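(* Let $\rho=(\alpha^{\pm};\beta^{\pm};\gamma^{\pm})$ be a specialization with $\alpha_i^-=\beta_i^-=0$ for all $i$, $\gamma^-=0$, and $\beta_1^+<1$. Then for every $\tau\ge 0$ the Markov semigroup $\mathbb{L}_\tau$ acts on the extreme Gibbs measure $\mathbb{P}[\vec 1\mid\rho]$ as $$\mathbb{P}[\vec 1\mid\rho]\,\mathbb{L}_\tau=\mathbb{P}[\vec 1\mid\hat\rho],$$ where $\hat\rho$ is the specialization with parameters $\hat\alpha_i^-=\hat\beta_i^-=0$, $\hat\gamma^-=0$ and $$\hat\alpha_i^+=\frac{\alpha_i^+e^{-\tau}}{1+\alpha_i^+-\alpha_i^+e^{-\tau}},\qquad \hat\beta_i^+=\frac{\beta_i^+e^{-\tau}}{1-\beta_i^++\beta_i^+e^{-\tau}},\qquad \hat\gamma^+=e^{-\tau}\gamma^+ .$$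
   Context: A specialization $\rho=(\alpha^\pm;\beta^\pm;\gamma^\pm)$ consists of real parameters $\alpha_1^\pm\ge\alpha_2^\pm\ge\dots\ge 0$, $\beta_1^\pm\ge\beta_2^\pm\ge\dots\ge 0$, $\gamma^\pm\ge 0$ with $\sum_i(\alpha_i^\pm+\beta_i^\pm)<\infty$ and $\beta_1^++\beta_1^-\le 1$. Define $\psi_n(\rho)$, $n\in\mathbb{Z}$, by $$\sum_{n\in\mathbb{Z}}\psi_n(\rho)u^n=e^{\gamma^+(u-1)+\gamma^-(u^{-1}-1)}\prod_{i\ge 1}\frac{1+\beta_i^+(u-1)}{1-\alpha_i^+(u-1)}\,\frac{1+\beta_i^-(u^{-1}-1)}{1-\alpha_i^-(u^{-1}-1)},\qquad |u|=1,$$ and for a signature $\lambda=(\lambda_1\ge\dots\ge\lambda_N)$, $\lambda_i\in\mathbb{Z}$, put $s_\lambda(\rho)=\det[\psi_{\lambda_i+j-i}(\rho)]_{i,j=1}^N$. An (infinite) interlacing array is a collection $\{\lambda^{(k)}_j\}_{1\le j\le k}$, $k\ge 1$, of integers with $\lambda^{(k+1)}_{j+1}\le\lambda^{(k)}_j\le\lambda^{(k+1)}_j$ for all $1\le j\le k$. The measure $\mathbb{P}[\vec 1\mid\rho]$ is the probability measure on interlacing arrays such that for every $N$ the probability of $(\lambda^{(1)},\dots,\lambda^{(N)})$ equals $s_{\lambda^{(N)}}(\rho)$ for every interlacing $\lambda^{(1)},\dots,\lambda^{(N)}$. For $\rho$ as in the claim, all $\lambda^{(k)}_j\ge0$ almost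 surely, and $\mathbb{P}[\vec 1\mid\rho]$ is supported on the set $\mathcal{S}^c$ defined next. $\mathcal{S}^c$ is the set of interlacing arrays with nonnegative entries such that there are $J(N)$ with $N-J(N)\to+\infty$ as $N\to+\infty$ and $\lambda^{(N)}_j=0$ for all $N$ and all $J(N)\le j\le N$. $\{\mathbb{L}_\tau\}_{\tau\ge 0}$ is the continuous-time Markov semigroup on $\mathcal{S}^c$ under which each $\lambda^{(k)}_j$, $1\le j\le k$, independently jumps to each of the locations $m\in\mathbb{Z}$ with $$\max\{\lambda^{(k+1)}_{j+1},\lambda^{(k-1)}_j\}\le m\le\lambda^{(k)}_j-1$$ at rate $k$ per location (for $j=k$ the term $\lambda^{(k-1)}_k$ is omitted from the maximum). It is well defined: for each $K$, the evolution of $\{\lambda^{(N)}_j: N\ge 1,\ N-K+1\le j\le N\}$ is an autonomous Markov process in which only finitely many particles jump in finite time, and these processes are compatible for different $K$. *)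

theory Defs
  imports "HOL-Probability.Probability" "Jordan_Normal_Form.Determinant"
begin

section \<open>Specializations\<close>

text \<open>The parameters are indexed from 0: the \<open>i\<close>-th entry of each sequence is the
  parameter with index \<open>i + 1\<close> in the usual numbering.\<close>

record specialization =
  alpha_plus :: "nat \<Rightarrow> real"
  alpha_minus :: "nat \<Rightarrow> real"
  beta_plus :: "nat \<Rightarrow> real"
  beta_minus :: "nat \<Rightarrow> real"
  gamma_plus :: real
  gamma_minus :: real

definition is_specialization :: "specialization \<Rightarrow> bool" where
  "is_specialization \<rho> \<longleftrightarrow>
     decseq (alpha_plus \<rho>) \<and> (\<forall>i. alpha_plus \<rho> i \<ge> 0) \<and> summable (alpha_plus \<rho>) \<and>
     decseq (alpha_minus \<rho>) \<and> (\<forall>i. alpha_minus \<rho> i \<ge> 0) \<and> summable (alpha_minus \<rho>) \<and>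
     decseq (beta_plus \<rho>) \<and> (\<forall>i. beta_plus \<rho> i \<ge> 0) \<and> summable (beta_plus \<rho>) \<and>
     decseq (beta_minus \<rho>) \<and> (\<forall>i. beta_minus \<rho> i \<ge> 0) \<and> summable (beta_minus \<rho>) \<and>
     gamma_plus \<rho> \<ge> 0 \<and> gamma_minus \<rho> \<ge> 0 \<and>
     beta_plus \<rho> 0 + beta_minus \<rho> 0 \<le> 1"

definition spec_gen_fun :: "specialization \<Rightarrow> complex \<Rightarrow> complex" where
  "spec_gen_fun \<rho> u =
     exp (of_real (gamma_plus \<rho>) * (u - 1) + of_real (gamma_minus \<rho>) * (inverse u - 1)) *
     (\<Prod>i. (1 + of_real (beta_plus \<rho> i) * (u - 1)) / (1 - of_real (alpha_plus \<rho> i) * (u - 1)) *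
          ((1 + of_real (beta_minus \<rho> i) * (inverse u - 1)) /
           (1 - of_real (alpha_minus \<rho> i) * (inverse u - 1))))"

definition spec_psi :: "specialization \<Rightarrow> int \<Rightarrow> real" where
  "spec_psi \<rho> = (THE \<psi>. \<forall>u::complex. norm u = 1 \<longrightarrow>
     ((\<lambda>n::int. of_real (\<psi> n) * u powi n) has_sum spec_gen_fun \<rho> u) UNIV)"

text \<open>A signature with \<open>N\<close> parts is given by the values at \<open>1, \<dots>, N\<close> of a function on the
  natural numbers. Matrix indices start from 0, which does not affect \<open>j - i\<close>.\<close>

definition spec_schur :: "specialization \<Rightarrow> nat \<Rightarrow> (nat \<Rightarrow> int) \<Rightarrow> real" where
  "spec_schur \<rho> N l =
     Determinant.det (Matrix.mat N N (\<lambda>(i, j). spec_psi \<rho> (l (Suc i) + int j - int i)))"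


section \<open>Interlacing arrays\<close>

text \<open>The entry of the array \<open>x\<close> at level \<open>k\<close> and position \<open>j\<close>, with \<open>1 \<le> j \<le> k\<close>, is
  \<open>x (k, j)\<close>.\<close>

type_synonym array = "nat \<times> nat \<Rightarrow> int"

definition array_index :: "(nat \<times> nat) set" where
  "array_index = {(k, j). 1 \<le> j \<and> j \<le> k}"

definition interlacing_arrays :: "array set" where
  "interlacing_arrays = {x \<in> extensional array_index.
     \<forall>k j. 1 \<le> j \<and> j \<le> k \<longrightarrow> x (Suc k, Suc j) \<le> x (k, j) \<and> x (k, j) \<le> x (Suc k, j)}"

definition array_space :: "array measure" where
  "array_space = restrict_space (Pi\<^sub>M array_index (\<lambda>_. count_space UNIV)) interlacing_arrays"

definition interlacing_upto :: "nat \<Rightarrow> array \<Rightarrow> bool" where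
  "interlacing_upto N l \<longleftrightarrow>
     (\<forall>k j. 1 \<le> j \<and> j \<le> k \<and> k < N \<longrightarrow> l (Suc k, Suc j) \<le> l (k, j) \<and> l (k, j) \<le> l (Suc k, j))"

definition cylinder :: "nat \<Rightarrow> array \<Rightarrow> array set" where
  "cylinder N l = {x \<in> interlacing_arrays. \<forall>k j. 1 \<le> j \<and> j \<le> k \<and> k \<le> N \<longrightarrow> x (k, j) = l (k, j)}"

text \<open>\<open>is_gibbs_measure \<rho> M\<close> says that \<open>M\<close> is the measure \<open>\<P>[1 | \<rho>]\<close>. By
  \<open>is_gibbs_measure_unique\<close> below there is at most one such \<open>M\<close>.\<close>

definition is_gibbs_measure :: "specialization \<Rightarrow> array measure \<Rightarrow> bool" where
  "is_gibbs_measure \<rho> M \<longleftrightarrow>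
     prob_space M \<and> sets M = sets array_space \<and>
     (\<forall>N l. interlacing_upto N l \<longrightarrow>
        measure M (cylinder N l) = spec_schur \<rho> N (\<lambda>j. l (N, j)))"

lemma space_array_space: "space array_space = interlacing_arrays"
proof -
  have "interlacing_arrays \<subseteq> Pi\<^sub>E array_index (\<lambda>_. UNIV)"
    by (simp add: interlacing_arrays_def PiE_def subset_iff)
  then show ?thesis by (simp add: array_space_def space_restrict_space space_PiM Int_absorb2)
qed

lemma coord_set_in_sets:
  assumes "i \<in> array_index"
  shows "{x \<in> interlacing_arrays. x i \<in> A} \<in> sets array_space"
proof -
  have "(\<lambda>x. x i) \<in> measurable (Pi\<^sub>M array_index (\<lambda>_. count_space UNIV)) (count_space (UNIV :: int set))"
    by (rule measurable_component_singleton[OF assms])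
  then have "(\<lambda>x. x i) \<in> measurable array_space (count_space (UNIV :: int set))"
    unfolding array_space_def by (rule measurable_restrict_space1)
  then have "(\<lambda>x. x i) -` A \<inter> space array_space \<in> sets array_space"
    by (rule measurable_sets) simp
  then show ?thesis
    by (simp add: space_array_space vimage_def Int_def conj_commute)
qed

lemma finite_array_index_upto: "finite {i \<in> array_index. fst i \<le> N}"
  by (rule finite_subset[of _ "{..N} \<times> {..N}"]) (auto simp: array_index_def)

lemma cylinder_in_sets: "cylinder N l \<in> sets array_space"
proof -
  have "cylinder N l =
      {x \<in> space array_space. \<forall>i\<in>{i \<in> array_index. fst i \<le> N}. x i \<in> {l i}}"
    by (auto simp: cylinder_def array_index_def space_array_space)
  also have "\<dots> \<in> sets array_space"
  proof (rule sets.sets_Collect_finite_All)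
    fix i assume "i \<in> {i \<in> array_index. fst i \<le> N}"
    then show "{x \<in> space array_space. x i \<in> {l i}} \<in> sets array_space"
      unfolding space_array_space by (intro coord_set_in_sets) auto
  qed (rule finite_array_index_upto)
  finally show ?thesis .
qed

lemma cylinder_Int:
  assumes "M \<le> N"
  shows "cylinder M l \<inter> cylinder N l' = {} \<or> cylinder M l \<inter> cylinder N l' = cylinder N l'"
proof (cases "\<forall>k j. 1 \<le> j \<and> j \<le> k \<and> k \<le> M \<longrightarrow> l (k, j) = l' (k, j)")
  case True
  then show ?thesis using assms by (auto simp: cylinder_def)
next
  case False
  then obtain k j where "1 \<le> j" "j \<le> k" "k \<le> M" "l (k, j) \<noteq> l' (k, j)" by blast
  then show ?thesis using assms by (auto simp: cylinder_def)
qed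

lemma Int_stable_cylinders: "Int_stable (insert {} (range (case_prod cylinder)))"
proof (rule Int_stableI)
  fix A B assume A: "A \<in> insert {} (range (case_prod cylinder))"
    and B: "B \<in> insert {} (range (case_prod cylinder))"
  show "A \<inter> B \<in> insert {} (range (case_prod cylinder))"
  proof (cases "A = {} \<or> B = {}")
    case False
    then obtain M l N l' where eq: "A = cylinder M l" "B = cylinder N l'"
      using A B by auto
    show ?thesis
    proof (cases "M \<le> N")
      case True
      then show ?thesis using cylinder_Int[of M N l l'] A B eq by auto
    next
      case False
      then show ?thesis using cylinder_Int[of N M l' l] A B eq by (auto simp: Int_commute)
    qed
  qed auto
qed

lemma sets_array_space:
  "sets array_space = sigma_sets interlacing_arrays (insert {} (range (case_prod cylinder)))"
    (is "_ = sigma_sets _ ?E")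
proof
  have sub: "?E \<subseteq> Pow interlacing_arrays" by (auto simp: cylinder_def)
  let ?S = "sigma interlacing_arrays ?E"
  have sets_S: "sets ?S = sigma_sets interlacing_arrays ?E" and space_S: "space ?S = interlacing_arrays"
    using sub by (simp_all add: space_measure_of_conv)
  have cyl: "cylinder N l \<in> sets ?S" for N l
    unfolding sets_S by (rule sigma_sets.Basic) auto
  show "sigma_sets interlacing_arrays ?E \<subseteq> sets array_space"
    unfolding space_array_space[symmetric]
    by (rule sets.sigma_sets_subset) (auto simp: cylinder_in_sets)
  have coord: "(\<lambda>x. x i) \<in> measurable ?S (count_space UNIV)" if i: "i \<in> array_index" for i
  proof -
    have "(\<lambda>x. x i) -` {c} \<inter> space ?S \<in> sets ?S" for c :: int
    proof -
      let ?T = "{i' \<in> array_index. fst i' \<le> fst i}"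
      let ?L = "{l \<in> Pi\<^sub>E ?T (\<lambda>_. UNIV :: int set). l i = c}"
      have "countable (Pi\<^sub>E ?T (\<lambda>_. UNIV :: int set))"
        by (rule countable_PiE) (simp_all add: finite_array_index_upto)
      then have cL: "countable ?L" by (rule countable_subset[rotated]) auto
      have "(\<lambda>x. x i) -` {c} \<inter> space ?S = (\<Union>l\<in>?L. cylinder (fst i) l)"
      proof (intro equalityI subsetI)
        fix x assume x: "x \<in> (\<lambda>x. x i) -` {c} \<inter> space ?S"
        then have "restrict x ?T \<in> ?L" using i by auto
        moreover have "x \<in> cylinder (fst i) (restrict x ?T)"
          using x space_S by (auto simp: cylinder_def array_index_def)
        ultimately show "x \<in> (\<Union>l\<in>?L. cylinder (fst i) l)" by blast
      next
        fix x assume "x \<in> (\<Union>l\<in>?L. cylinder (fst i) l)"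
        then show "x \<in> (\<lambda>x. x i) -` {c} \<inter> space ?S"
          using i space_S by (cases i) (auto simp: cylinder_def array_index_def)
      qed
      also have "\<dots> \<in> sets ?S" using cL cyl by (intro sets.countable_UN') auto
      finally show ?thesis .
    qed
    then show ?thesis
      by (subst measurable_count_space_eq_countable) (auto simp del: sets_measure_of)
  qed
  have "(\<lambda>x. x) \<in> measurable ?S array_space"
    unfolding array_space_def
  proof (rule measurable_restrict_space2)
    show "(\<lambda>x. x) \<in> space ?S \<rightarrow> interlacing_arrays" using space_S by auto
    show "(\<lambda>x. x) \<in> measurable ?S (Pi\<^sub>M array_index (\<lambda>_. count_space UNIV))"
    proof (rule measurable_PiM_single')
      show "(\<lambda>x i. x i) \<in> space ?S \<rightarrow> Pi\<^sub>E array_index (\<lambda>_. space (count_space UNIV))"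
        unfolding space_S by (simp add: interlacing_arrays_def PiE_def)
    qed (rule coord)
  qed
  note id_measurable = this
  have "A \<in> sets ?S" if "A \<in> sets array_space" for A
  proof -
    have "(\<lambda>x. x) -` A \<inter> space ?S \<in> sets ?S"
      using id_measurable that by (rule measurable_sets)
    moreover have "(\<lambda>x. x) -` A \<inter> space ?S = A"
      using sets.sets_into_space[OF that] unfolding space_S space_array_space by blast
    ultimately show ?thesis by (simp only:)
  qed
  then show "sets array_space \<subseteq> sigma_sets interlacing_arrays ?E"
    unfolding sets_S by (rule subsetI)
qed

lemma is_gibbs_measure_unique:
  assumes "is_gibbs_measure \<rho> M" "is_gibbs_measure \<rho> M'"
  shows "M = M'"
proof -
  let ?E = "insert {} (range (case_prod cylinder))"
  interpret M: prob_space M using assms by (simp add: is_gibbs_measure_def)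
  interpret M': prob_space M' using assms by (simp add: is_gibbs_measure_def)
  have eq: "emeasure M (cylinder N l) = emeasure M' (cylinder N l)" for N l
  proof (cases "interlacing_upto N l")
    case True
    then have "measure M (cylinder N l) = measure M' (cylinder N l)"
      using assms by (simp add: is_gibbs_measure_def)
    then show ?thesis by (simp add: M.emeasure_eq_measure M'.emeasure_eq_measure)
  next
    case False
    then obtain k j where kj: "1 \<le> j" "j \<le> k" "k < N"
      "\<not> (l (Suc k, Suc j) \<le> l (k, j) \<and> l (k, j) \<le> l (Suc k, j))"
      by (auto simp: interlacing_upto_def)
    have "x \<notin> cylinder N l" for x
    proof
      assume x: "x \<in> cylinder N l"
      have *: "x (k', j') = l (k', j')" if "1 \<le> j'" "j' \<le> k'" "k' \<le> N" for k' j'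
        using x that by (auto simp: cylinder_def)
      have "x (Suc k, Suc j) = l (Suc k, Suc j)" "x (k, j) = l (k, j)" "x (Suc k, j) = l (Suc k, j)"
        using kj by (auto intro: *)
      moreover have "x (Suc k, Suc j) \<le> x (k, j) \<and> x (k, j) \<le> x (Suc k, j)"
      proof -
        have "x \<in> interlacing_arrays" using x by (simp add: cylinder_def)
        then show ?thesis using kj by (simp add: interlacing_arrays_def)
      qed
      ultimately show False using kj by simp
    qed
    then have "cylinder N l = {}" by auto
    then show ?thesis by simp
  qed
  have sets: "sets M = sigma_sets interlacing_arrays ?E" "sets M' = sigma_sets interlacing_arrays ?E"
    using assms by (simp_all add: is_gibbs_measure_def sets_array_space)
  have top: "cylinder 0 (\<lambda>_. 0) = interlacing_arrays" by (auto simp: cylinder_def)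
  show ?thesis
  proof (rule measure_eqI_generator_eq_countable[OF Int_stable_cylinders _ _ sets])
    show "?E \<subseteq> Pow interlacing_arrays" by (auto simp: cylinder_def)
    show "emeasure M X = emeasure M' X" if "X \<in> ?E" for X
      using that eq by auto
    show "{cylinder 0 (\<lambda>_. 0)} \<subseteq> ?E" by (auto intro: rev_image_eqI[of "(0, \<lambda>_. 0)"])
    show "\<Union>{cylinder 0 (\<lambda>_. 0)} = interlacing_arrays" by (simp add: top)
    show "countable {cylinder 0 (\<lambda>_. 0 :: int)}" by simp
    show "emeasure M X \<noteq> \<infinity>" if "X \<in> {cylinder 0 (\<lambda>_. 0)}" for X
      by (simp add: M.emeasure_eq_measure)
  qed
qed


section \<open>The backwards dynamics\<close>

definition eventually_zero_arrays :: "array set"  (\<open>\<S>\<^sup>c\<close>) where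
  "\<S>\<^sup>c = {x \<in> interlacing_arrays. (\<forall>i\<in>array_index. 0 \<le> x i) \<and>
     (\<exists>J :: nat \<Rightarrow> int. filterlim (\<lambda>N. int N - J N) at_top sequentially \<and>
        (\<forall>N j. 1 \<le> j \<and> j \<le> N \<and> J N \<le> int j \<longrightarrow> x (N, j) = 0))}"

text \<open>The indices of the \<open>min K N\<close> rightmost entries of each level \<open>N\<close>.\<close>

definition strip :: "nat \<Rightarrow> (nat \<times> nat) set" where
  "strip K = {(N, j). 1 \<le> j \<and> j \<le> N \<and> N < j + K}"

definition jump_allowed :: "array \<Rightarrow> nat \<Rightarrow> nat \<Rightarrow> int \<Rightarrow> bool" where
  "jump_allowed x k j m \<longleftrightarrow>
     x (Suc k, Suc j) \<le> m \<and> (j < k \<longrightarrow> x (k - 1, j) \<le> m) \<and> m \<le> x (k, j) - 1"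

text \<open>The generator of the dynamics restricted to the coordinates in \<open>strip K\<close>. The conditions
  in \<open>jump_allowed x k j m\<close> for \<open>(k, j) \<in> strip K\<close> only involve coordinates in \<open>strip K\<close>.
  For \<open>x\<close> the restriction of an element of \<open>\<S>\<^sup>c\<close> to \<open>strip K\<close>, all but finitely many coordinates
  in the strip vanish, so the set of possible jumps is finite; moreover only finitely many
  states can be reached from \<open>x\<close>, as the coordinates only decrease.\<close>

definition strip_moves :: "nat \<Rightarrow> array \<Rightarrow> ((nat \<times> nat) \<times> int) set" where
  "strip_moves K x = {((k, j), m). (k, j) \<in> strip K \<and> jump_allowed x k j m}"

definition strip_generator :: "nat \<Rightarrow> (array \<Rightarrow> real) \<Rightarrow> array \<Rightarrow> real" where
  "strip_generator K f x =
     (\<Sum>((k, j), m)\<in>strip_moves K x. real k * (f (x((k, j) := m)) - f x))"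

text \<open>The transition function \<open>p\<^sub>t(x, y)\<close> of the continuous-time Markov chain on \<open>strip K\<close>: the
  \<open>(x, y)\<close> entry of \<open>exp (t G)\<close>, with \<open>G\<close> the generator. By the previous remark this is the
  exponential of a finite matrix, indexed by the states reachable from \<open>x\<close>.\<close>

definition strip_transition :: "nat \<Rightarrow> real \<Rightarrow> array \<Rightarrow> array \<Rightarrow> real" where
  "strip_transition K t x y =
     (\<Sum>n. t ^ n / fact n * (strip_generator K ^^ n) (\<lambda>z. if z = y then 1 else 0) x)"

text \<open>\<open>L\<close> is the family of Markov kernels on \<open>\<S>\<^sup>c\<close> under which, for each \<open>K\<close>, the coordinates in
  \<open>strip K\<close> evolve as the above chain. The events below, for all \<open>K\<close> and \<open>y\<close>, are closed under
  non-empty intersections and generate the \<open>\<sigma>\<close>-algebra, so \<open>L \<tau> x\<close> is determined for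
  all \<open>\<tau> \<ge> 0\<close> and \<open>x \<in> \<S>\<^sup>c\<close>; \<open>L 0 x\<close> is the point mass at \<open>x\<close>, and the semigroup property is
  inherited from the chains.\<close>

definition is_backward_semigroup :: "(real \<Rightarrow> array \<Rightarrow> array measure) \<Rightarrow> bool" where
  "is_backward_semigroup L \<longleftrightarrow>
     (\<forall>\<tau>\<ge>0. L \<tau> \<in> restrict_space array_space \<S>\<^sup>c \<rightarrow>\<^sub>M prob_algebra (restrict_space array_space \<S>\<^sup>c)) \<and>
     (\<forall>\<tau>\<ge>0. \<forall>K. \<forall>x\<in>\<S>\<^sup>c. \<forall>y\<in>\<S>\<^sup>c.
        measure (L \<tau> x) {z \<in> \<S>\<^sup>c. restrict z (strip K) = restrict y (strip K)} =
          strip_transition K \<tau> (restrict x (strip K)) (restrict y (strip K)))"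

text \<open>The action of a kernel on \<open>\<S>\<^sup>c\<close> on a measure on the space of all interlacing arrays. The
  result is a probability measure only if \<open>M\<close> is supported on \<open>\<S>\<^sup>c\<close>; otherwise the mass outside
  of \<open>\<S>\<^sup>c\<close> is lost.\<close>

definition kernel_action :: "array measure \<Rightarrow> (array \<Rightarrow> array measure) \<Rightarrow> array measure" where
  "kernel_action M \<kappa> = distr (restrict_space M \<S>\<^sup>c \<bind> \<kappa>) array_space (\<lambda>x. x)"

definition backward_spec :: "real \<Rightarrow> specialization \<Rightarrow> specialization" where
  "backward_spec \<tau> \<rho> = \<lparr>
     alpha_plus = (\<lambda>i. alpha_plus \<rho> i * exp (- \<tau>) / (1 + alpha_plus \<rho> i - alpha_plus \<rho> i * exp (- \<tau>))),
     alpha_minus = (\<lambda>_. 0),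
     beta_plus = (\<lambda>i. beta_plus \<rho> i * exp (- \<tau>) / (1 - beta_plus \<rho> i + beta_plus \<rho> i * exp (- \<tau>))),
     beta_minus = (\<lambda>_. 0),
     gamma_plus = exp (- \<tau>) * gamma_plus \<rho>,
     gamma_minus = 0\<rparr>"

end

theory Submission
  imports Defs "HOL-Complex_Analysis.Cauchy_Integral_Formula"
begin

text \<open>The generating function of the transformed specialization is \<open>F(q u) / F(q)\<close> with
  \<open>q = exp (- \<tau>)\<close>. Writing \<open>|x\<^sub>n|\<close> for the sum of level \<open>n\<close>, it follows that on the first \<open>n\<close>
  levels the transformed measure has the density \<open>q^|x\<^sub>n| / F(q)^n\<close> with respect to the original
  one. Given its neighbouring levels, each entry is uniform on an interval, so the adjoint of the
  generator of the jumps at levels up to \<open>n\<close> is found by exchanging the positions before and after a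
  jump. Weighted with the rates \<open>k\<close>, the divergences of the levels telescope to
  \<open>n |x\<^sub>n\<^sub>+\<^sub>1| - (n + 1) |x\<^sub>n|\<close>. By the branching rule, \<open>|x\<^sub>n\<^sub>+\<^sub>1| - |x\<^sub>n|\<close> is independent of the first
  \<open>n\<close> levels and has the generating function \<open>F\<close>; hence the divergence averages to the time
  derivative of the density. The jumps at level \<open>n\<close>, which the first \<open>n\<close> levels do not determine,
  contribute an error of order \<open>n\<close> times the size of the last \<open>K\<close> entries of that level. These decay
  geometrically, because independently of the past a level is repeated with a zero appended with
  probability \<open>\<psi>\<^sub>0 > 0\<close>.\<close>

section \<open>The generating function of a one-sided specialization\<close>

text \<open>The first n levels are not autonomous, since a jump at level n can be blocked by level n
  + 1, and the kernel is only known through chains on strips, which see infinitely many levels. So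
  the evolved measure is never differentiated itself. For fixed n the proof follows, as a function
  of s, the expectation under \<open>M\<close> of the density at time s times the probability that
  the dynamics, started from the first n levels continued by appended zeros and run for the
  remaining time \<tau> - s, ends in a given cylinder. At s = \<tau> this is the claimed
  probability, at s = 0 it tends to the true one as n grows. In the derivative all levels below n
  cancel; what is left at level n is at most a constant times n r^n with r = 1 - \<psi>_0 / 2,
  uniformly in s. The condition \<beta>_1 < 1 enters through F(0) = \<psi>_0 > 0, which bounds the
  densities and makes the right edge vanish; a radius of convergence above 1 gives the finite
  means.\<close>

lemma sum_roots_of_unity_powi:
  fixes m :: nat and r :: int
  assumes "m > 0"
  shows "(\<Sum>j<m. cis (2 * pi * real j / real m) powi r) = (if int m dvd r then of_nat m else 0)"
proof -
  let ?w = "cis (2 * pi * of_int r / real m)"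
  have *: "cis (2 * pi * real j / real m) powi r = ?w ^ j" for j
  proof -
    have "cis (2 * pi * real j / real m) powi r = cis (of_int r * (2 * pi * real j / real m))"
      by (simp add: cis_power_int)
    also have "\<dots> = cis (real j * (2 * pi * of_int r / real m))"
      by (simp add: field_simps)
    also have "\<dots> = ?w ^ j" by (rule Complex.DeMoivre[symmetric])
    finally show ?thesis .
  qed
  have w1: "?w = 1 \<longleftrightarrow> int m dvd r"
  proof
    assume "?w = 1"
    then obtain k :: int where "2 * pi * of_int r / real m = 2 * pi * of_int k"
      by (auto simp: complex_eq_iff cos_one_2pi_int mult_ac)
    then have "of_int r = (of_int k * real m :: real)"
      using assms by (simp add: field_simps)
    then have "r = k * int m"
      by (metis of_int_eq_iff of_int_mult of_int_of_nat_eq)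
    then show "int m dvd r" by simp
  next
    assume "int m dvd r"
    then obtain k where "r = int m * k" by blast
    then have "2 * pi * of_int r / real m = 2 * pi * of_int k" using assms by simp
    then show "?w = 1" by (simp add: complex_eq_iff cos_int_2pin sin_int_2pin)
  qed
  have "?w ^ m = 1"
  proof -
    have "?w ^ m = cis (2 * pi * of_int r)" using assms by (simp add: Complex.DeMoivre)
    then show ?thesis by (simp add: complex_eq_iff cos_int_2pin sin_int_2pin)
  qed
  then have "(\<Sum>j<m. ?w ^ j) = (if ?w = 1 then of_nat m else 0)"
    by (simp add: geometric_sum)
  then show ?thesis by (simp only: * w1)
qed

lemma has_sum_sum:
  fixes f :: "'i \<Rightarrow> 'b \<Rightarrow> 'a :: topological_comm_monoid_add"
  assumes "finite J" "\<And>j. j \<in> J \<Longrightarrow> (f j has_sum s j) A"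
  shows "((\<lambda>n. \<Sum>j\<in>J. f j n) has_sum (\<Sum>j\<in>J. s j)) A"
  using assms by (induction J rule: finite_induct) (auto intro!: has_sum_add)

text \<open>A Fourier coefficient is extracted without integration. Averaging the series times u
  powi (- k) over the m-th roots of unity keeps exactly the indices congruent to k modulo m. For
  suitable m these avoid, apart from k itself, a finite set X that carries all but less than
  \<open>norm (d k)\<close> of the absolute sum.\<close>

lemma circle_series_zero:
  fixes d :: "int \<Rightarrow> complex"
  assumes "\<And>u. norm u = 1 \<Longrightarrow> ((\<lambda>n. d n * u powi n) has_sum 0) UNIV"
  shows "d k = 0"
proof (rule ccontr)
  assume "d k \<noteq> 0"
  have "(d has_sum 0) UNIV" using assms[of 1] by simp
  then have abs: "(\<lambda>n. norm (d n)) summable_on UNIV"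
    by (metis has_sum_imp_summable summable_on_iff_abs_summable_on_complex)
  define S where "S = infsum (\<lambda>n. norm (d n)) UNIV"
  have "((\<lambda>n. norm (d n)) has_sum S) UNIV" using abs S_def by simp
  then have "eventually (\<lambda>Y. dist (\<Sum>n\<in>Y. norm (d n)) S < norm (d k)) (finite_subsets_at_top UNIV)"
    using \<open>d k \<noteq> 0\<close> unfolding has_sum_def by (intro tendstoD) auto
  then have "\<exists>X. finite X \<and> (\<forall>Y. finite Y \<and> X \<subseteq> Y \<longrightarrow> dist (\<Sum>n\<in>Y. norm (d n)) S < norm (d k))"
    by (simp add: eventually_finite_subsets_at_top)
  then obtain X where "finite X \<and> (\<forall>Y. finite Y \<and> X \<subseteq> Y \<longrightarrow> dist (\<Sum>n\<in>Y. norm (d n)) S < norm (d k))" ..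
  then have X: "finite X" "dist (\<Sum>n\<in>X. norm (d n)) S < norm (d k)" by simp_all
  \<comment> \<open>This m exceeds the distance from k to every point of X, so X meets the residue
    class of k at most in k. A sum instead of a maximum also covers the empty set.\<close>
  define m where "m = nat (1 + (\<Sum>n\<in>X. \<bar>n - k\<bar>))"
  have m0: "m > 0" unfolding m_def by (smt (verit) sum_nonneg abs_ge_zero zero_less_nat_eq)
  have mX: "\<bar>n - k\<bar> < int m" if "n \<in> X" for n
  proof -
    have "\<bar>n - k\<bar> \<le> (\<Sum>n\<in>X. \<bar>n - k\<bar>)"
      using that X(1) by (intro member_le_sum) auto
    then show ?thesis unfolding m_def by linarith
  qed
  define P where "P = {n. int m dvd n - k}"
  have "((\<lambda>n. \<Sum>j<m. d n * cis (2 * pi * real j / real m) powi n * cis (2 * pi * real j / real m) powi (-k)) has_sum (\<Sum>j<m. 0 * cis (2 * pi * real j / real m) powi (-k))) UNIV"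
    by (intro has_sum_sum has_sum_cmult_left assms) auto
  moreover have "(\<Sum>j<m. d n * cis (2 * pi * real j / real m) powi n * cis (2 * pi * real j / real m) powi (-k))
     = of_nat m * (if n \<in> P then d n else 0)" for n
  proof -
    have "(\<Sum>j<m. d n * cis (2 * pi * real j / real m) powi n * cis (2 * pi * real j / real m) powi (-k))
       = d n * (\<Sum>j<m. cis (2 * pi * real j / real m) powi (n - k))"
      by (simp add: sum_distrib_left mult.assoc power_int_diff field_simps power_int_minus)
    then show ?thesis by (simp add: sum_roots_of_unity_powi[OF m0] P_def)
  qed
  ultimately have "((\<lambda>n. of_nat m * (if n \<in> P then d n else 0)) has_sum 0) UNIV" by simp
  then have "((\<lambda>n. inverse (of_nat m) * (of_nat m * (if n \<in> P then d n else 0))) has_sum inverse (of_nat m) * 0) UNIV"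
    by (rule has_sum_cmult_right)
  then have "((\<lambda>n. if n \<in> P then d n else 0) has_sum 0) UNIV" using m0 by (simp add: mult.assoc[symmetric])
  then have P0: "(d has_sum 0) P"
    by (rule has_sum_cong_neutral[THEN iffD1, rotated -1]) auto
  have kP: "k \<in> P" by (simp add: P_def)
  have "(d has_sum (0 - d k)) (P - {k})"
    by (rule has_sum_Diff[OF P0 has_sum_finiteI]) (use kP in auto)
  then have "norm (d k) \<le> infsum (\<lambda>n. norm (d n)) (P - {k})"
    using norm_infsum_bound[of d "P - {k}"] abs
    by (metis infsumI norm_minus_cancel diff_0 summable_on_subset_banach subset_UNIV)
  also have "\<dots> \<le> infsum (\<lambda>n. norm (d n)) (- X)"
  proof (rule infsum_mono2)
    show "P - {k} \<subseteq> - X"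
    proof (safe, rule ccontr)
      fix n assume "n \<in> P" "n \<in> X" "n \<noteq> k"
      then have "int m dvd \<bar>n - k\<bar>" "\<bar>n - k\<bar> > 0" by (auto simp: P_def)
      then have "int m \<le> \<bar>n - k\<bar>" using zdvd_imp_le by blast
      then show False using mX \<open>n \<in> X\<close> by force
    qed
  qed (auto intro: summable_on_subset_banach[OF abs])
  also have "\<dots> = S - (\<Sum>n\<in>X. norm (d n))"
  proof -
    have "infsum (\<lambda>n. norm (d n)) (UNIV - X) = S - infsum (\<lambda>n. norm (d n)) X"
      unfolding S_def using X(1) abs by (intro infsum_Diff) auto
    then show ?thesis using X(1) by (simp add: Compl_eq_Diff_UNIV)
  qed
  also have "\<dots> < norm (d k)" using X(2) by (simp add: dist_real_def)
  finally show False by simp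
qed

lemma circle_series_unique:
  fixes a b :: "int \<Rightarrow> complex"
  assumes "\<And>u. norm u = 1 \<Longrightarrow> ((\<lambda>n. a n * u powi n) has_sum F u) UNIV"
    and "\<And>u. norm u = 1 \<Longrightarrow> ((\<lambda>n. b n * u powi n) has_sum F u) UNIV"
  shows "a = b"
proof
  fix k
  have "((\<lambda>n. (a n - b n) * u powi n) has_sum 0) UNIV" if "norm u = 1" for u
    using has_sum_add[OF assms(1)[OF that] has_sum_uminusI[OF assms(2)[OF that]]]
    by (simp add: left_diff_distrib)
  from circle_series_zero[OF this] show "a k = b k" by simp
qed

text \<open>Uniqueness on the circle makes the definite description usable: it is enough to exhibit
  coefficients.\<close>

lemma spec_psi_eqI:
  assumes "\<And>u. norm u = 1 \<Longrightarrow> ((\<lambda>n. of_real (\<psi> n) * u powi n) has_sum spec_gen_fun \<rho> u) UNIV"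
  shows "spec_psi \<rho> = \<psi>"
  unfolding spec_psi_def
proof (rule the_equality)
  fix \<phi> :: "int \<Rightarrow> real"
  assume "\<forall>u. norm u = 1 \<longrightarrow> ((\<lambda>n. of_real (\<phi> n) * u powi n) has_sum spec_gen_fun \<rho> u) UNIV"
  then have "(\<lambda>n. complex_of_real (\<phi> n)) = (\<lambda>n. of_real (\<psi> n))"
    using assms by (intro circle_series_unique) blast+
  then show "\<phi> = \<psi>" by (metis of_real_eq_iff ext)
qed (use assms in blast)

text \<open>\<open>spec_psi\<close> asks for unordered sums over the integers, whereas Taylor series
  are ordered sums over the naturals; absolute summability bridges the two.\<close>

lemma has_sum_int_of_sums_nat:
  fixes c :: "nat \<Rightarrow> complex"
  assumes "summable (\<lambda>n. norm (c n))" "norm u = 1" "(\<lambda>n. c n * u ^ n) sums s"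
  shows "((\<lambda>n::int. (if n < 0 then 0 else c (nat n)) * u powi n) has_sum s) UNIV"
proof -
  have "((\<lambda>n. c n * u ^ n) has_sum s) UNIV"
    using assms by (intro norm_summable_imp_has_sum) (auto simp: norm_mult norm_power)
  then have "((\<lambda>n::int. c (nat n) * u powi n) has_sum s) (range int)"
    by (subst has_sum_reindex) (auto simp: o_def)
  then show ?thesis
  proof (rule has_sum_cong_neutral[THEN iffD1, rotated -1])
    fix n :: int assume "n \<in> UNIV - range int"
    then have "n < 0" by (metis DiffD2 int_nat_eq linorder_not_less rangeI)
    then show "(if n < 0 then 0 else c (nat n)) * u powi n = 0" by simp
  qed auto
qed

section \<open>Convergence and holomorphy of the product beyond the unit circle\<close>

definition plus_factor :: "real \<Rightarrow> real \<Rightarrow> complex \<Rightarrow> complex" where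
  "plus_factor a b u = (1 + of_real b * (u - 1)) / (1 - of_real a * (u - 1))"

text \<open>The radius \<open>1 + 1 / (A + 1)\<close> is smaller than all poles \<open>1 + 1 / a\<close> with \<open>a \<le> A\<close>, and it
  also makes sense for \<open>A = 0\<close>.\<close>

lemma norm_plus_denominator:
  fixes u :: complex
  assumes "0 \<le> a" "a \<le> A" "norm u < 1 + 1 / (A + 1)"
  shows "1 / (A + 1) \<le> norm (1 - of_real a * (u - 1))"
proof -
  have "a * (Re u - 1) \<le> A * (1 / (A + 1))"
  proof (cases "Re u \<ge> 1")
    case True
    have "Re u - 1 \<le> 1 / (A + 1)" using complex_Re_le_cmod[of u] assms(3) by linarith
    then show ?thesis using assms True by (intro mult_mono) auto
  next
    case False
    then have "a * (Re u - 1) \<le> 0" using assms by (intro mult_nonneg_nonpos) auto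
    also have "0 \<le> A * (1 / (A + 1))" using assms by auto
    finally show ?thesis .
  qed
  also have "A * (1 / (A + 1)) = 1 - 1 / (A + 1)" using assms by (simp add: field_simps)
  finally have "1 / (A + 1) \<le> Re (1 - of_real a * (u - 1))" by simp
  then show ?thesis using complex_Re_le_cmod order_trans by blast
qed

text \<open>The difference is (a + b) (u - 1) over the denominator, and norm (u - 1) \<le> 3 as the
  disc has radius at most 2. The result is one summable majorant for the whole disc, which gives
  convergence of the product at each point as well as local uniform convergence.\<close>

lemma norm_plus_factor_minus_one:
  fixes u :: complex
  assumes "0 \<le> a" "a \<le> A" "0 \<le> b" "norm u < 1 + 1 / (A + 1)"
  shows "norm (plus_factor a b u - 1) \<le> (a + b) * (3 * (A + 1))"
proof -
  have d: "1 / (A + 1) \<le> norm (1 - of_real a * (u - 1))"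
    by (rule norm_plus_denominator) (use assms in auto)
  have A: "0 < 1 / (A + 1)" using assms by simp
  have ne: "1 - of_real a * (u - 1) \<noteq> 0" using d A by auto
  have "plus_factor a b u - 1 = of_real (a + b) * (u - 1) / (1 - of_real a * (u - 1))"
    using ne by (simp add: plus_factor_def field_simps)
  then have "norm (plus_factor a b u - 1) = (a + b) * norm (u - 1) / norm (1 - of_real a * (u - 1))"
    using assms by (simp add: norm_mult norm_divide del: of_real_add)
  also have *: "\<dots> \<le> (a + b) * 3 / (1 / (A + 1))"
  proof (intro frac_le mult_left_mono d A)
    have "1 / (A + 1) \<le> 1" using assms by simp
    then show "norm (u - 1) \<le> 3" using norm_triangle_ineq4[of u 1] assms(4) by simp
  qed (use assms in auto)
  finally show ?thesis by (simp add: algebra_simps)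
qed

locale one_sided_specialization =
  fixes \<rho> :: specialization
  assumes spec: "is_specialization \<rho>"
    and minus: "\<And>i. alpha_minus \<rho> i = 0" "\<And>i. beta_minus \<rho> i = 0" "gamma_minus \<rho> = 0"
    and beta_less: "beta_plus \<rho> 0 < 1"
begin

abbreviation "rad \<equiv> 1 + 1 / (alpha_plus \<rho> 0 + 1)"
abbreviation "fac i \<equiv> plus_factor (alpha_plus \<rho> i) (beta_plus \<rho> i)"

lemma params: "0 \<le> alpha_plus \<rho> i" "alpha_plus \<rho> i \<le> alpha_plus \<rho> 0"
  "0 \<le> beta_plus \<rho> i" "beta_plus \<rho> i \<le> beta_plus \<rho> 0"
  using spec by (auto simp: is_specialization_def decseq_def)

lemma rad_gt_1: "rad > 1" using params(1)[of 0] by simp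

lemma summable_params: "summable (\<lambda>i. (alpha_plus \<rho> i + beta_plus \<rho> i) * (3 * (alpha_plus \<rho> 0 + 1)))"
  using spec by (intro summable_mult2 summable_add) (auto simp: is_specialization_def)

lemma spec_gen_fun_eq:
  "spec_gen_fun \<rho> u = exp (of_real (gamma_plus \<rho>) * (u - 1)) * (\<Prod>i. fac i u)"
  by (simp add: spec_gen_fun_def minus plus_factor_def)

lemma convergent_prod_fac:
  assumes "norm u < rad" shows "convergent_prod (\<lambda>i. fac i u)"
proof (rule abs_convergent_prod_imp_convergent_prod, rule summable_imp_abs_convergent_prod)
  show "summable (\<lambda>i. norm (fac i u - 1))"
    by (rule summable_comparison_test'[OF summable_params])
       (use params assms norm_plus_factor_minus_one in \<open>simp del: distrib_left_numeral\<close>)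
qed

lemma prod_fac_LIMSEQ:
  assumes "norm u < rad" shows "(\<lambda>n. \<Prod>i<n. fac i u) \<longlonglongrightarrow> (\<Prod>i. fac i u)"
  using convergent_prod_LIMSEQ[OF convergent_prod_fac[OF assms]] LIMSEQ_lessThan_iff_atMost by blast

lemma plus_denominator_nonzero:
  "norm u < rad \<Longrightarrow> 1 - of_real (alpha_plus \<rho> i) * (u - 1) \<noteq> (0 :: complex)"
  using norm_plus_denominator[OF params(1,2), of u i] params(1)[of 0] by fastforce

lemma holomorphic_fac: "fac i holomorphic_on ball 0 rad"
  unfolding plus_factor_def[abs_def]
  by (intro holomorphic_intros) (use plus_denominator_nonzero in \<open>auto simp: dist_norm\<close>)

lemma holomorphic_spec_gen_fun: "spec_gen_fun \<rho> holomorphic_on ball 0 rad"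
proof -
  have "(\<lambda>u. \<Prod>i. fac i u) holomorphic_on ball 0 rad"
  proof (rule holomorphic_uniform_sequence)
    show "(\<lambda>u. \<Prod>i<n. fac i u) holomorphic_on ball 0 rad" for n
      by (intro holomorphic_intros holomorphic_fac)
    fix x :: complex assume "x \<in> ball 0 rad"
    then obtain d where d: "d > 0" "cball x d \<subseteq> ball 0 rad"
      using open_contains_cball[of "ball (0::complex) rad"] by blast
    have in_ball: "norm u < rad" if "u \<in> cball x d" for u using d that by (auto simp: dist_norm)
    have "uniformly_convergent_on (cball x d) (\<lambda>N u. \<Prod>n<N. fac n u)"
    proof (rule uniformly_convergent_on_prod')
      show "continuous_on (cball x d) (fac n)" for n
        using holomorphic_on_imp_continuous_on[OF holomorphic_fac] d continuous_on_subset by blast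
      have "uniform_limit (cball x d) (\<lambda>N u. \<Sum>n<N. norm (fac n u - 1)) (\<lambda>u. \<Sum>n. norm (fac n u - 1)) sequentially"
        by (rule Weierstrass_m_test[OF _ summable_params])
           (use params in_ball norm_plus_factor_minus_one in \<open>simp del: distrib_left_numeral\<close>)
      then show "uniformly_convergent_on (cball x d) (\<lambda>N u. \<Sum>n<N. norm (fac n u - 1))"
        unfolding uniformly_convergent_on_def by blast
    qed auto
    then obtain l where l: "uniform_limit (cball x d) (\<lambda>N u. \<Prod>n<N. fac n u) l sequentially"
      unfolding uniformly_convergent_on_def by blast
    have "l u = (\<Prod>i. fac i u)" if "u \<in> cball x d" for u
      using tendsto_uniform_limitI[OF l that] prod_fac_LIMSEQ[OF in_ball[OF that]] LIMSEQ_unique by blast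
    then have "uniform_limit (cball x d) (\<lambda>N u. \<Prod>n<N. fac n u) (\<lambda>u. \<Prod>i. fac i u) sequentially"
      by (intro uniform_limit_cong'[THEN iffD1, OF _ _ l]) auto
    then show "\<exists>d>0. cball x d \<subseteq> ball 0 rad \<and>
       uniform_limit (cball x d) (\<lambda>N u. \<Prod>n<N. fac n u) (\<lambda>u. \<Prod>i. fac i u) sequentially"
      using d by blast
  qed auto
  then have "(\<lambda>u. exp (of_real (gamma_plus \<rho>) * (u - 1)) * (\<Prod>i. fac i u)) holomorphic_on ball 0 rad"
    by (intro holomorphic_intros) auto
  then show ?thesis by (simp add: spec_gen_fun_eq[abs_def])
qed

text \<open>Holds because the parameters are real; it makes the Taylor coefficients real, as
  \<open>spec_psi\<close> has real values.\<close>

lemma spec_gen_fun_cnj: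
  assumes "norm u < rad" shows "spec_gen_fun \<rho> (cnj u) = cnj (spec_gen_fun \<rho> u)"
proof -
  have "fac i (cnj u) = cnj (fac i u)" for i by (simp add: plus_factor_def)
  then have "(\<lambda>n. cnj (\<Prod>i<n. fac i u)) \<longlonglongrightarrow> (\<Prod>i. fac i (cnj u))"
    using prod_fac_LIMSEQ[of "cnj u"] assms by simp
  moreover have "(\<lambda>n. cnj (\<Prod>i<n. fac i u)) \<longlonglongrightarrow> cnj (\<Prod>i. fac i u)"
    by (intro tendsto_cnj prod_fac_LIMSEQ assms)
  ultimately have "(\<Prod>i. fac i (cnj u)) = cnj (\<Prod>i. fac i u)" using LIMSEQ_unique by blast
  then show ?thesis by (simp add: spec_gen_fun_eq exp_cnj)
qed

lemma spec_gen_fun_1: "spec_gen_fun \<rho> 1 = 1"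
  by (simp add: spec_gen_fun_eq plus_factor_def)

text \<open>Rests on \<open>beta_less\<close>: 1 - b (1 - q) is positive for all q in [0, 1] and all
  b between 0 and \<open>beta_plus \<rho> 0\<close>. The value q = 0 gives \<psi>_0 \<noteq> 0, the
  other values allow the division by F(q).\<close>

lemma spec_gen_fun_nonzero:
  assumes "0 \<le> q" "q \<le> 1" shows "spec_gen_fun \<rho> (of_real q) \<noteq> 0"
proof -
  have q: "norm (complex_of_real q) < rad" using assms rad_gt_1 unfolding norm_of_real by linarith
  have "fac i (of_real q) \<noteq> 0" for i
  proof -
    have "beta_plus \<rho> i * (1 - q) < 1"
      by (rule le_less_trans[OF _ beta_less]) (use params[of i] assms in \<open>auto intro: order_trans[OF mult_left_le]\<close>)
    then have "1 + beta_plus \<rho> i * (q - 1) \<noteq> 0" by (simp add: algebra_simps)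
    then have "complex_of_real (1 + beta_plus \<rho> i * (q - 1)) \<noteq> 0"
      unfolding of_real_eq_0_iff by linarith
    then have "1 + complex_of_real (beta_plus \<rho> i) * (of_real q - 1) \<noteq> 0" by simp
    then show ?thesis using plus_denominator_nonzero[OF q] by (simp add: plus_factor_def)
  qed
  then have "(\<Prod>i. fac i (of_real q)) \<noteq> 0"
    using convergent_prod_fac[OF q] by (intro prodinf_nonzero) auto
  then show ?thesis by (simp add: spec_gen_fun_eq)
qed

text \<open>Without minus parameters F is holomorphic in the whole disc, so its expansion on the
  circle is the Taylor series at 0 and the coefficients of negative index vanish.\<close>

lemma gen_fun_coefficients:
  obtains c :: "nat \<Rightarrow> real" where
    "\<And>u. norm u < rad \<Longrightarrow> (\<lambda>n. of_real (c n) * u ^ n) sums spec_gen_fun \<rho> u"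
    "\<And>r. \<bar>r\<bar> < rad \<Longrightarrow> summable (\<lambda>n. \<bar>c n * r ^ n\<bar>)"
    "spec_psi \<rho> = (\<lambda>n. if n < 0 then 0 else c (nat n))"
proof -
  define d where "d = (\<lambda>n. (deriv ^^ n) (spec_gen_fun \<rho>) 0 / fact n)"
  have d: "(\<lambda>n. d n * u ^ n) sums spec_gen_fun \<rho> u" if "norm u < rad" for u
    using holomorphic_power_series[OF holomorphic_spec_gen_fun, of u] that by (simp add: d_def)
  have abs: "summable (\<lambda>n. norm (d n * u ^ n))" if u: "norm u < rad" for u
  proof -
    obtain r where r: "norm u < r" "r < rad" using dense[OF u] by blast
    then have "summable (\<lambda>n. d n * (of_real r) ^ n)" using d[of "of_real r"] sums_summable
      by (smt (verit) norm_ge_zero norm_of_real)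
    then show ?thesis by (rule powser_insidea) (use r in auto)
  qed
  have d1: "summable (\<lambda>n. norm (d n))" using abs[of 1] rad_gt_1 by simp
  have norm1: "norm u < rad" if "norm u = 1" for u :: complex using that rad_gt_1 by simp
  \<comment> \<open>The conjugated coefficients represent cnj (F (cnj u)) = F u on the circle, so
    uniqueness identifies them with the original ones.\<close>
  have real: "cnj (d n) = d n" for n
  proof -
    have "(\<lambda>n::int. if n < 0 then 0 else cnj (d (nat n))) = (\<lambda>n. if n < 0 then 0 else d (nat n))"
    proof (rule circle_series_unique[where F = "spec_gen_fun \<rho>"])
      fix u :: complex assume u: "norm u = 1"
      show "((\<lambda>n. (if n < 0 then 0 else d (nat n)) * u powi n) has_sum spec_gen_fun \<rho> u) UNIV"
        by (rule has_sum_int_of_sums_nat[OF d1 u d[OF norm1[OF u]]])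
      have "(\<lambda>n. cnj (d n * cnj u ^ n)) sums cnj (spec_gen_fun \<rho> (cnj u))"
        using d[of "cnj u"] norm1[OF u] sums_cnj by fastforce
      then have "(\<lambda>n. cnj (d n) * u ^ n) sums spec_gen_fun \<rho> u"
        using spec_gen_fun_cnj[OF norm1[OF u]] by simp
      with d1 u show "((\<lambda>n. (if n < 0 then 0 else cnj (d (nat n))) * u powi n) has_sum spec_gen_fun \<rho> u) UNIV"
        by (intro has_sum_int_of_sums_nat) auto
    qed
    from fun_cong[OF this, of "int n"] show ?thesis by simp
  qed
  have dRe: "d n = of_real (Re (d n))" for n using real[of n] by (metis Reals_cnj_iff of_real_Re)
  show thesis
  proof (rule that[of "\<lambda>n. Re (d n)"])
    show "(\<lambda>n. of_real (Re (d n)) * u ^ n) sums spec_gen_fun \<rho> u" if "norm u < rad" for u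
      using d[OF that] dRe by simp
    show "summable (\<lambda>n. \<bar>Re (d n) * r ^ n\<bar>)" if "\<bar>r\<bar> < rad" for r
    proof -
      have "norm (d n * of_real r ^ n) = \<bar>Re (d n) * r ^ n\<bar>" for n
        by (subst dRe) (simp add: norm_mult norm_power abs_mult power_abs)
      then show ?thesis using abs[of "of_real r"] that by simp
    qed
    show "spec_psi \<rho> = (\<lambda>n. if n < 0 then 0 else Re (d (nat n)))"
    proof (rule spec_psi_eqI)
      fix u :: complex assume u: "norm u = 1"
      have "complex_of_real (if n < 0 then 0 else Re (d (nat n))) = (if n < 0 then 0 else d (nat n))" for n
        using dRe by simp
      then show "((\<lambda>n. complex_of_real (if n < 0 then 0 else Re (d (nat n))) * u powi n) has_sum spec_gen_fun \<rho> u) UNIV"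
        using has_sum_int_of_sums_nat[OF d1 u d[OF norm1[OF u]]] by simp
    qed
  qed
qed

section \<open>The transformed specialization\<close>

abbreviation "bspec \<tau> \<equiv> backward_spec \<tau> \<rho>"

text \<open>Both parameter maps are increasing, so the order survives. The first denominator is at
  least 1 and the second at least 1 - \<open>beta_plus \<rho> 0\<close> > 0 along the whole
  sequence, so summability survives.\<close>

lemma is_specialization_backward:
  assumes "\<tau> \<ge> 0" shows "is_specialization (bspec \<tau>)"
proof -
  define q where "q = exp (- \<tau>)"
  have q: "0 < q" "q \<le> 1" using assms by (auto simp: q_def)
  have a_den: "1 + a - a * q \<ge> 1" if "a \<ge> 0" for a :: real
    using mult_left_mono[of q 1 a] q that by simp
  have b_den: "1 - b + b * q > 0" if "b \<ge> 0" "b < 1" for b :: real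
    using mult_nonneg_nonneg[of b q] q that by linarith
  have b1: "beta_plus \<rho> i < 1" for i using params(4)[of i] beta_less by linarith
  have "summable (\<lambda>i. alpha_plus \<rho> i * q / (1 + alpha_plus \<rho> i - alpha_plus \<rho> i * q))"
  proof (rule summable_comparison_test')
    show "summable (\<lambda>i. alpha_plus \<rho> i * q)"
      using spec by (intro summable_mult2) (simp add: is_specialization_def)
    show "norm (alpha_plus \<rho> i * q / (1 + alpha_plus \<rho> i - alpha_plus \<rho> i * q)) \<le> alpha_plus \<rho> i * q" for i
      unfolding real_norm_def
    proof -
      have "alpha_plus \<rho> i * q / (1 + alpha_plus \<rho> i - alpha_plus \<rho> i * q) \<le> alpha_plus \<rho> i * q / 1"
        using a_den[of "alpha_plus \<rho> i"] params(1)[of i] q by (intro divide_left_mono) auto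
      moreover have "0 \<le> alpha_plus \<rho> i * q / (1 + alpha_plus \<rho> i - alpha_plus \<rho> i * q)"
        using a_den[of "alpha_plus \<rho> i"] params(1)[of i] q by simp
      ultimately show "\<bar>alpha_plus \<rho> i * q / (1 + alpha_plus \<rho> i - alpha_plus \<rho> i * q)\<bar> \<le> alpha_plus \<rho> i * q"
        by (simp only: abs_of_nonneg)
    qed
  qed
  moreover have "summable (\<lambda>i. beta_plus \<rho> i * q / (1 - beta_plus \<rho> i + beta_plus \<rho> i * q))"
  proof (rule summable_comparison_test')
    show "summable (\<lambda>i. beta_plus \<rho> i * q / (1 - beta_plus \<rho> 0))"
      using spec by (intro summable_mult2 summable_divide) (simp add: is_specialization_def)
    show "norm (beta_plus \<rho> i * q / (1 - beta_plus \<rho> i + beta_plus \<rho> i * q)) \<le> beta_plus \<rho> i * q / (1 - beta_plus \<rho> 0)" for i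
      unfolding real_norm_def
    proof -
      have "beta_plus \<rho> i * q \<ge> 0" using params(3)[of i] q by simp
      then have "beta_plus \<rho> i * q / (1 - beta_plus \<rho> i + beta_plus \<rho> i * q) \<le> beta_plus \<rho> i * q / (1 - beta_plus \<rho> 0)"
        using params(3,4)[of i] beta_less by (intro divide_left_mono mult_pos_pos) linarith+
      moreover have "0 \<le> beta_plus \<rho> i * q / (1 - beta_plus \<rho> i + beta_plus \<rho> i * q)"
        using b_den[OF params(3) b1, of i] params(3)[of i] q by simp
      ultimately show "\<bar>beta_plus \<rho> i * q / (1 - beta_plus \<rho> i + beta_plus \<rho> i * q)\<bar> \<le> beta_plus \<rho> i * q / (1 - beta_plus \<rho> 0)"
        by (simp only: abs_of_nonneg)
    qed
  qed
  moreover have "a * q / (1 + a - a * q) \<le> a' * q / (1 + a' - a' * q)" if "0 \<le> a" "a \<le> a'" for a a'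
  proof -
    \<comment> \<open>With the denominators cleared, the terms in a a' are equal on both sides and a
      q \<le> a' q remains.\<close>
    have "a * q * (1 + a' - a' * q) \<le> a' * q * (1 + a - a * q)"
      using mult_right_mono[OF that(2), of q] q by (simp add: algebra_simps)
    then show ?thesis using a_den[of a] a_den[of a'] that by (simp add: divide_simps mult_ac)
  qed
  moreover have "b * q / (1 - b + b * q) \<le> b' * q / (1 - b' + b' * q)" if "0 \<le> b" "b \<le> b'" "b' < 1" for b b'
  proof -
    have "b * q * (1 - b' + b' * q) \<le> b' * q * (1 - b + b * q)"
      using mult_right_mono[OF that(2), of q] q by (simp add: algebra_simps)
    then show ?thesis using b_den[of b] b_den[of b'] that by (simp add: divide_simps mult_ac)
  qed
  moreover have "beta_plus \<rho> 0 * q / (1 - beta_plus \<rho> 0 + beta_plus \<rho> 0 * q) \<le> 1"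
    using b_den[OF params(3) b1, of 0] beta_less by (simp add: divide_simps)
  moreover have "0 \<le> alpha_plus \<rho> i * q / (1 + alpha_plus \<rho> i - alpha_plus \<rho> i * q)" for i
    using a_den[of "alpha_plus \<rho> i"] params(1)[of i] q by simp
  moreover have "0 \<le> beta_plus \<rho> i * q / (1 - beta_plus \<rho> i + beta_plus \<rho> i * q)" for i
    using b_den[OF params(3) b1, of i] params(3)[of i] q by simp
  moreover have "decseq (alpha_plus \<rho>)" "decseq (beta_plus \<rho>)" "gamma_plus \<rho> \<ge> 0"
    using spec by (auto simp: is_specialization_def)
  ultimately show ?thesis
    using q params(1,3) b1 unfolding is_specialization_def backward_spec_def
    by (simp add: q_def[symmetric] decseq_def)
qed

text \<open>Every parameter transforms such that its factor \<open>f(u)\<close> becomes \<open>f(q u) / f(q)\<close>.\<close>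

lemma spec_gen_fun_backward:
  assumes "\<tau> \<ge> 0" "norm u = 1"
  shows "spec_gen_fun (bspec \<tau>) u = spec_gen_fun \<rho> (of_real (exp (- \<tau>)) * u) / spec_gen_fun \<rho> (of_real (exp (- \<tau>)))"
proof -
  define q where "q = exp (- \<tau>)"
  have q: "0 < q" "q \<le> 1" using assms by (auto simp: q_def)
  define Q where "Q = complex_of_real q"
  have "norm Q = q" "norm (Q * u) = q" using q assms by (simp_all add: Q_def norm_mult)
  then have nQ: "norm Q < rad" "norm (Q * u) < rad" using q rad_gt_1 by linarith+
  have fac: "plus_factor (alpha_plus (bspec \<tau>) i) (beta_plus (bspec \<tau>) i) u = fac i (Q * u) / fac i Q" for i
  proof -
    define a where "a = complex_of_real (alpha_plus \<rho> i)"
    define b where "b = complex_of_real (beta_plus \<rho> i)"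
    have 1: "1 - a * (Q * u - 1) \<noteq> 0" "1 - a * (Q - 1) \<noteq> 0"
      using plus_denominator_nonzero[OF nQ(1)] plus_denominator_nonzero[OF nQ(2)] by (auto simp: a_def)
    have b1: "beta_plus \<rho> i < 1" using params(4)[of i] beta_less by linarith
    have "1 - beta_plus \<rho> i + beta_plus \<rho> i * q > 0"
      using mult_nonneg_nonneg[of "beta_plus \<rho> i" q] q params(3)[of i] b1 by linarith
    then have "complex_of_real (1 - beta_plus \<rho> i + beta_plus \<rho> i * q) \<noteq> 0" unfolding of_real_eq_0_iff by linarith
    then have 2: "1 + b * (Q - 1) \<noteq> 0" by (simp add: b_def Q_def algebra_simps)
    have A: "of_real (alpha_plus (bspec \<tau>) i) = a * Q / (1 - a * (Q - 1))"
      "of_real (beta_plus (bspec \<tau>) i) = b * Q / (1 + b * (Q - 1))"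
      by (simp_all add: backward_spec_def a_def b_def Q_def q_def algebra_simps)
    have "1 + of_real (beta_plus (bspec \<tau>) i) * (u - 1) = (1 + b * (Q * u - 1)) / (1 + b * (Q - 1))"
      unfolding A using 2 by (simp add: divide_simps) (simp add: algebra_simps)
    moreover have "1 - of_real (alpha_plus (bspec \<tau>) i) * (u - 1) = (1 - a * (Q * u - 1)) / (1 - a * (Q - 1))"
      unfolding A using 1(2) by (simp add: divide_simps) (simp add: algebra_simps)
    ultimately show ?thesis by (simp add: plus_factor_def a_def b_def)
  qed
  have "spec_gen_fun (bspec \<tau>) u = exp (Q * of_real (gamma_plus \<rho>) * (u - 1)) * (\<Prod>i. fac i (Q * u) / fac i Q)"
    unfolding fac[symmetric] by (simp add: spec_gen_fun_def backward_spec_def plus_factor_def Q_def q_def)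
  also have "(\<Prod>i. fac i (Q * u) / fac i Q) = (\<Prod>i. fac i (Q * u)) / (\<Prod>i. fac i Q)"
    using nQ by (intro prodinf_divide[symmetric] convergent_prod_fac)
  also have "exp (Q * of_real (gamma_plus \<rho>) * (u - 1)) =
      exp (of_real (gamma_plus \<rho>) * (Q * u - 1)) / exp (of_real (gamma_plus \<rho>) * (Q - 1))"
    by (simp add: exp_diff[symmetric] algebra_simps)
  finally show ?thesis by (simp add: spec_gen_fun_eq Q_def q_def)
qed

lemma psi_nonneg_index: "n < 0 \<Longrightarrow> spec_psi \<rho> n = 0"
  by (rule gen_fun_coefficients) simp

text \<open>The room beyond the unit circle, in the form of an exponential moment: it later gives
  finite means and differentiability of the generating function at q = 1.\<close>

lemma psi_summable:
  obtains r where "r > 1" "summable (\<lambda>n. \<bar>spec_psi \<rho> (int n) * r ^ n\<bar>)"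
proof -
  obtain r where r: "1 < r" "r < rad" using dense[OF rad_gt_1] by blast
  have "summable (\<lambda>n. \<bar>spec_psi \<rho> (int n) * r ^ n\<bar>)"
    by (rule gen_fun_coefficients) (use r in simp)
  with r that show ?thesis by blast
qed

lemma psi_sums_spec_gen_fun:
  assumes "norm u < rad"
  shows "(\<lambda>n. of_real (spec_psi \<rho> (int n)) * u ^ n) sums spec_gen_fun \<rho> u"
  by (rule gen_fun_coefficients) (use assms in simp)

lemma psi_sums_1: "(\<lambda>n. spec_psi \<rho> (int n)) sums 1"
proof -
  have "(\<lambda>n. of_real (spec_psi \<rho> (int n))) sums complex_of_real 1"
    using psi_sums_spec_gen_fun[of 1] rad_gt_1 by (simp add: spec_gen_fun_1)
  then show ?thesis by (simp only: sums_of_real_iff)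
qed

lemma psi_0_nonzero: "spec_psi \<rho> 0 \<noteq> 0"
proof -
  have "(\<lambda>n. of_real (spec_psi \<rho> (int n)) * 0 ^ n) sums spec_gen_fun \<rho> 0"
    using psi_sums_spec_gen_fun[of 0] rad_gt_1 by simp
  then have "spec_gen_fun \<rho> 0 = of_real (spec_psi \<rho> 0)"
    using powser_sums_zero_iff[of "\<lambda>n. complex_of_real (spec_psi \<rho> (int n))"] by simp
  then show ?thesis using spec_gen_fun_nonzero[of 0] by auto
qed

text \<open>These are the coefficients of F(q u) / F(q): the transformation is an exponential tilt,
  with normalizing constant F(q).\<close>

lemma spec_psi_backward:
  assumes "\<tau> \<ge> 0"
  shows "spec_psi (bspec \<tau>) n =
    exp (- \<tau>) powi n * spec_psi \<rho> n / (\<Sum>m. spec_psi \<rho> (int m) * exp (- \<tau>) ^ m)"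
proof -
  define q where "q = exp (- \<tau>)"
  have q: "0 < q" "q \<le> 1" using assms by (auto simp: q_def)
  define Z where "Z = (\<Sum>m. spec_psi \<rho> (int m) * q ^ m)"
  define \<psi> where "\<psi> = (\<lambda>n. q powi n * spec_psi \<rho> n / Z)"
  obtain r where r: "r > 1" "summable (\<lambda>n. \<bar>spec_psi \<rho> (int n) * r ^ n\<bar>)" by (rule psi_summable)
  have sq: "summable (\<lambda>n. norm (spec_psi \<rho> (int n) * q ^ n))"
  proof (rule summable_comparison_test'[OF r(2)])
    show "norm (norm (spec_psi \<rho> (int n) * q ^ n)) \<le> \<bar>spec_psi \<rho> (int n) * r ^ n\<bar>" for n
      using q r by (auto simp: abs_mult intro!: mult_left_mono power_mono)
  qed
  have nq: "norm (of_real q * u) < rad" if "norm u = 1" for u :: complex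
  proof -
    have "norm (of_real q * u) = q" using q that by (simp add: norm_mult)
    then show ?thesis using q rad_gt_1 by linarith
  qed
  have Z: "spec_gen_fun \<rho> (of_real q) = of_real Z"
  proof -
    have "(\<lambda>n. complex_of_real (spec_psi \<rho> (int n) * q ^ n)) sums spec_gen_fun \<rho> (of_real q)"
      using psi_sums_spec_gen_fun[of "of_real q"] nq[of 1] by simp
    moreover have "(\<lambda>n. complex_of_real (spec_psi \<rho> (int n) * q ^ n)) sums of_real Z"
      unfolding Z_def sums_of_real_iff using summable_norm_cancel[OF sq] by (rule summable_sums)
    ultimately show ?thesis using sums_unique2 by blast
  qed
  have "spec_psi (bspec \<tau>) = \<psi>"
  proof (rule spec_psi_eqI)
    fix u :: complex assume u: "norm u = 1"
    have "(\<lambda>n. of_real (spec_psi \<rho> (int n)) * (of_real q * u) ^ n / of_real Z) sums spec_gen_fun (bspec \<tau>) u"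
      unfolding spec_gen_fun_backward[OF assms u] q_def[symmetric] Z
      by (intro sums_divide psi_sums_spec_gen_fun nq u)
    then have "(\<lambda>n. of_real (\<psi> (int n)) * u ^ n) sums spec_gen_fun (bspec \<tau>) u"
      by (simp add: \<psi>_def power_mult_distrib mult_ac)
    moreover have "summable (\<lambda>n. norm (complex_of_real (\<psi> (int n))))"
      using summable_divide[OF sq, of "\<bar>Z\<bar>"] by (simp add: \<psi>_def norm_mult norm_divide norm_power abs_mult power_abs mult_ac)
    ultimately have "((\<lambda>n::int. (if n < 0 then 0 else complex_of_real (\<psi> (int (nat n)))) * u powi n) has_sum spec_gen_fun (bspec \<tau>) u) UNIV"
      using u by (intro has_sum_int_of_sums_nat) auto
    moreover have "(if n < 0 then 0 else complex_of_real (\<psi> (int (nat n)))) = of_real (\<psi> n)" for n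
      by (simp add: \<psi>_def psi_nonneg_index)
    ultimately show "((\<lambda>n. of_real (\<psi> n) * u powi n) has_sum spec_gen_fun (bspec \<tau>) u) UNIV"
      by simp
  qed
  then show ?thesis by (simp add: \<psi>_def Z_def q_def)
qed

end

section \<open>Branching of the determinants\<close>

definition schur_det :: "(int \<Rightarrow> real) \<Rightarrow> nat \<Rightarrow> (nat \<Rightarrow> int) \<Rightarrow> real" where
  "schur_det \<psi> N l = Determinant.det (Matrix.mat N N (\<lambda>(i, j). \<psi> (l (Suc i) + int j - int i)))"

lemma spec_schur_eq: "spec_schur \<rho> = schur_det (spec_psi \<rho>)"
  by (simp add: fun_eq_iff spec_schur_def schur_det_def)

lemma schur_det_expand:
  "schur_det \<psi> N l =
     (\<Sum>p | p permutes {0..<N}. signof p * (\<Prod>i=0..<N. \<psi> (l (Suc i) + int (p i) - int i)))"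
  unfolding schur_det_def
  by (subst Determinant.det_def'[of _ N]) (auto intro!: sum.cong prod.cong simp: permutes_in_image[where S = "{0..<N}", simplified])

lemma schur_det_cong:
  assumes "\<And>i. i \<in> {1..N} \<Longrightarrow> l i = l' i" shows "schur_det \<psi> N l = schur_det \<psi> N l'"
  unfolding schur_det_def
  by (rule arg_cong[where f = Determinant.det]) (auto intro!: eq_matI simp: assms)

lemma prod_power_int:
  assumes "(q::real) \<noteq> 0" shows "(\<Prod>i\<in>I. q powi f i) = q powi (\<Sum>i\<in>I. f i)"
  using assms by (induction I rule: infinite_finite_induct) (auto simp: power_int_add)

text \<open>In each product of the Leibniz expansion the arguments l_i + p(i) - i add up to the sum
  of l, because p is a permutation. So a tilt of the coefficients changes the determinant by a
  factor that depends on l only through its sum; this factor is the density on cylinders.\<close>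

lemma schur_det_scale:
  assumes "(q::real) \<noteq> 0"
  shows "schur_det (\<lambda>m. q powi m * \<psi> m / c) N l = q powi (\<Sum>j=1..N. l j) * schur_det \<psi> N l / c ^ N"
proof -
  have "(\<Prod>i=0..<N. q powi (l (Suc i) + int (p i) - int i) * \<psi> (l (Suc i) + int (p i) - int i) / c)
      = q powi (\<Sum>j=1..N. l j) / c ^ N * (\<Prod>i=0..<N. \<psi> (l (Suc i) + int (p i) - int i))"
    if p: "p permutes {0..<N}" for p
  proof -
    have "(\<Sum>i=0..<N. l (Suc i) + int (p i) - int i) = (\<Sum>i=0..<N. l (Suc i)) + (\<Sum>i=0..<N. int (p i)) - (\<Sum>i=0..<N. int i)"
      by (simp add: sum.distrib sum_subtractf)
    also have "(\<Sum>i=0..<N. int (p i)) = (\<Sum>i=0..<N. int i)"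
      using sum.permute[OF p, of int] by (simp add: o_def)
    also have "(\<Sum>i=0..<N. l (Suc i)) = (\<Sum>j=1..N. l j)"
      by (rule sum.reindex_bij_witness[of _ "\<lambda>i. i - 1" Suc]) auto
    finally show ?thesis
      by (simp add: prod.distrib prod_dividef prod_power_int[OF assms])
  qed
  then show ?thesis
    unfolding schur_det_expand sum_distrib_left sum_divide_distrib by (intro sum.cong) auto
qed

text \<open>The last row of the matrix vanishes, as its arguments are at most
  \<open>l N\<close>.\<close>

lemma schur_det_negative:
  assumes "\<And>n. n < 0 \<Longrightarrow> \<psi> n = 0" "l N < 0" "N > 0"
  shows "schur_det \<psi> N l = 0"
proof -
  let ?A = "Matrix.mat N N (\<lambda>(i, j). \<psi> (l (Suc i) + int j - int i))"
  have "Determinant.det ?A = (\<Sum>j<N. ?A $$ (N - 1, j) * cofactor ?A (N - 1) j)"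
    using assms by (intro laplace_expansion_row) auto
  also have "\<dots> = 0"
    using assms by (intro sum.neutral) auto
  finally show ?thesis by (simp add: schur_det_def)
qed

section \<open>Summation over the interlacing rows of length n + 1\<close>

definition partial_sums :: "(int \<Rightarrow> real) \<Rightarrow> int \<Rightarrow> real" where
  "partial_sums \<phi> m = (\<Sum>r\<in>{0..<m}. \<phi> r)"

lemma partial_sums_step:
  assumes "\<And>n. n < 0 \<Longrightarrow> \<phi> n = 0"
  shows "partial_sums \<phi> (m + 1) = partial_sums \<phi> m + \<phi> m"
proof (cases "m \<ge> 0")
  case True
  then have "{0..<m + 1} = insert m {0..<m}" by auto
  then show ?thesis by (simp add: partial_sums_def)
qed (use assms in \<open>auto simp: partial_sums_def\<close>)

lemma sum_interval_partial_sums: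
  assumes "\<And>n. n < 0 \<Longrightarrow> \<phi> n = 0" "a \<le> b"
  shows "(\<Sum>v\<in>{a..b}. \<phi> (v + k)) = partial_sums \<phi> (b + 1 + k) - partial_sums \<phi> (a + k)"
  using assms(2)
proof (induction b rule: int_ge_induct)
  case base
  show ?case using partial_sums_step[OF assms(1), where m = "a + k"] by (simp add: add_ac)
next
  case (step b)
  then have "{a..b + 1} = insert (b + 1) {a..b}" by auto
  then show ?case using step partial_sums_step[OF assms(1), where m = "b + 1 + k"] by (simp add: add_ac)
qed

text \<open>Left and right multiplication by the following unipotent matrix turns the entries into
  differences of neighbouring rows and columns.\<close>

definition difference_mat :: "nat \<Rightarrow> real mat" where
  "difference_mat n = Matrix.mat n n (\<lambda>(i, k). if k = i then 1 else if k = Suc i then - 1 else 0)"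

lemma difference_mat_left:
  assumes "B \<in> carrier_mat n n" "i < n" "j < n"
  shows "(difference_mat n * B) $$ (i, j) = B $$ (i, j) - (if Suc i < n then B $$ (Suc i, j) else 0)"
proof -
  have "(difference_mat n * B) $$ (i, j) =
      (\<Sum>k\<in>{0..<n}. (if k = i then B $$ (k, j) else 0) - (if k = Suc i then B $$ (k, j) else 0))"
    using assms by (auto simp: difference_mat_def scalar_prod_def intro!: sum.cong)
  also have "\<dots> = B $$ (i, j) - (if Suc i < n then B $$ (Suc i, j) else 0)"
    using assms by (simp add: sum_subtractf)
  finally show ?thesis .
qed

lemma difference_mat_right:
  assumes "B \<in> carrier_mat n n" "i < n" "j < n"
  shows "(B * difference_mat n) $$ (i, j) = B $$ (i, j) - (if j > 0 then B $$ (i, j - 1) else 0)"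
proof -
  have "(B * difference_mat n) $$ (i, j) =
      (\<Sum>k\<in>{0..<n}. (if k = j then B $$ (i, k) else 0) - (if j > 0 \<and> k = j - 1 then B $$ (i, k) else 0))"
    using assms by (auto simp: difference_mat_def scalar_prod_def intro!: sum.cong)
  also have "\<dots> = B $$ (i, j) - (if j > 0 then B $$ (i, j - 1) else 0)"
    using assms by (cases "j > 0") (auto simp add: sum_subtractf)
  finally show ?thesis .
qed

text \<open>The rows that can stand above \<open>l\<close>. Given \<open>l\<close> the entries range
  independently, hence a product set; the lower bound 0 for the last entry and the cutoff
  \<open>t\<close> for the first make it finite.\<close>

definition branch_set :: "nat \<Rightarrow> (nat \<Rightarrow> int) \<Rightarrow> nat \<Rightarrow> (nat \<Rightarrow> int) set" where
  "branch_set n l t = (\<Pi>\<^sub>E i\<in>{1..Suc n}. {if i = Suc n then 0 else l i..if i = 1 then int t else l (i - 1)})"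

text \<open>Multilinearity in the rows: each row of the matrix involves a single entry of the
  signature, and the entries vary independently.\<close>

lemma sum_schur_det_PiE:
  assumes "\<And>i. finite (I i)"
  shows "(\<Sum>\<nu>\<in>Pi\<^sub>E {1..N} I. schur_det \<phi> N \<nu>) =
    Determinant.det (Matrix.mat N N (\<lambda>(i, j). \<Sum>v\<in>I (Suc i). \<phi> (v + int j - int i)))"
proof -
  have shift: "prod f {1..N} = (\<Prod>i=0..<N. f (Suc i))" for f :: "nat \<Rightarrow> real"
    by (rule prod.reindex_bij_witness[of _ Suc "\<lambda>i. i - 1"]) auto
  have "(\<Prod>i=0..<N. \<Sum>v\<in>I (Suc i). \<phi> (v + int (p i) - int i)) =
    (\<Sum>\<nu>\<in>Pi\<^sub>E {1..N} I. \<Prod>i=0..<N. \<phi> (\<nu> (Suc i) + int (p i) - int i))" for p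
    using prod_sum_PiE[of "{1..N}" I "\<lambda>i v. \<phi> (v + int (p (i - 1)) - int (i - 1))"] assms
    unfolding shift diff_Suc_1 by blast
  then have "Determinant.det (Matrix.mat N N (\<lambda>(i, j). \<Sum>v\<in>I (Suc i). \<phi> (v + int j - int i)))
    = (\<Sum>p | p permutes {0..<N}. signof p * (\<Sum>\<nu>\<in>Pi\<^sub>E {1..N} I. \<Prod>i=0..<N. \<phi> (\<nu> (Suc i) + int (p i) - int i)))"
    by (subst Determinant.det_def'[of _ N]) (auto intro!: sum.cong prod.cong simp: permutes_in_image[where S = "{0..<N}", simplified])
  also have "\<dots> = (\<Sum>\<nu>\<in>Pi\<^sub>E {1..N} I. schur_det \<phi> N \<nu>)"
    unfolding schur_det_expand sum_distrib_left by (rule sum.swap)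
  finally show ?thesis ..
qed

text \<open>Summation over the interlacing top rows is a telescoping sum in each row of the
  determinant; only the first row remembers the cutoff \<open>t\<close>.\<close>

lemma schur_branching_LIMSEQ:
  fixes \<phi> :: "int \<Rightarrow> real"
  assumes neg: "\<And>n. n < 0 \<Longrightarrow> \<phi> n = 0"
    and sm: "summable (\<lambda>m. \<phi> (int m))"
    and dec: "\<And>i. 1 \<le> i \<Longrightarrow> i < n \<Longrightarrow> l (Suc i) \<le> l i"
    and nonneg: "n \<ge> 1 \<Longrightarrow> 0 \<le> l n"
  shows "(\<lambda>t. \<Sum>\<nu>\<in>branch_set n l t. schur_det \<phi> (Suc n) \<nu>) \<longlonglongrightarrow> (\<Sum>m. \<phi> (int m)) * schur_det \<phi> n l"
proof -
  let ?S = "partial_sums \<phi>"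
  \<comment> \<open>All endpoints in one sequence: entry i + 1 of the new row runs from
    \<open>e t (Suc i)\<close> to \<open>e t i\<close>, so neighbouring ranges share an
    endpoint.\<close>
  define e where "e = (\<lambda>(t::nat) i. if i = 0 then int t else if i = Suc n then 0 else l i)"
  \<comment> \<open>Cumulative sums of \<phi> at the upper endpoints. Differences of neighbouring
    rows are the sums over the ranges, differences of neighbouring columns give back values of
    \<phi>.\<close>
  define B where "B = (\<lambda>t. Matrix.mat (Suc n) (Suc n) (\<lambda>(i, j). ?S (e t i + 1 - int i + int j)))"
  define C where "C = (\<lambda>t. B t * difference_mat (Suc n))"
  have [simp]: "B t \<in> carrier_mat (Suc n) (Suc n)" "C t \<in> carrier_mat (Suc n) (Suc n)"
    "dim_row (C t) = Suc n" "dim_col (C t) = Suc n" for t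
    by (auto simp: B_def C_def difference_mat_def)
  have C0: "C t $$ (0, 0) = ?S (int t + 1)" for t
    using difference_mat_right[of "B t" "Suc n" 0 0] by (simp add: C_def B_def e_def)
  have Cij: "C t $$ (i, Suc j) = \<phi> (e t i + 1 - int i + int j)" if "i < Suc n" "j < n" for i j t
    using difference_mat_right[of "B t" "Suc n" i "Suc j"] that
      partial_sums_step[OF neg, where m = "e t i + 1 - int i + int j"]
    by (simp add: C_def B_def add_ac)
  have Ci0: "C t $$ (i, 0) = ?S (e t i + 1 - int i)" if "i < Suc n" for i t
    using difference_mat_right[of "B t" "Suc n" i 0] that by (simp add: C_def B_def)
  have eq: "(\<Sum>\<nu>\<in>branch_set n l t. schur_det \<phi> (Suc n) \<nu>) = Determinant.det (C t)"
    if t: "n \<ge> 1 \<Longrightarrow> l 1 \<le> int t" for t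
  proof -
    have e_dec: "e t (Suc i) \<le> e t i" if "i < Suc n" for i
      using that t dec[of i] nonneg by (auto simp: e_def)
    let ?A = "Matrix.mat (Suc n) (Suc n) (\<lambda>(i, j). \<Sum>v\<in>{e t (Suc i)..e t i}. \<phi> (v + int j - int i))"
    have "(\<Sum>\<nu>\<in>branch_set n l t. schur_det \<phi> (Suc n) \<nu>) = Determinant.det
      (Matrix.mat (Suc n) (Suc n) (\<lambda>(i, j). \<Sum>v\<in>{if Suc i = Suc n then 0 else l (Suc i)..if Suc i = 1 then int t else l (Suc i - 1)}. \<phi> (v + int j - int i)))"
      unfolding branch_set_def by (rule sum_schur_det_PiE) simp
    also have "\<dots> = Determinant.det ?A"
      by (intro arg_cong[where f = Determinant.det] eq_matI) (auto simp: e_def intro!: sum.cong)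
    also have "?A = difference_mat (Suc n) * B t"
    proof (rule eq_matI)
      fix i j assume "i < dim_row (difference_mat (Suc n) * B t)" "j < dim_col (difference_mat (Suc n) * B t)"
      then have ij: "i < Suc n" "j < Suc n" by (auto simp: difference_mat_def B_def)
      have "(\<Sum>v\<in>{e t (Suc i)..e t i}. \<phi> (v + (int j - int i))) =
        ?S (e t i + 1 + (int j - int i)) - ?S (e t (Suc i) + (int j - int i))"
        by (rule sum_interval_partial_sums[OF neg e_dec[OF ij(1)]])
      \<comment> \<open>In the last row there is no next row to subtract. Its lower endpoint is 0
        and the column index is at most n, so the missing term is an empty sum.\<close>
      moreover have "?S (e t (Suc i) + (int j - int i)) = 0" if "\<not> Suc i < Suc n"
        using ij that by (auto simp: e_def partial_sums_def not_less_eq less_Suc_eq)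
      ultimately show "?A $$ (i, j) = (difference_mat (Suc n) * B t) $$ (i, j)"
        using ij by (cases "Suc i < Suc n") (simp_all add: difference_mat_left B_def algebra_simps)
    qed (auto simp: difference_mat_def B_def)
    also have "Determinant.det (difference_mat (Suc n) * B t) = Determinant.det (difference_mat (Suc n)) * Determinant.det (B t)"
      by (rule det_mult) (auto simp: difference_mat_def)
    \<comment> \<open>Moving the factor from the left of \<open>B\<close> to its right trades row
      differences for column differences without evaluating it.\<close>
    also have "\<dots> = Determinant.det (B t) * Determinant.det (difference_mat (Suc n))"
      by simp
    also have "\<dots> = Determinant.det (C t)"
      unfolding C_def by (rule det_mult[symmetric]) (auto simp: difference_mat_def)
    finally show ?thesis .
  qed
  have del: "mat_delete (C t) 0 j = mat_delete (C 0) 0 j" if "j < Suc n" for j t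
  proof (rule eq_matI)
    fix i k assume "i < dim_row (mat_delete (C 0) 0 j)" "k < dim_col (mat_delete (C 0) 0 j)"
    then have ik: "i < n" "k < n" by (auto simp: mat_delete_def)
    have "C t $$ (Suc i, k') = C 0 $$ (Suc i, k')" if "k' < Suc n" for k'
      using that ik by (cases k') (auto simp: Cij Ci0 e_def)
    then show "mat_delete (C t) 0 j $$ (i, k) = mat_delete (C 0) 0 j $$ (i, k)"
      using ik by (simp add: mat_delete_def)
  qed (auto simp: mat_delete_def)
  \<comment> \<open>Only the first row of \<open>C\<close> depends on t. Its first entry tends to
    the sum of \<phi> and has the determinant of \<open>l\<close> as cofactor, while all other
    entries of the row tend to 0.\<close>
  have lap: "Determinant.det (C t) =
    ?S (int t + 1) * schur_det \<phi> n l + (\<Sum>j<n. \<phi> (int t + 1 + int j) * cofactor (C 0) 0 (Suc j))" for t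
  proof -
    have "Determinant.det (C t) = (\<Sum>j<Suc n. C t $$ (0, j) * cofactor (C t) 0 j)"
      by (rule laplace_expansion_row) auto
    also have "\<dots> = C t $$ (0, 0) * cofactor (C t) 0 0 + (\<Sum>j<n. C t $$ (0, Suc j) * cofactor (C t) 0 (Suc j))"
      by (rule sum.lessThan_Suc_shift)
    also have "(\<Sum>j<n. C t $$ (0, Suc j) * cofactor (C t) 0 (Suc j)) = (\<Sum>j<n. \<phi> (int t + 1 + int j) * cofactor (C 0) 0 (Suc j))"
      by (intro sum.cong refl) (auto simp: Cij e_def cofactor_def del[of _ t])
    also have "cofactor (C t) 0 0 = schur_det \<phi> n l"
    proof -
      have "mat_delete (C t) 0 0 = Matrix.mat n n (\<lambda>(i, j). \<phi> (l (Suc i) + int j - int i))"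
        by (rule eq_matI) (auto simp: mat_delete_def Cij e_def algebra_simps)
      then show ?thesis by (simp add: cofactor_def schur_det_def)
    qed
    finally show ?thesis by (simp add: C0)
  qed
  have S: "?S (int t + 1) = (\<Sum>m<Suc t. \<phi> (int m))" for t
  proof -
    have "{0..<int t + 1} = int ` {..<Suc t}"
      by (auto simp: image_iff intro!: bexI[of _ "nat _"])
    then show ?thesis unfolding partial_sums_def by (simp only: sum.reindex[OF inj_on_of_nat] o_def)
  qed
  have "(\<lambda>t. ?S (int t + 1)) \<longlonglongrightarrow> (\<Sum>m. \<phi> (int m))"
    unfolding S using summable_LIMSEQ[OF sm] LIMSEQ_Suc by blast
  moreover have "(\<lambda>t. \<phi> (int t + 1 + int j)) \<longlonglongrightarrow> 0" for j
  proof -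
    have "(\<lambda>t. \<phi> (int (t + (1 + j)))) \<longlonglongrightarrow> 0"
      using LIMSEQ_ignore_initial_segment[OF summable_LIMSEQ_zero[OF sm]] .
    then show ?thesis by (simp add: add_ac)
  qed
  ultimately have "(\<lambda>t. ?S (int t + 1) * schur_det \<phi> n l + (\<Sum>j<n. \<phi> (int t + 1 + int j) * cofactor (C 0) 0 (Suc j)))
     \<longlonglongrightarrow> (\<Sum>m. \<phi> (int m)) * schur_det \<phi> n l + (\<Sum>j<n. 0 * cofactor (C 0) 0 (Suc j))"
    by (intro tendsto_intros)
  then have "(\<lambda>t. Determinant.det (C t)) \<longlonglongrightarrow> (\<Sum>m. \<phi> (int m)) * schur_det \<phi> n l"
    unfolding lap by simp
  then show ?thesis
  proof (rule Lim_transform_eventually)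
    show "\<forall>\<^sub>F t in sequentially. Determinant.det (C t) = (\<Sum>\<nu>\<in>branch_set n l t. schur_det \<phi> (Suc n) \<nu>)"
      using eventually_ge_at_top[of "nat (l 1)"] by eventually_elim (auto intro!: eq[symmetric])
  qed
qed

section \<open>One-sided Gibbs measures\<close>

definition levels :: "nat \<Rightarrow> (nat \<times> nat) set" where
  "levels n = {i \<in> array_index. fst i \<le> n}"

text \<open>Measurability with respect to the first n levels, in pointwise form. There are only
  countably many patterns, so such functions are constant on each of countably many cylinders and
  automatically measurable.\<close>

definition determined_by :: "nat \<Rightarrow> (array \<Rightarrow> 'a) \<Rightarrow> bool" where
  "determined_by n f \<longleftrightarrow> (\<forall>x y. (\<forall>i\<in>levels n. x i = y i) \<longrightarrow> f x = f y)"

text \<open>Canonical labels: extensionality makes every interlacing array lie in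
  \<open>cylinder n l\<close> for exactly one pattern \<open>l\<close>.\<close>

definition patterns :: "nat \<Rightarrow> array set" where
  "patterns n = {l \<in> extensional (levels n). interlacing_upto n l}"

definition level_sum :: "nat \<Rightarrow> array \<Rightarrow> int" where
  "level_sum n x = (\<Sum>j=1..n. x (n, j))"

definition level_diff :: "nat \<Rightarrow> array \<Rightarrow> int" where
  "level_diff n x = level_sum (Suc n) x - level_sum n x"

lemma levels_iff [simp]: "(k, j) \<in> levels n \<longleftrightarrow> 1 \<le> j \<and> j \<le> k \<and> k \<le> n"
  by (auto simp: levels_def array_index_def)

lemma finite_levels: "finite (levels n)"
  unfolding levels_def by (rule finite_array_index_upto)

lemma levels_mono: "m \<le> n \<Longrightarrow> levels m \<subseteq> levels n"
  by (auto simp: levels_def)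

lemma determined_byD: "determined_by n f \<Longrightarrow> (\<And>i. i \<in> levels n \<Longrightarrow> x i = y i) \<Longrightarrow> f x = f y"
  by (auto simp: determined_by_def)

lemma determined_byI: "(\<And>x y. (\<And>i. i \<in> levels n \<Longrightarrow> x i = y i) \<Longrightarrow> f x = f y) \<Longrightarrow> determined_by n f"
  unfolding determined_by_def by blast

lemma determined_by_mono: "determined_by m f \<Longrightarrow> m \<le> n \<Longrightarrow> determined_by n f"
  using levels_mono[of m n] unfolding determined_by_def by blast

lemma determined_by_const [simp]: "determined_by n (\<lambda>_. c)"
  by (simp add: determined_by_def)

lemma determined_by_coord: "i \<in> levels n \<Longrightarrow> determined_by n (\<lambda>x. x i)"
  by (simp add: determined_by_def)

lemma determined_by_app: "determined_by n f \<Longrightarrow> determined_by n (\<lambda>x. h (f x))"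
  unfolding determined_by_def by metis

lemma determined_by_app2:
  "determined_by n f \<Longrightarrow> determined_by n g \<Longrightarrow> determined_by n (\<lambda>x. h (f x) (g x))"
  unfolding determined_by_def by metis

lemma determined_by_level_sum: "m \<le> n \<Longrightarrow> determined_by n (level_sum m)"
  by (auto intro!: determined_byI sum.cong simp: level_sum_def)

lemma determined_by_level_diff: "determined_by (Suc n) (level_diff n)"
  unfolding level_diff_def[abs_def]
  by (intro determined_by_app2[where h = "(-)"] determined_by_level_sum) auto

lemma countable_patterns: "countable (patterns n)"
proof (rule countable_subset)
  show "patterns n \<subseteq> Pi\<^sub>E (levels n) (\<lambda>_. UNIV)" by (auto simp: patterns_def PiE_def)
  show "countable (Pi\<^sub>E (levels n) (\<lambda>_. UNIV :: int set))"
    by (rule countable_PiE) (auto intro: finite_levels)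
qed

lemma restrict_in_patterns:
  assumes "x \<in> interlacing_arrays" shows "restrict x (levels n) \<in> patterns n"
  using assms by (auto simp: patterns_def interlacing_upto_def interlacing_arrays_def)

lemma in_cylinder_iff:
  assumes "l \<in> patterns n" "x \<in> interlacing_arrays"
  shows "x \<in> cylinder n l \<longleftrightarrow> l = restrict x (levels n)"
proof
  assume "x \<in> cylinder n l"
  then have "l i = restrict x (levels n) i" for i
  proof (cases "i \<in> levels n")
    case True
    then show ?thesis using \<open>x \<in> cylinder n l\<close> by (cases i) (auto simp: cylinder_def)
  next
    case False
    then show ?thesis using assms(1) by (simp add: patterns_def extensional_def del: levels_iff split_paired_All)
  qed
  then show "l = restrict x (levels n)" by (rule ext)
qed (use assms in \<open>auto simp: cylinder_def\<close>)

lemma determined_by_restrict: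
  "determined_by n f \<Longrightarrow> f (restrict x (levels n)) = f x"
  by (erule determined_byD) simp

lemma level_sum_nonneg: "\<forall>i\<in>array_index. 0 \<le> x i \<Longrightarrow> 0 \<le> level_sum n x"
  by (auto simp: level_sum_def array_index_def intro!: sum_nonneg)

lemma interlacing_arraysD:
  assumes "x \<in> interlacing_arrays" "1 \<le> j" "j \<le> k"
  shows "x (Suc k, Suc j) \<le> x (k, j)" "x (k, j) \<le> x (Suc k, j)"
  using assms by (simp_all add: interlacing_arrays_def)

lemma interlacing_arrays_row_mono:
  assumes "x \<in> interlacing_arrays" "1 \<le> i" "i \<le> j" "j \<le> k"
  shows "x (k, j) \<le> x (k, i)"
  using assms(3,4)
proof (induction j rule: dec_induct)
  case (step j)
  then obtain k' where k: "k = Suc k'" by (cases k) auto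
  have "x (Suc k', Suc j) \<le> x (k', j)" "x (k', j) \<le> x (Suc k', j)"
    using assms step k by (auto simp: interlacing_arrays_def)
  then show ?case using step k by simp
qed simp

lemma interlacing_arrays_diag_mono:
  assumes "x \<in> interlacing_arrays" "1 \<le> j" "j \<le> k"
  shows "x (k + d, j + d) \<le> x (k, j)"
proof (induction d)
  case (Suc d)
  have "x (Suc (k + d), Suc (j + d)) \<le> x (k + d, j + d)"
    using assms by (auto simp: interlacing_arrays_def)
  then show ?case using Suc by simp
qed simp

lemma level_diff_ge:
  assumes "x \<in> interlacing_arrays" shows "x (Suc n, Suc n) \<le> level_diff n x"
proof -
  have "level_sum n x \<le> (\<Sum>j=1..n. x (Suc n, j))"
    unfolding level_sum_def using assms by (intro sum_mono) (auto simp: interlacing_arrays_def)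
  then show ?thesis by (simp add: level_diff_def level_sum_def)
qed

text \<open>The increment is a sum of n + 1 nonnegative terms, so all of them vanish: the level is
  repeated with a zero appended.\<close>

lemma level_diff_eq_0:
  assumes "x \<in> interlacing_arrays" "level_diff n x = 0" "x (Suc n, Suc n) \<ge> 0"
  shows "x (Suc n, Suc n) = 0" "\<And>j. 1 \<le> j \<Longrightarrow> j \<le> n \<Longrightarrow> x (Suc n, j) = x (n, j)"
proof -
  have eq: "level_diff n x = (\<Sum>j=1..n. x (Suc n, j) - x (n, j)) + x (Suc n, Suc n)"
    by (simp add: level_diff_def level_sum_def sum_subtractf)
  have nn: "0 \<le> x (Suc n, j) - x (n, j)" if "j \<in> {1..n}" for j
    using assms(1) that by (auto simp: interlacing_arrays_def)
  then have nn': "0 \<le> (\<Sum>j=1..n. x (Suc n, j) - x (n, j))" by (rule sum_nonneg)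
  then show "x (Suc n, Suc n) = 0" using eq assms by linarith
  then have "(\<Sum>j=1..n. x (Suc n, j) - x (n, j)) = 0" using eq assms by linarith
  then show "x (Suc n, j) = x (n, j)" if "1 \<le> j" "j \<le> n" for j
    using sum_nonneg_eq_0_iff[of "{1..n}" "\<lambda>j. x (Suc n, j) - x (n, j)"] nn that by auto
qed

text \<open>A power series with a nonzero coefficient has isolated zeros, while here the zeros
  accumulate at 0.\<close>

lemma powser_eq_zero_coeff:
  fixes c :: "nat \<Rightarrow> real"
  assumes "\<And>q. 0 < q \<Longrightarrow> q \<le> 1 \<Longrightarrow> (\<lambda>n. c n * q ^ n) sums 0"
  shows "c k = 0"
proof (rule ccontr)
  assume k: "c k \<noteq> 0"
  \<comment> \<open>Multiplication by x: \<open>powser_0_nonzero\<close> concerns series that vanish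
    at the origin, and c 0 may be nonzero.\<close>
  define a where "a = (\<lambda>n. case n of 0 \<Rightarrow> 0 | Suc m \<Rightarrow> c m)"
  define f where "f = (\<lambda>x. \<Sum>n. a n * x ^ n)"
  have a_sums: "(\<lambda>n. a n * x ^ n) sums (x * s)" if "(\<lambda>n. c n * x ^ n) sums s" for x s
  proof -
    have "(\<lambda>n. x * (c n * x ^ n)) sums (x * s)" using that by (rule sums_mult)
    then have "(\<lambda>n. a (Suc n) * x ^ Suc n) sums (x * s)" by (simp add: a_def mult_ac)
    then show ?thesis by (subst (asm) sums_Suc_iff) (simp add: a_def)
  qed
  have "summable (\<lambda>n. c n * 1 ^ n)" using assms[of 1] sums_summable by auto
  then have "summable (\<lambda>n. c n * x ^ n)" if "norm x < 1" for x
    using powser_inside[of c 1 x] that by simp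
  then have "summable (\<lambda>n. a n * x ^ n)" if "norm x < 1" for x
    using a_sums[OF summable_sums] that sums_summable by blast
  then have f: "(\<lambda>n. a n * (x - 0) ^ n) sums f x" if "norm (x - 0) < 1" for x
    using that unfolding f_def by (simp add: summable_sums)
  have f0: "f 0 = 0" using powser_zero[of a] by (simp add: f_def a_def)
  obtain s where s: "0 < s" "\<And>z. z \<in> cball 0 s - {0} \<Longrightarrow> f z \<noteq> 0"
    by (rule powser_0_nonzero[where r = 1 and a = a and f = f and \<xi> = 0 and m = "Suc k"]) (use f f0 k in \<open>auto simp: a_def\<close>)
  define q where "q = min s (1/2)"
  have q: "0 < q" "q \<le> 1" "q \<le> s" "norm (q - 0) < 1" using s by (auto simp: q_def)
  have "f q = 0"
    using sums_unique2[OF f[OF q(4)]] a_sums[OF assms[OF q(1,2)]] by simp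
  moreover have "f q \<noteq> 0" using s(2)[of q] q by auto
  ultimately show False by simp
qed

locale one_sided_gibbs = prob_space M for M :: "array measure" +
  fixes \<psi> :: "int \<Rightarrow> real"
  assumes sets_M: "sets M = sets array_space"
    and measure_cylinder:
      "\<And>N l. interlacing_upto N l \<Longrightarrow> measure M (cylinder N l) = schur_det \<psi> N (\<lambda>j. l (N, j))"
    and psi_neg: "\<And>n. n < 0 \<Longrightarrow> \<psi> n = 0"
    and psi_sums: "(\<lambda>n. \<psi> (int n)) sums 1"
    and psi_exp: "\<exists>r>1. summable (\<lambda>n. \<bar>\<psi> (int n) * r ^ n\<bar>)"
    and psi_0: "\<psi> 0 \<noteq> 0"
begin

lemma space_M: "space M = interlacing_arrays"
  using sets_eq_imp_space_eq[OF sets_M] by (simp add: space_array_space)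

lemma cylinder_measurable [measurable]: "cylinder n l \<in> sets M"
  by (simp add: sets_M cylinder_in_sets)

text \<open>Read off from the first level, whose single entry has the law \<psi>. Positivity is thus
  inherited from \<open>M\<close> instead of being derived from the parameters.\<close>

lemma psi_nonneg: "0 \<le> \<psi> n"
proof -
  have "measure M (cylinder 1 (\<lambda>_. n)) = schur_det \<psi> 1 (\<lambda>_. n)"
    by (rule measure_cylinder) (simp add: interlacing_upto_def)
  also have "\<dots> = \<psi> n" by (simp add: schur_det_expand)
  finally show ?thesis using measure_nonneg by metis
qed

lemma psi_0_pos: "0 < \<psi> 0"
  using psi_nonneg[of 0] psi_0 by linarith

lemma measurable_determined:
  assumes "determined_by n f" "\<And>x. f x \<in> space N"
  shows "f \<in> measurable M N"
proof (rule measurableI)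
  fix A assume "A \<in> sets N"
  have "f -` A \<inter> space M = (\<Union>l\<in>{l \<in> patterns n. f l \<in> A}. cylinder n l)"
  proof (intro equalityI subsetI)
    fix x assume "x \<in> f -` A \<inter> space M"
    then show "x \<in> (\<Union>l\<in>{l \<in> patterns n. f l \<in> A}. cylinder n l)"
      by (intro UN_I[of "restrict x (levels n)"])
         (auto simp: space_M restrict_in_patterns in_cylinder_iff determined_by_restrict[OF assms(1)])
  next
    fix x assume "x \<in> (\<Union>l\<in>{l \<in> patterns n. f l \<in> A}. cylinder n l)"
    then obtain l where l: "l \<in> patterns n" "f l \<in> A" "x \<in> cylinder n l" by blast
    then have x: "x \<in> interlacing_arrays" by (simp add: cylinder_def)
    with l have "l = restrict x (levels n)" by (simp add: in_cylinder_iff)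
    then show "x \<in> f -` A \<inter> space M" using l x by (simp add: space_M determined_by_restrict[OF assms(1)])
  qed
  moreover have "\<dots> \<in> sets M"
    using countable_subset[OF _ countable_patterns[of n], of "{l \<in> patterns n. f l \<in> A}"]
    by (intro sets.countable_UN') auto
  ultimately show "f -` A \<inter> space M \<in> sets M" by simp
qed (use assms in auto)

lemma borel_measurable_determined:
  fixes f :: "array \<Rightarrow> 'a::topological_space"
  assumes "determined_by n f" shows "f \<in> borel_measurable M"
  using assms by (rule measurable_determined) simp

lemma level_sum_measurable [measurable]: "level_sum n \<in> measurable M (count_space UNIV)"
  by (rule measurable_determined[OF determined_by_level_sum[OF order_refl]]) simp

lemma level_diff_measurable [measurable]: "level_diff n \<in> measurable M (count_space UNIV)"
  by (rule measurable_determined[OF determined_by_level_diff]) simp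

lemma coord_measurable: "i \<in> levels n \<Longrightarrow> (\<lambda>x. x i) \<in> measurable M (count_space UNIV)"
  by (rule measurable_determined[OF determined_by_coord]) simp_all

text \<open>Conditioning on the first n levels, written as a countable sum over cylinders;
  \<open>f\<close> is constant on each of them.\<close>

lemma nn_integral_patterns_mult:
  assumes f: "determined_by n f" and [measurable]: "h \<in> borel_measurable M"
  shows "(\<integral>\<^sup>+x. f x * h x \<partial>M) =
    (\<integral>\<^sup>+l. f l * (\<integral>\<^sup>+x. h x * indicator (cylinder n l) x \<partial>M) \<partial>count_space (patterns n))"
proof -
  have "(\<integral>\<^sup>+x. f x * h x \<partial>M) =
    (\<integral>\<^sup>+x. (\<integral>\<^sup>+l. f l * (h x * indicator (cylinder n l) x) \<partial>count_space (patterns n)) \<partial>M)"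
  proof (rule nn_integral_cong)
    fix x assume x: "x \<in> space M"
    let ?l = "restrict x (levels n)"
    have "(\<integral>\<^sup>+l. f l * (h x * indicator (cylinder n l) x) \<partial>count_space (patterns n)) =
      (\<integral>\<^sup>+l. f x * h x * indicator {?l} l \<partial>count_space (patterns n))"
      using x by (intro nn_integral_cong)
        (auto simp: space_M in_cylinder_iff indicator_def determined_by_restrict[OF f] split: if_splits)
    also have "\<dots> = f x * h x"
      using x restrict_in_patterns[of x n] by (subst nn_integral_cmult_indicator) (auto simp: space_M)
    finally show "f x * h x = (\<integral>\<^sup>+l. f l * (h x * indicator (cylinder n l) x) \<partial>count_space (patterns n))" ..
  qed
  also have "\<dots> = (\<integral>\<^sup>+l. (\<integral>\<^sup>+x. f l * (h x * indicator (cylinder n l) x) \<partial>M) \<partial>count_space (patterns n))"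
    by (rule nn_integral_count_space_nn_integral[OF countable_patterns]) measurable
  also have "\<dots> = (\<integral>\<^sup>+l. f l * (\<integral>\<^sup>+x. h x * indicator (cylinder n l) x \<partial>M) \<partial>count_space (patterns n))"
    by (intro nn_integral_cong nn_integral_cmult) measurable
  finally show ?thesis .
qed

lemma nn_integral_patterns:
  assumes "determined_by n f"
  shows "(\<integral>\<^sup>+x. f x \<partial>M) = (\<integral>\<^sup>+l. f l * emeasure M (cylinder n l) \<partial>count_space (patterns n))"
  using nn_integral_patterns_mult[OF assms, of "\<lambda>_. 1"] by simp

lemma AE_patternsI:
  assumes P: "determined_by n P"
    and null: "\<And>l. l \<in> patterns n \<Longrightarrow> \<not> P l \<Longrightarrow> measure M (cylinder n l) = 0"
  shows "AE x in M. P x"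
proof -
  have "(\<integral>\<^sup>+x. (if P x then 0 else 1) \<partial>M) = 0"
  proof (subst nn_integral_patterns[of n])
    show "determined_by n (\<lambda>x. if P x then 0 else 1 :: ennreal)" by (rule determined_by_app[OF P])
    have "(\<integral>\<^sup>+l. (if P l then 0 else 1) * emeasure M (cylinder n l) \<partial>count_space (patterns n)) =
       (\<integral>\<^sup>+l. 0 \<partial>count_space (patterns n))"
      by (intro nn_integral_cong) (auto simp: emeasure_eq_measure null)
    then show "(\<integral>\<^sup>+l. (if P l then 0 else 1) * emeasure M (cylinder n l) \<partial>count_space (patterns n)) = 0" by simp
  qed
  moreover have [measurable]: "Measurable.pred M P"
    using measurable_determined[OF P] by simp
  ultimately have "AE x in M. (if P x then 0 else 1 :: ennreal) = 0"
    by (subst (asm) nn_integral_0_iff_AE) measurable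
  then show ?thesis by eventually_elim (auto split: if_splits)
qed

lemma AE_diag_nonneg: "AE x in M. 0 \<le> x (Suc n, Suc n)"
proof (rule AE_patternsI[of "Suc n"])
  show "determined_by (Suc n) (\<lambda>x. 0 \<le> x (Suc n, Suc n))"
    by (rule determined_by_app[OF determined_by_coord]) simp
  fix l assume l: "l \<in> patterns (Suc n)" "\<not> 0 \<le> l (Suc n, Suc n)"
  then have "measure M (cylinder (Suc n) l) = schur_det \<psi> (Suc n) (\<lambda>j. l (Suc n, j))"
    by (intro measure_cylinder) (simp add: patterns_def)
  also have "\<dots> = 0" using l psi_neg by (intro schur_det_negative) auto
  finally show "measure M (cylinder (Suc n) l) = 0" .
qed

lemma AE_nonneg: "AE x in M. \<forall>i\<in>array_index. 0 \<le> x i"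
proof -
  have "AE x in M. \<forall>n. 0 \<le> x (Suc n, Suc n)" using AE_diag_nonneg by (simp add: AE_all_countable)
  with AE_space show ?thesis
  proof eventually_elim
    fix x assume x: "x \<in> space M" "\<forall>n. 0 \<le> x (Suc n, Suc n)"
    show "\<forall>i\<in>array_index. 0 \<le> x i"
    proof
      fix i assume "i \<in> array_index"
      then obtain k j where i: "i = (Suc k, j)" "1 \<le> j" "j \<le> Suc k" by (cases i; cases "fst i") (auto simp: array_index_def)
      then have "x (Suc k, Suc k) \<le> x (Suc k, j)"
        using x by (intro interlacing_arrays_row_mono) (auto simp: space_M)
      then show "0 \<le> x i" using x i by (metis order_trans)
    qed
  qed
qed

lemma AE_level_diff_nonneg: "AE x in M. 0 \<le> level_diff n x"
  using AE_diag_nonneg[of n] AE_space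
proof eventually_elim
  case (elim x)
  then show ?case using level_diff_ge[of x n] by (simp add: space_M)
qed

lemma psi_power_summable:
  assumes "0 \<le> q" "q \<le> 1" shows "summable (\<lambda>n. \<psi> (int n) * q ^ n)"
  by (rule summable_comparison_test'[OF sums_summable[OF psi_sums]])
     (use assms psi_nonneg in \<open>auto simp: abs_mult power_le_one intro!: mult_left_le\<close>)

text \<open>The branching rule for the tilted coefficients q^m \<psi>(m), carried over to
  \<open>M\<close> by gluing the interlacing rows on top of \<open>l\<close>. Almost all of the
  cylinder lies in \<open>C\<close>, whose sign condition is the lower endpoint 0 in
  \<open>branch_set\<close>.\<close>

lemma expectation_cylinder_power:
  assumes l: "l \<in> patterns n" and q: "0 < q" "q \<le> 1"
  defines "C \<equiv> {x \<in> cylinder n l. 0 \<le> x (Suc n, Suc n)}"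
  shows "(\<integral>x. indicator C x * q powi level_sum (Suc n) x \<partial>M) =
    (\<Sum>m. \<psi> (int m) * q ^ m) * (q powi level_sum n l * measure M (cylinder n l))"
proof (cases "n \<ge> 1 \<longrightarrow> 0 \<le> l (n, n)")
  case False
  then have "measure M (cylinder n l) = 0"
    using l psi_neg by (subst measure_cylinder) (auto simp: patterns_def intro!: schur_det_negative)
  \<comment> \<open>The new last entry is at most \<open>l (n, n)\<close>, which is negative in this
    case.\<close>
  moreover have "C = {}"
  proof -
    have "\<not> 0 \<le> x (Suc n, Suc n)" if "x \<in> cylinder n l" for x
    proof -
      have "x (Suc n, Suc n) \<le> x (n, n)" "x (n, n) = l (n, n)"
        using that False interlacing_arrays_diag_mono[of x n n 1] by (auto simp: cylinder_def)
      then show ?thesis using False by linarith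
    qed
    then show ?thesis by (auto simp: C_def)
  qed
  ultimately show ?thesis by simp
next
  case True
  \<comment> \<open>The division by 1 matches the form of \<open>schur_det_scale\<close>.\<close>
  let ?\<phi> = "\<lambda>m. q powi m * \<psi> m / 1"
  define row where "row = (\<lambda>j. l (n, j))"
  define A where "A = (\<lambda>t. {x \<in> C. x (Suc n, 1) \<le> int t})"
  define ext where "ext = (\<lambda>\<nu> i. if fst i = Suc n then \<nu> (snd i) else l i :: int)"
  have il: "interlacing_upto n l" using l by (simp add: patterns_def)
  have dec: "row (Suc i) \<le> row i" if i: "1 \<le> i" "i < n" for i
  proof -
    obtain n' where n': "n = Suc n'" using i by (cases n) auto
    have "l (Suc n', Suc i) \<le> l (n', i)" "l (n', i) \<le> l (Suc n', i)"
      using il i n' by (auto simp: interlacing_upto_def)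
    then show ?thesis by (simp add: row_def n')
  qed
  have ext_il: "interlacing_upto (Suc n) (ext \<nu>)" if \<nu>: "\<nu> \<in> branch_set n row t" for \<nu> t
    unfolding interlacing_upto_def
  proof (intro allI impI)
    fix k j assume kj: "1 \<le> j \<and> j \<le> k \<and> k < Suc n"
    show "ext \<nu> (Suc k, Suc j) \<le> ext \<nu> (k, j) \<and> ext \<nu> (k, j) \<le> ext \<nu> (Suc k, j)"
    proof (cases "k = n")
      case True
      have "\<nu> (Suc j) \<in> {if Suc j = Suc n then 0 else row (Suc j)..if Suc j = 1 then int t else row (Suc j - 1)}"
        "\<nu> j \<in> {if j = Suc n then 0 else row j..if j = 1 then int t else row (j - 1)}"
        using kj True
        by (intro PiE_mem[OF \<nu>[unfolded branch_set_def]]; simp)+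
      then show ?thesis using True kj by (auto simp: ext_def row_def)
    next
      case False
      then show ?thesis using il kj by (auto simp: ext_def interlacing_upto_def)
    qed
  qed
  have A_int: "(\<integral>x. indicator (A t) x * q powi level_sum (Suc n) x \<partial>M) =
     (\<Sum>\<nu>\<in>branch_set n row t. schur_det ?\<phi> (Suc n) \<nu>)" for t
  proof -
    have fin: "finite (branch_set n row t)" unfolding branch_set_def by (intro finite_PiE) auto
    have "(\<integral>x. indicator (A t) x * q powi level_sum (Suc n) x \<partial>M) =
      (\<integral>x. (\<Sum>\<nu>\<in>branch_set n row t. q powi (\<Sum>j=1..Suc n. \<nu> j) * indicator (cylinder (Suc n) (ext \<nu>)) x) \<partial>M)"
    proof (rule Bochner_Integration.integral_cong[OF refl])
      fix x assume "x \<in> space M"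
      then have x: "x \<in> interlacing_arrays" by (simp add: space_M)
      define \<mu> where "\<mu> = restrict (\<lambda>j. x (Suc n, j)) {1..Suc n}"
      have mem: "x \<in> cylinder (Suc n) (ext \<nu>) \<longleftrightarrow> x \<in> cylinder n l \<and> \<nu> = \<mu>" if "\<nu> \<in> branch_set n row t" for \<nu>
      proof -
        have \<nu>: "\<nu> \<in> extensional {1..Suc n}" using that by (auto simp: branch_set_def PiE_def)
        have "x \<in> cylinder (Suc n) (ext \<nu>) \<longleftrightarrow> x \<in> cylinder n l \<and> (\<forall>j. 1 \<le> j \<and> j \<le> Suc n \<longrightarrow> x (Suc n, j) = \<nu> j)"
          using x by (auto simp: cylinder_def ext_def le_Suc_eq)
        also have "(\<forall>j. 1 \<le> j \<and> j \<le> Suc n \<longrightarrow> x (Suc n, j) = \<nu> j) \<longleftrightarrow> \<nu> = \<mu>"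
          using \<nu> by (auto simp: \<mu>_def extensional_def fun_eq_iff restrict_def)
        finally show ?thesis .
      qed
      have inA: "x \<in> A t \<longleftrightarrow> x \<in> cylinder n l \<and> \<mu> \<in> branch_set n row t"
      proof (cases "x \<in> cylinder n l")
        case True
        then have xl: "x (n, j) = row j" if "1 \<le> j" "j \<le> n" for j using that by (auto simp: cylinder_def row_def)
        have "\<mu> \<in> branch_set n row t \<longleftrightarrow> (\<forall>j\<in>{1..Suc n}. \<mu> j \<in> {if j = Suc n then 0 else row j..if j = 1 then int t else row (j - 1)})"
          by (auto simp: branch_set_def \<mu>_def PiE_iff)
        also have "\<dots> \<longleftrightarrow> 0 \<le> x (Suc n, Suc n) \<and> x (Suc n, 1) \<le> int t"
        proof
          assume H: "0 \<le> x (Suc n, Suc n) \<and> x (Suc n, 1) \<le> int t"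
          have lower: "row j \<le> x (Suc n, j)" if "1 \<le> j" "j \<le> n" for j
            using interlacing_arraysD(2)[OF x that] xl[OF that] by simp
          have upper: "x (Suc n, j) \<le> row (j - 1)" if "1 < j" "j \<le> Suc n" for j
          proof -
            have "x (Suc n, Suc (j - 1)) \<le> x (n, j - 1)"
              using that by (intro interlacing_arraysD x) auto
            then show ?thesis using xl[of "j - 1"] that by simp
          qed
          show "\<forall>j\<in>{1..Suc n}. \<mu> j \<in> {if j = Suc n then 0 else row j..if j = 1 then int t else row (j - 1)}"
          proof
            fix j assume j: "j \<in> {1..Suc n}"
            then have "(if j = Suc n then 0 else row j) \<le> x (Suc n, j)" using H lower[of j] by simp
            moreover have "x (Suc n, j) \<le> (if j = 1 then int t else row (j - 1))" using H upper[of j] j by simp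
            ultimately show "\<mu> j \<in> {if j = Suc n then 0 else row j..if j = 1 then int t else row (j - 1)}"
              using j by (simp only: \<mu>_def restrict_apply' atLeastAtMost_iff)
          qed
        next
          assume H: "\<forall>j\<in>{1..Suc n}. \<mu> j \<in> {if j = Suc n then 0 else row j..if j = 1 then int t else row (j - 1)}"
          have "\<mu> (Suc n) \<in> {if Suc n = Suc n then 0 else row (Suc n)..if Suc n = 1 then int t else row (Suc n - 1)}"
            "\<mu> 1 \<in> {if 1 = Suc n then 0 else row 1..if 1 = (1::nat) then int t else row (1 - 1)}"
            by (rule bspec[OF H], simp)+
          then show "0 \<le> x (Suc n, Suc n) \<and> x (Suc n, 1) \<le> int t" by (simp add: \<mu>_def)
        qed
        finally show ?thesis using True by (auto simp: A_def C_def)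
      qed (auto simp: A_def C_def)
      have "(\<Sum>\<nu>\<in>branch_set n row t. q powi (\<Sum>j=1..Suc n. \<nu> j) * indicator (cylinder (Suc n) (ext \<nu>)) x) =
        (\<Sum>\<nu>\<in>branch_set n row t. if \<nu> = \<mu> then q powi (\<Sum>j=1..Suc n. \<mu> j) * indicator (cylinder n l) x else 0)"
        by (intro sum.cong refl) (auto simp: mem indicator_def)
      also have "\<dots> = indicator (A t) x * q powi (\<Sum>j=1..Suc n. \<mu> j)"
        using fin by (auto simp: inA indicator_def)
      also have "(\<Sum>j=1..Suc n. \<mu> j) = level_sum (Suc n) x"
        unfolding level_sum_def by (intro sum.cong) (auto simp: \<mu>_def)
      finally show "indicator (A t) x * q powi level_sum (Suc n) x =
        (\<Sum>\<nu>\<in>branch_set n row t. q powi (\<Sum>j=1..Suc n. \<nu> j) * indicator (cylinder (Suc n) (ext \<nu>)) x)" ..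
    qed
    also have "\<dots> = (\<Sum>\<nu>\<in>branch_set n row t. q powi (\<Sum>j=1..Suc n. \<nu> j) * measure M (cylinder (Suc n) (ext \<nu>)))"
      by (subst Bochner_Integration.integral_sum) (auto simp: emeasure_eq_measure)
    also have "\<dots> = (\<Sum>\<nu>\<in>branch_set n row t. schur_det ?\<phi> (Suc n) \<nu>)"
    proof (rule sum.cong[OF refl])
      fix \<nu> assume "\<nu> \<in> branch_set n row t"
      then have "measure M (cylinder (Suc n) (ext \<nu>)) = schur_det \<psi> (Suc n) \<nu>"
        by (subst measure_cylinder[OF ext_il]) (auto intro!: schur_det_cong simp: ext_def)
      then show "q powi (\<Sum>j=1..Suc n. \<nu> j) * measure M (cylinder (Suc n) (ext \<nu>)) = schur_det ?\<phi> (Suc n) \<nu>"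
        using schur_det_scale[of q \<psi> 1 "Suc n" \<nu>] q by simp
    qed
    finally show ?thesis .
  qed
  have "(\<lambda>t. \<Sum>\<nu>\<in>branch_set n row t. schur_det ?\<phi> (Suc n) \<nu>) \<longlonglongrightarrow> (\<Sum>m. ?\<phi> (int m)) * schur_det ?\<phi> n row"
    using psi_power_summable[of q] q True dec
    by (intro schur_branching_LIMSEQ) (auto simp: psi_neg mult.commute row_def)
  \<comment> \<open>Removal of the cutoff: \<open>A t\<close> increases to \<open>C\<close>, and the
    integrand is almost surely at most 1, because the level sums are nonnegative and q \<le>
    1.\<close>
  moreover have "(\<lambda>t. \<integral>x. indicator (A t) x * q powi level_sum (Suc n) x \<partial>M) \<longlonglongrightarrow>
     (\<integral>x. indicator C x * q powi level_sum (Suc n) x \<partial>M)"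
  proof (rule integral_dominated_convergence[where w = "\<lambda>_. 1"])
    have [measurable]: "(\<lambda>x. x (Suc n, 1)) \<in> measurable M (count_space UNIV)"
      "(\<lambda>x. x (Suc n, Suc n)) \<in> measurable M (count_space UNIV)"
      by (rule coord_measurable[of _ "Suc n"], simp)+
    have sub: "cylinder n l \<subseteq> space M" by (auto simp: space_M cylinder_def)
    have C_eq: "C = cylinder n l \<inter> {x \<in> space M. 0 \<le> x (Suc n, Suc n)}" using sub by (auto simp: C_def)
    have A_eq: "A t = cylinder n l \<inter> {x \<in> space M. 0 \<le> x (Suc n, Suc n) \<and> x (Suc n, 1) \<le> int t}" for t
      using sub by (auto simp: C_def A_def)
    have [measurable]: "C \<in> sets M" "\<And>t. A t \<in> sets M" unfolding C_eq A_eq by measurable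
    show "(\<lambda>x. indicator C x * q powi level_sum (Suc n) x) \<in> borel_measurable M"
      "\<And>t. (\<lambda>x. indicator (A t) x * q powi level_sum (Suc n) x) \<in> borel_measurable M" by measurable
    show "AE x in M. (\<lambda>t. indicator (A t) x * q powi level_sum (Suc n) x) \<longlonglongrightarrow> indicator C x * q powi level_sum (Suc n) x"
    proof (rule AE_I2, rule tendsto_eventually)
      fix x
      show "\<forall>\<^sub>F t in sequentially. indicator (A t) x * q powi level_sum (Suc n) x = indicator C x * q powi level_sum (Suc n) x"
        using eventually_ge_at_top[of "nat (x (Suc n, 1))"]
        by eventually_elim (auto simp: A_def indicator_def)
    qed
    show "AE x in M. norm (indicator (A t) x * q powi level_sum (Suc n) x) \<le> 1" for t
      using AE_nonneg AE_space
    proof eventually_elim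
      case (elim x)
      have "0 \<le> level_sum (Suc n) x"
        unfolding level_sum_def using elim by (intro sum_nonneg) (auto simp: array_index_def)
      then have "q powi level_sum (Suc n) x \<le> 1" using q by (simp add: power_int_def power_le_one)
      then show ?case using q by (auto simp: indicator_def)
    qed
  qed simp
  ultimately have "(\<integral>x. indicator C x * q powi level_sum (Suc n) x \<partial>M) = (\<Sum>m. ?\<phi> (int m)) * schur_det ?\<phi> n row"
    using LIMSEQ_unique unfolding A_int by blast
  also have "schur_det ?\<phi> n row = q powi level_sum n l * measure M (cylinder n l)"
    using schur_det_scale[of q \<psi> 1 n row] q measure_cylinder[OF il] by (simp add: row_def level_sum_def)
  also have "(\<Sum>m. ?\<phi> (int m)) = (\<Sum>m. \<psi> (int m) * q ^ m)" by (simp add: mult.commute)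
  finally show ?thesis .
qed

text \<open>After division by q powi \<open>level_sum n l\<close>, the left side of
  \<open>expectation_cylinder_power\<close> is the generating function of the increment on the
  cylinder. It equals F(q) times the mass of the cylinder for all q in (0, 1], and comparing
  coefficients gives independence and the law \<psi> at once.\<close>

lemma measure_level_diff:
  assumes l: "l \<in> patterns n"
  shows "measure M (cylinder n l \<inter> {x \<in> space M. level_diff n x = int r}) = measure M (cylinder n l) * \<psi> (int r)"
proof -
  define C where "C = {x \<in> cylinder n l. 0 \<le> x (Suc n, Suc n)}"
  define E where "E = (\<lambda>r. C \<inter> {x \<in> space M. level_diff n x = int r})"
  have sub: "cylinder n l \<subseteq> space M" by (auto simp: space_M cylinder_def)
  have [measurable]: "(\<lambda>x. x (Suc n, Suc n)) \<in> measurable M (count_space UNIV)"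
    by (rule coord_measurable[of _ "Suc n"], simp)
  have C_eq: "C = cylinder n l \<inter> {x \<in> space M. 0 \<le> x (Suc n, Suc n)}" using sub by (auto simp: C_def)
  have [measurable]: "C \<in> sets M" unfolding C_eq by measurable
  have [measurable]: "E r \<in> sets M" for r unfolding E_def by measurable
  have D_nonneg: "0 \<le> level_diff n x" if "x \<in> C" for x
    using that sub level_diff_ge[of x n] by (force simp: C_def space_M)
  have sumE: "summable (\<lambda>r. measure M (E r))"
  proof -
    have "disjoint_family E" by (auto simp: disjoint_family_on_def E_def)
    moreover have "range E \<subseteq> sets M" by auto
    ultimately show ?thesis using finite_measure_UNION[of E] by (auto intro: sums_summable)
  qed
  have "(\<lambda>r. measure M (E r) * q ^ r) sums ((\<Sum>m. \<psi> (int m) * q ^ m) * measure M (cylinder n l))"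
    if q: "0 < q" "q \<le> 1" for q
  proof -
    have "(\<lambda>r. \<integral>x. indicator (E r) x * q ^ r \<partial>M) sums (\<integral>x. (\<Sum>r. indicator (E r) x * q ^ r) \<partial>M)"
    proof (rule sums_integral)
      show "integrable M (\<lambda>x. indicator (E r) x * q ^ r)" for r
        by (intro integrable_mult_left integrable_real_indicator) (auto simp: emeasure_eq_measure)
      have pt: "summable (\<lambda>r. norm (indicator (E r) x * q ^ r))" for x
        by (rule summable_finite[of "{nat (level_diff n x)}"]) (auto simp: E_def indicator_def)
      then show "AE x in M. summable (\<lambda>r. norm (indicator (E r) x * q ^ r))" by simp
      have "summable (\<lambda>r. measure M (E r) * q ^ r)"
        by (rule summable_comparison_test'[OF sumE]) (use q in \<open>auto simp: power_le_one intro!: mult_left_le\<close>)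
      then show "summable (\<lambda>r. \<integral>x. norm (indicator (E r) x * q ^ r) \<partial>M)"
        using q by (simp add: abs_mult)
    qed
    moreover have "(\<integral>x. (\<Sum>r. indicator (E r) x * q ^ r) \<partial>M) =
       (\<integral>x. inverse (q powi level_sum n l) * (indicator C x * q powi level_sum (Suc n) x) \<partial>M)"
    proof (rule Bochner_Integration.integral_cong[OF refl])
      fix x assume x: "x \<in> space M"
      show "(\<Sum>r. indicator (E r) x * q ^ r) = inverse (q powi level_sum n l) * (indicator C x * q powi level_sum (Suc n) x)"
      proof (cases "x \<in> C")
        case True
        have "level_sum n x = level_sum n l"
          using True by (auto simp: level_sum_def C_def cylinder_def intro!: sum.cong)
        then have D: "level_sum (Suc n) x = level_sum n l + level_diff n x" by (simp add: level_diff_def)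
        have "(\<Sum>r. indicator (E r) x * q ^ r) = (\<Sum>r\<in>{nat (level_diff n x)}. indicator (E r) x * q ^ r)"
          by (rule suminf_finite) (auto simp: E_def indicator_def)
        also have "\<dots> = q powi level_diff n x"
          using True x D_nonneg[OF True] by (simp add: E_def power_int_def)
        finally show ?thesis using True q by (simp add: D power_int_add)
      qed (auto simp: E_def)
    qed
    moreover have "\<dots> = inverse (q powi level_sum n l) * ((\<Sum>m. \<psi> (int m) * q ^ m) * (q powi level_sum n l * measure M (cylinder n l)))"
      using expectation_cylinder_power[OF l q] by (simp add: C_def)
    ultimately show ?thesis using q by (simp add: field_simps)
  qed
  moreover have "(\<lambda>r. measure M (cylinder n l) * \<psi> (int r) * q ^ r) sums ((\<Sum>m. \<psi> (int m) * q ^ m) * measure M (cylinder n l))"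
    if q: "0 < q" "q \<le> 1" for q
    using sums_mult[OF summable_sums[OF psi_power_summable[of q]], of "measure M (cylinder n l)"] q
    by (simp add: mult_ac)
  ultimately have "(\<lambda>r. (measure M (E r) - measure M (cylinder n l) * \<psi> (int r)) * q ^ r) sums 0"
    if q: "0 < q" "q \<le> 1" for q
    using sums_diff[of "\<lambda>r. measure M (E r) * q ^ r" _ "\<lambda>r. measure M (cylinder n l) * \<psi> (int r) * q ^ r"] q
    by (fastforce simp: left_diff_distrib)
  then have "measure M (E r) - measure M (cylinder n l) * \<psi> (int r) = 0"
    by (rule powser_eq_zero_coeff)
  moreover have "measure M (E r) = measure M (cylinder n l \<inter> {x \<in> space M. level_diff n x = int r})"
  proof (rule finite_measure_eq_AE)
    show "AE x in M. (x \<in> E r) = (x \<in> cylinder n l \<inter> {x \<in> space M. level_diff n x = int r})"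
      using AE_diag_nonneg[of n] by eventually_elim (auto simp: E_def C_def)
  qed measurable
  ultimately show ?thesis by simp
qed

text \<open>Summation of \<open>measure_level_diff\<close> over all patterns and increments;
  nonnegative integrands avoid questions of integrability at this stage.\<close>

lemma nn_integral_level_diff:
  fixes G :: "int \<Rightarrow> ennreal"
  assumes f: "determined_by n f"
  shows "(\<integral>\<^sup>+x. f x * G (level_diff n x) \<partial>M) =
    (\<integral>\<^sup>+x. f x \<partial>M) * (\<Sum>r. G (int r) * ennreal (\<psi> (int r)))"
proof -
  have [measurable]: "(\<lambda>x. G (level_diff n x)) \<in> borel_measurable M"
    by (rule measurable_compose[OF level_diff_measurable]) simp
  have "(\<integral>\<^sup>+x. G (level_diff n x) * indicator (cylinder n l) x \<partial>M) =
     emeasure M (cylinder n l) * (\<Sum>r. G (int r) * ennreal (\<psi> (int r)))" if l: "l \<in> patterns n" for l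
  proof -
    let ?E = "\<lambda>r. cylinder n l \<inter> {x \<in> space M. level_diff n x = int r}"
    have "(\<integral>\<^sup>+x. G (level_diff n x) * indicator (cylinder n l) x \<partial>M) =
      (\<integral>\<^sup>+x. (\<Sum>r. G (int r) * indicator (?E r) x) \<partial>M)"
    proof (rule nn_integral_cong_AE)
      show "AE x in M. G (level_diff n x) * indicator (cylinder n l) x = (\<Sum>r. G (int r) * indicator (?E r) x)"
        using AE_level_diff_nonneg[of n] AE_space
      proof eventually_elim
        case (elim x)
        have "(\<Sum>r. G (int r) * indicator (?E r) x) = (\<Sum>r\<in>{nat (level_diff n x)}. G (int r) * indicator (?E r) x)"
          by (rule suminf_finite) (auto simp: indicator_def)
        then show ?case using elim by (simp add: indicator_def)
      qed
    qed
    also have "\<dots> = (\<Sum>r. \<integral>\<^sup>+x. G (int r) * indicator (?E r) x \<partial>M)"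
      by (rule nn_integral_suminf) measurable
    also have "\<dots> = (\<Sum>r. emeasure M (cylinder n l) * (G (int r) * ennreal (\<psi> (int r))))"
    proof (rule suminf_cong)
      fix r
      have "(\<integral>\<^sup>+x. G (int r) * indicator (?E r) x \<partial>M) = G (int r) * emeasure M (?E r)"
        by (rule nn_integral_cmult_indicator) measurable
      also have "emeasure M (?E r) = emeasure M (cylinder n l) * ennreal (\<psi> (int r))"
        using measure_level_diff[OF l, of r] psi_nonneg by (simp add: emeasure_eq_measure ennreal_mult')
      finally show "(\<integral>\<^sup>+x. G (int r) * indicator (?E r) x \<partial>M) = emeasure M (cylinder n l) * (G (int r) * ennreal (\<psi> (int r)))"
        by (simp add: mult_ac)
    qed
    finally show ?thesis by simp
  qed
  then have "(\<integral>\<^sup>+x. f x * G (level_diff n x) \<partial>M) =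
    (\<integral>\<^sup>+l. f l * emeasure M (cylinder n l) * (\<Sum>r. G (int r) * ennreal (\<psi> (int r))) \<partial>count_space (patterns n))"
    by (subst nn_integral_patterns_mult[OF f]) (auto intro!: nn_integral_cong simp: mult_ac)
  also have "\<dots> = (\<integral>\<^sup>+x. f x \<partial>M) * (\<Sum>r. G (int r) * ennreal (\<psi> (int r)))"
    by (subst nn_integral_patterns[OF f]) (auto intro!: nn_integral_multc)
  finally show ?thesis .
qed

lemma expectation_level_diff:
  fixes f :: "array \<Rightarrow> real" and G :: "int \<Rightarrow> real"
  assumes f: "determined_by n f" "AE x in M. 0 \<le> f x" "integrable M f"
    and G: "\<And>r. 0 \<le> G r" "(\<lambda>r. G (int r) * \<psi> (int r)) sums s"
  shows "has_bochner_integral M (\<lambda>x. f x * G (level_diff n x)) ((\<integral>x. f x \<partial>M) * s)"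
proof (rule has_bochner_integral_nn_integral)
  have [measurable]: "(\<lambda>x. G (level_diff n x)) \<in> borel_measurable M"
    by (rule measurable_compose[OF level_diff_measurable]) simp
  have [measurable]: "f \<in> borel_measurable M" using f by simp
  show "(\<lambda>x. f x * G (level_diff n x)) \<in> borel_measurable M" by measurable
  show "AE x in M. 0 \<le> f x * G (level_diff n x)" using f(2) by eventually_elim (simp add: G(1))
  have s: "0 \<le> s" using sums_le[OF _ sums_zero G(2)] G(1) psi_nonneg by simp
  show "0 \<le> (\<integral>x. f x \<partial>M) * s" using s f(2) by (intro mult_nonneg_nonneg integral_nonneg_AE)
  have "(\<integral>\<^sup>+x. ennreal (f x * G (level_diff n x)) \<partial>M) = (\<integral>\<^sup>+x. ennreal (f x) * ennreal (G (level_diff n x)) \<partial>M)"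
    using f(2) G(1) by (intro nn_integral_cong_AE) (auto simp: ennreal_mult)
  also have "\<dots> = (\<integral>\<^sup>+x. ennreal (f x) \<partial>M) * (\<Sum>r. ennreal (G (int r)) * ennreal (\<psi> (int r)))"
    by (rule nn_integral_level_diff[OF determined_by_app[OF f(1)]])
  also have "(\<Sum>r. ennreal (G (int r)) * ennreal (\<psi> (int r))) = ennreal s"
    using suminf_ennreal_eq[OF _ G(2)] G(1) psi_nonneg by (simp add: ennreal_mult)
  also have "(\<integral>\<^sup>+x. ennreal (f x) \<partial>M) = ennreal (\<integral>x. f x \<partial>M)"
    using f by (intro nn_integral_eq_integral) auto
  finally show "(\<integral>\<^sup>+x. ennreal (f x * G (level_diff n x)) \<partial>M) = ennreal ((\<integral>x. f x \<partial>M) * s)"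
    using s f(2) by (simp add: ennreal_mult integral_nonneg_AE)
qed

section \<open>Generating function of the increments and tilted densities\<close>

definition pgf :: "real \<Rightarrow> real" where
  "pgf s = (\<Sum>r. \<psi> (int r) * exp (- s) ^ r)"

text \<open>Minus the derivative in s of \<open>pgf s\<close>, which is F at exp (- s).\<close>

definition pgf' :: "real \<Rightarrow> real" where
  "pgf' s = (\<Sum>r. real r * \<psi> (int r) * exp (- s) ^ r)"

text \<open>The density, on the first \<open>n\<close> levels, of the measure with parameters transformed by time
  \<open>s\<close> with respect to \<open>M\<close>.\<close>

definition weight :: "nat \<Rightarrow> real \<Rightarrow> array \<Rightarrow> real" where
  "weight n s x = exp (- s * of_int (level_sum n x)) / pgf s ^ n"

lemma pgf_sums: "s \<ge> 0 \<Longrightarrow> (\<lambda>r. \<psi> (int r) * exp (- s) ^ r) sums pgf s"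
  unfolding pgf_def by (intro summable_sums psi_power_summable) auto

text \<open>With a radius above 1 the point exp (- s) is interior even for s = 0, so termwise
  differentiation is available on the closed half-line.\<close>

lemma psi_power_summable':
  obtains r where "r > 1" "\<And>x::real. norm x < r \<Longrightarrow> summable (\<lambda>n. \<psi> (int n) * x ^ n)"
proof -
  obtain r where r: "r > 1" "summable (\<lambda>n. \<bar>\<psi> (int n) * r ^ n\<bar>)" using psi_exp by blast
  have "summable (\<lambda>n. \<psi> (int n) * x ^ n)" if "norm x < r" for x
    using powser_inside[of "\<lambda>n. \<psi> (int n)" r x] summable_rabs_cancel[OF r(2)] that r(1) by simp
  with r that show ?thesis by blast
qed

lemma pgf'_sums:
  assumes "s \<ge> 0" shows "(\<lambda>r. real r * \<psi> (int r) * exp (- s) ^ r) sums pgf' s"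
proof -
  obtain r where r: "r > 1" "\<And>x::real. norm x < r \<Longrightarrow> summable (\<lambda>n. \<psi> (int n) * x ^ n)" by (rule psi_power_summable') blast
  let ?q = "exp (- s)"
  have q: "norm ?q < r" using r assms by (auto intro: le_less_trans[of _ 1])
  have "summable (\<lambda>n. diffs (\<lambda>n. \<psi> (int n)) n * ?q ^ n)"
    by (rule termdiff_converges[OF q r(2)])
  from sums_mult[OF diffs_equiv[OF this], of ?q]
  have "summable (\<lambda>n. ?q * (of_nat n * \<psi> (int n) * ?q ^ (n - Suc 0)))" using sums_summable by blast
  moreover have "?q * (of_nat n * \<psi> (int n) * ?q ^ (n - Suc 0)) = real n * \<psi> (int n) * ?q ^ n" for n
    by (cases n) auto
  ultimately show ?thesis unfolding pgf'_def by (simp add: summable_sums)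
qed

lemma DERIV_pgf:
  assumes "s \<ge> 0" shows "(pgf has_real_derivative - pgf' s) (at s)"
proof -
  obtain r where r: "r > 1" "\<And>x::real. norm x < r \<Longrightarrow> summable (\<lambda>n. \<psi> (int n) * x ^ n)" by (rule psi_power_summable') blast
  let ?q = "exp (- s)"
  have q: "norm ?q < r" using r assms by (auto intro: le_less_trans[of _ 1])
  have sm: "summable (\<lambda>n. diffs (\<lambda>n. \<psi> (int n)) n * ?q ^ n)"
    by (rule termdiff_converges[OF q r(2)])
  let ?d = "\<Sum>n. diffs (\<lambda>n. \<psi> (int n)) n * ?q ^ n"
  have d: "((\<lambda>x. \<Sum>n. \<psi> (int n) * x ^ n) has_real_derivative ?d) (at ?q)"
    by (rule termdiffs_strong'[OF r(2) q])
  have "((\<lambda>s. exp (- s)) has_real_derivative - ?q) (at s)" by (auto intro!: derivative_eq_intros)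
  from DERIV_chain2[OF d this] have "(pgf has_real_derivative ?d * (- ?q)) (at s)"
    by (simp add: pgf_def[abs_def])
  moreover have "?q * ?d = pgf' s"
  proof -
    have "(\<lambda>n. ?q * (of_nat n * \<psi> (int n) * ?q ^ (n - Suc 0))) sums (?q * ?d)"
      by (rule sums_mult[OF diffs_equiv[OF sm]])
    moreover have "?q * (of_nat n * \<psi> (int n) * ?q ^ (n - Suc 0)) = real n * \<psi> (int n) * ?q ^ n" for n
      by (cases n) auto
    ultimately show ?thesis using pgf'_sums[OF assms] sums_unique2 by simp
  qed
  ultimately show ?thesis by (simp add: mult.commute)
qed

lemma pgf_ge: "s \<ge> 0 \<Longrightarrow> \<psi> 0 \<le> pgf s"
  using sum_le_suminf[OF sums_summable[OF pgf_sums], of s "{0}"] psi_nonneg by (simp add: pgf_def)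

lemma pgf_pos: "s \<ge> 0 \<Longrightarrow> 0 < pgf s"
  using pgf_ge psi_0_pos by force

lemma pgf_le_1: "s \<ge> 0 \<Longrightarrow> pgf s \<le> 1"
  by (rule sums_le[OF _ pgf_sums psi_sums]) (auto intro!: mult_left_le psi_nonneg power_le_one)

lemma pgf_0: "pgf 0 = 1"
  using pgf_sums[of 0] psi_sums sums_unique2 by simp

lemma pgf'_nonneg: "s \<ge> 0 \<Longrightarrow> 0 \<le> pgf' s"
  by (rule sums_le[OF _ sums_zero pgf'_sums]) (auto intro!: mult_nonneg_nonneg psi_nonneg)

lemma pgf'_le: "s \<ge> 0 \<Longrightarrow> pgf' s \<le> pgf' 0"
  by (rule sums_le[OF _ pgf'_sums pgf'_sums]) (auto intro!: mult_left_le mult_nonneg_nonneg psi_nonneg power_le_one)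

lemma weight_Suc:
  "weight (Suc n) s x = weight n s x * (exp (- s * of_int (level_diff n x)) / pgf s)"
  by (simp add: weight_def level_diff_def exp_add[symmetric] algebra_simps)

lemma determined_by_weight: "m \<le> n \<Longrightarrow> determined_by n (weight m s)"
  unfolding weight_def[abs_def]
  by (rule determined_by_app[OF determined_by_level_sum, where h = "\<lambda>m. exp (- s * of_int m) / _"])

lemma weight_measurable [measurable]: "weight n s \<in> borel_measurable M"
  by (rule borel_measurable_determined[OF determined_by_weight[OF order_refl]])

lemma weight_pos: "s \<ge> 0 \<Longrightarrow> 0 < weight n s x"
  using pgf_pos by (simp add: weight_def)

lemma AE_level_sum_nonneg: "AE x in M. 0 \<le> level_sum n x"
  using AE_nonneg by eventually_elim (rule level_sum_nonneg)

text \<open>Uniform in s, because \<psi> 0 \<le> pgf s. This is the majorant when differentiating in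
  s under the integral.\<close>

lemma weight_le:
  assumes "s \<ge> 0" "0 \<le> level_sum n x" shows "weight n s x \<le> 1 / \<psi> 0 ^ n"
  unfolding weight_def using assms psi_0_pos pgf_ge[of s]
  by (intro frac_le power_mono) auto

lemma integrable_weight_mult:
  assumes s: "s \<ge> 0" and f: "integrable M f"
  shows "integrable M (\<lambda>x. weight n s x * f x)"
proof (rule Bochner_Integration.integrable_bound)
  show "integrable M (\<lambda>x. 1 / \<psi> 0 ^ n * f x)" using f by simp
  have [measurable]: "f \<in> borel_measurable M" using f by simp
  show "(\<lambda>x. weight n s x * f x) \<in> borel_measurable M" by measurable
  show "AE x in M. norm (weight n s x * f x) \<le> norm (1 / \<psi> 0 ^ n * f x)"
    using AE_level_sum_nonneg[of n]
  proof eventually_elim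
    case (elim x)
    then show ?case
      unfolding norm_mult using weight_le[OF s elim] weight_pos[OF s, of n x] psi_0_pos by (intro mult_right_mono) auto
  qed
qed

lemma integrable_level_sum: "integrable M (\<lambda>x. real_of_int (level_sum n x))"
proof (induction n)
  case 0
  then show ?case by (simp add: level_sum_def)
next
  case (Suc n)
  have "has_bochner_integral M (\<lambda>x. (1::real) * \<bar>real_of_int (level_diff n x)\<bar>) ((\<integral>x. 1 \<partial>M) * pgf' 0)"
    using pgf'_sums[of 0] by (intro expectation_level_diff) auto
  then have "integrable M (\<lambda>x. \<bar>real_of_int (level_diff n x)\<bar>)" using integrable.intros by auto
  then have "integrable M (\<lambda>x. real_of_int (level_diff n x))"
    by (rule integrable_abs_cancel) (rule borel_measurable_determined[OF determined_by_app[OF determined_by_level_diff]])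
  then have "integrable M (\<lambda>x. real_of_int (level_sum n x) + real_of_int (level_diff n x))"
    using Suc by (rule Bochner_Integration.integrable_add[rotated])
  then show ?case by (simp add: level_diff_def)
qed

text \<open>Martingale property of the densities: the factor added by level n + 1 is independent of
  the first n levels and has mean 1 by the choice of \<open>pgf\<close>.\<close>

lemma expectation_weight_Suc:
  assumes s: "s \<ge> 0" and f: "determined_by n f" "AE x in M. 0 \<le> f x" "integrable M f"
  shows "(\<integral>x. weight (Suc n) s x * f x \<partial>M) = (\<integral>x. weight n s x * f x \<partial>M)"
proof -
  have "has_bochner_integral M (\<lambda>x. (weight n s x * f x) * (exp (- s * of_int (level_diff n x)) / pgf s))
     ((\<integral>x. weight n s x * f x \<partial>M) * 1)"
  proof (rule expectation_level_diff)
    show "determined_by n (\<lambda>x. weight n s x * f x)"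
      by (rule determined_by_app2[OF determined_by_weight[OF order_refl] f(1)])
    show "AE x in M. 0 \<le> weight n s x * f x"
      using f(2) by eventually_elim (auto intro!: mult_nonneg_nonneg less_imp_le[OF weight_pos[OF s]])
    show "integrable M (\<lambda>x. weight n s x * f x)" by (rule integrable_weight_mult[OF s f(3)])
    show "0 \<le> exp (- s * of_int r) / pgf s" for r using pgf_pos[OF s] by simp
    have "(\<lambda>r. \<psi> (int r) * exp (- s) ^ r / pgf s) sums (pgf s / pgf s)"
      by (rule sums_divide[OF pgf_sums[OF s]])
    then show "(\<lambda>r. exp (- s * of_int (int r)) / pgf s * \<psi> (int r)) sums 1"
      using pgf_pos[OF s] by (simp add: exp_of_nat_mult[symmetric] mult_ac)
  qed
  then have "(\<integral>x. (weight n s x * f x) * (exp (- s * of_int (level_diff n x)) / pgf s) \<partial>M) = (\<integral>x. weight n s x * f x \<partial>M)"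
    using has_bochner_integral_integral_eq by fastforce
  then show ?thesis by (simp add: weight_Suc mult_ac)
qed

lemma expectation_weight_mono:
  assumes s: "s \<ge> 0" and f: "determined_by n f" "AE x in M. 0 \<le> f x" "integrable M f" and "n \<le> m"
  shows "(\<integral>x. weight m s x * f x \<partial>M) = (\<integral>x. weight n s x * f x \<partial>M)"
  using \<open>n \<le> m\<close>
proof (induction m rule: dec_induct)
  case (step m)
  then show ?case
    using expectation_weight_Suc[OF s determined_by_mono[OF f(1)] f(2,3), of m] by simp
qed simp

text \<open>The quotient of \<open>pgf'\<close> and \<open>pgf\<close> is the mean of the increment
  under its tilted law.\<close>

lemma expectation_weight_level_diff:
  assumes s: "s \<ge> 0" and f: "determined_by n f" "AE x in M. 0 \<le> f x" "integrable M f"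
  shows "has_bochner_integral M (\<lambda>x. weight (Suc n) s x * of_int (level_diff n x) * f x)
    (pgf' s / pgf s * (\<integral>x. weight n s x * f x \<partial>M))"
proof -
  \<comment> \<open>\<open>expectation_level_diff\<close> asks for a function that is nonnegative
    everywhere; the increment is almost surely nonnegative, so the maximum changes nothing under the
    integral.\<close>
  let ?G = "\<lambda>r::int. max 0 (of_int r) * exp (- s * of_int r) / pgf s"
  have "has_bochner_integral M (\<lambda>x. (weight n s x * f x) * ?G (level_diff n x))
     ((\<integral>x. weight n s x * f x \<partial>M) * (pgf' s / pgf s))"
  proof (rule expectation_level_diff)
    show "determined_by n (\<lambda>x. weight n s x * f x)"
      by (rule determined_by_app2[OF determined_by_weight[OF order_refl] f(1)])
    show "AE x in M. 0 \<le> weight n s x * f x"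
      using f(2) by eventually_elim (auto intro!: mult_nonneg_nonneg less_imp_le[OF weight_pos[OF s]])
    show "integrable M (\<lambda>x. weight n s x * f x)" by (rule integrable_weight_mult[OF s f(3)])
    show "0 \<le> ?G r" for r using pgf_pos[OF s] by simp
    have "(\<lambda>r. real r * \<psi> (int r) * exp (- s) ^ r / pgf s) sums (pgf' s / pgf s)"
      by (rule sums_divide[OF pgf'_sums[OF s]])
    then show "(\<lambda>r. ?G (int r) * \<psi> (int r)) sums (pgf' s / pgf s)"
      by (simp add: exp_of_nat_mult[symmetric] mult_ac)
  qed
  moreover have [measurable]: "f \<in> borel_measurable M" using f by simp
  have [measurable]: "(\<lambda>x. ?G (level_diff n x)) \<in> borel_measurable M"
    "(\<lambda>x. real_of_int (level_diff n x)) \<in> borel_measurable M"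
    by (rule borel_measurable_determined[OF determined_by_app[OF determined_by_level_diff]])+
  have "has_bochner_integral M (\<lambda>x. (weight n s x * f x) * ?G (level_diff n x)) v \<longleftrightarrow>
      has_bochner_integral M (\<lambda>x. weight (Suc n) s x * of_int (level_diff n x) * f x) v" for v
  proof (rule has_bochner_integral_cong_AE)
    show "AE x in M. (weight n s x * f x) * ?G (level_diff n x) = weight (Suc n) s x * of_int (level_diff n x) * f x"
      using AE_level_diff_nonneg[of n] by eventually_elim (simp add: weight_Suc mult_ac)
  qed measurable
  ultimately show ?thesis by (simp add: mult.commute)
qed

text \<open>The value 0 at K = 0 stands for the zero appended to a repeated level and starts the
  recursion in K.\<close>

definition from_right :: "nat \<Rightarrow> nat \<Rightarrow> array \<Rightarrow> int" where
  "from_right K n x = (if 1 \<le> K \<and> K \<le> n then x (n, n + 1 - K) else 0)"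

lemma determined_by_from_right: "determined_by n (from_right K n)"
proof (rule determined_byI)
  fix x y :: array assume "\<And>i. i \<in> levels n \<Longrightarrow> x i = y i"
  moreover have "(n, n + 1 - K) \<in> levels n" if "1 \<le> K" "K \<le> n"
    using that unfolding levels_iff by linarith
  ultimately show "from_right K n x = from_right K n y"
    unfolding from_right_def by presburger
qed

lemma from_right_measurable [measurable]: "from_right K n \<in> measurable M (count_space UNIV)"
  by (rule measurable_determined[OF determined_by_from_right]) simp

lemma coord_le_level_sum:
  assumes "\<forall>i\<in>array_index. 0 \<le> x i" "1 \<le> j" "j \<le> n"
  shows "x (n, j) \<le> level_sum n x"
  unfolding level_sum_def using assms by (intro member_le_sum) (auto simp: array_index_def)

lemma from_right_bounds:
  assumes "\<forall>i\<in>array_index. 0 \<le> x i"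
  shows "0 \<le> from_right K n x" "from_right K n x \<le> level_sum n x"
proof -
  have "(n, n + 1 - K) \<in> array_index" if "1 \<le> K" "K \<le> n"
    using that unfolding array_index_def by simp linarith
  then show "0 \<le> from_right K n x" using assms unfolding from_right_def by simp
  have "0 \<le> level_sum n x" by (rule level_sum_nonneg[OF assms])
  then show "from_right K n x \<le> level_sum n x"
    using coord_le_level_sum[OF assms, of "n + 1 - K" n] by (auto simp: from_right_def)
qed

lemma integrable_from_right: "integrable M (\<lambda>x. real_of_int (from_right K n x))"
proof (rule Bochner_Integration.integrable_bound[OF integrable_level_sum[of n]])
  show "(\<lambda>x. real_of_int (from_right K n x)) \<in> borel_measurable M"
    by (rule borel_measurable_determined[OF determined_by_app[OF determined_by_from_right]])
  show "AE x in M. norm (real_of_int (from_right K n x)) \<le> norm (real_of_int (level_sum n x))"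
    using AE_nonneg
  proof eventually_elim
    case (elim x)
    then show ?case using from_right_bounds[OF elim, of K n] by simp
  qed
qed

text \<open>If the level is repeated with a zero appended, distances from the right grow by one. In
  any other case interlacing still makes the entries decrease along the diagonal at fixed distance
  from the right.\<close>

lemma from_right_Suc_le:
  assumes x: "x \<in> interlacing_arrays" "\<forall>i\<in>array_index. 0 \<le> x i" and K: "K < n"
  shows "from_right (Suc K) (Suc n) x \<le>
    (if level_diff n x = 0 then from_right K n x else from_right (Suc K) n x)"
proof (cases "level_diff n x = 0")
  case True
  have nn: "x (Suc n, Suc n) \<ge> 0" using x(2) by (auto simp: array_index_def)
  show ?thesis
  proof (cases "K = 0")
    case True
    then show ?thesis using level_diff_eq_0(1)[OF x(1) \<open>level_diff n x = 0\<close> nn] \<open>level_diff n x = 0\<close>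
      by (simp add: from_right_def)
  next
    case False
    then show ?thesis using level_diff_eq_0(2)[OF x(1) \<open>level_diff n x = 0\<close> nn, of "Suc n - K"] \<open>level_diff n x = 0\<close> K
      by (simp add: from_right_def)
  qed
next
  case False
  have "x (n + 1, n - K + 1) \<le> x (n, n - K)"
    using K by (intro interlacing_arrays_diag_mono[OF x(1)]) auto
  then show ?thesis using False K by (simp add: from_right_def Suc_diff_le)
qed

text \<open>With probability at least \<open>\<psi> 0\<close>, independently of the past, the new level is the old one with
  a zero appended. Hence the entries at a fixed distance from the right edge decay geometrically.\<close>

lemma from_right_decay_step:
  assumes s: "s \<ge> 0" and K: "K < n"
  shows "(\<integral>x. weight (Suc n) s x * from_right (Suc K) (Suc n) x \<partial>M) \<le>
    \<psi> 0 * (\<integral>x. weight n s x * from_right K n x \<partial>M) +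
    (1 - \<psi> 0) * (\<integral>x. weight n s x * from_right (Suc K) n x \<partial>M)"
proof -
  let ?a = "\<lambda>K. \<integral>x. weight n s x * from_right K n x \<partial>M"
  \<comment> \<open>The factor exp (- s r) / pgf s is split according to whether the increment r
    vanishes. The tilted probability of a zero increment is \<psi> 0 / pgf s.\<close>
  let ?G0 = "\<lambda>r::int. if r = 0 then 1 / pgf s else 0"
  let ?G1 = "\<lambda>r::int. if r = 0 then 0 else exp (- s * of_int r) / pgf s"
  have nn: "AE x in M. 0 \<le> weight n s x * from_right K n x" for K
    using AE_nonneg
    by eventually_elim (auto intro!: mult_nonneg_nonneg less_imp_le[OF weight_pos[OF s]] from_right_bounds)
  have det: "determined_by n (\<lambda>x. weight n s x * from_right K n x)" for K
    by (rule determined_by_app2[OF determined_by_weight[OF order_refl] determined_by_app[OF determined_by_from_right]])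
  have "(\<lambda>r. if r = 0 then \<psi> 0 / pgf s else 0) sums (\<psi> 0 / pgf s)"
    using sums_single[of 0 "\<lambda>_. \<psi> 0 / pgf s"] by simp
  also have "(\<lambda>r::nat. if r = 0 then \<psi> 0 / pgf s else 0) = (\<lambda>r. ?G0 (int r) * \<psi> (int r))" by auto
  finally have G0: "(\<lambda>r. ?G0 (int r) * \<psi> (int r)) sums (\<psi> 0 / pgf s)" .
  have "(\<lambda>r. \<psi> (int r) * exp (- s) ^ r / pgf s - ?G0 (int r) * \<psi> (int r)) sums (pgf s / pgf s - \<psi> 0 / pgf s)"
    by (intro sums_diff sums_divide pgf_sums s G0)
  also have "(\<lambda>r. \<psi> (int r) * exp (- s) ^ r / pgf s - ?G0 (int r) * \<psi> (int r)) = (\<lambda>r. ?G1 (int r) * \<psi> (int r))"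
    by (auto simp: exp_of_nat_mult[symmetric] mult_ac)
  finally have G1: "(\<lambda>r. ?G1 (int r) * \<psi> (int r)) sums (1 - \<psi> 0 / pgf s)"
    using pgf_pos[OF s] by simp
  have E0: "has_bochner_integral M (\<lambda>x. (weight n s x * from_right K n x) * ?G0 (level_diff n x)) (?a K * (\<psi> 0 / pgf s))"
    using pgf_pos[OF s] by (intro expectation_level_diff det nn integrable_weight_mult[OF s] integrable_from_right G0) auto
  have E1: "has_bochner_integral M (\<lambda>x. (weight n s x * from_right (Suc K) n x) * ?G1 (level_diff n x)) (?a (Suc K) * (1 - \<psi> 0 / pgf s))"
    using pgf_pos[OF s] by (intro expectation_level_diff det nn integrable_weight_mult[OF s] integrable_from_right G1) auto
  note E = has_bochner_integral_add[OF E0 E1]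
  have "(\<integral>x. weight (Suc n) s x * from_right (Suc K) (Suc n) x \<partial>M) \<le> ?a K * (\<psi> 0 / pgf s) + ?a (Suc K) * (1 - \<psi> 0 / pgf s)"
    unfolding has_bochner_integral_integral_eq[OF E, symmetric]
  proof (rule integral_mono_AE)
    show "integrable M (\<lambda>x. weight (Suc n) s x * real_of_int (from_right (Suc K) (Suc n) x))"
      by (rule integrable_weight_mult[OF s integrable_from_right])
    show "integrable M (\<lambda>x. (weight n s x * from_right K n x) * ?G0 (level_diff n x) + (weight n s x * from_right (Suc K) n x) * ?G1 (level_diff n x))"
      using E by (rule integrable.intros)
    show "AE x in M. weight (Suc n) s x * real_of_int (from_right (Suc K) (Suc n) x) \<le>
      (weight n s x * from_right K n x) * ?G0 (level_diff n x) + (weight n s x * from_right (Suc K) n x) * ?G1 (level_diff n x)"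
      using AE_nonneg AE_space
    proof eventually_elim
      case (elim x)
      then have "from_right (Suc K) (Suc n) x \<le> (if level_diff n x = 0 then from_right K n x else from_right (Suc K) n x)"
        by (intro from_right_Suc_le K) (auto simp: space_M)
      then have "weight (Suc n) s x * real_of_int (from_right (Suc K) (Suc n) x) \<le>
        weight (Suc n) s x * real_of_int (if level_diff n x = 0 then from_right K n x else from_right (Suc K) n x)"
        using weight_pos[OF s, of "Suc n" x] by (intro mult_left_mono) auto
      also have "\<dots> = (weight n s x * from_right K n x) * ?G0 (level_diff n x) + (weight n s x * from_right (Suc K) n x) * ?G1 (level_diff n x)"
        by (simp add: weight_Suc)
      finally show ?case .
    qed
  qed
  also have "\<dots> \<le> \<psi> 0 * ?a K + (1 - \<psi> 0) * ?a (Suc K)"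
  proof -
    \<comment> \<open>Rows decrease, so lowering the weight of \<open>?a K\<close> in the convex
      combination from \<psi> 0 / pgf s to \<psi> 0 can only increase it.\<close>
    have "?a K \<le> ?a (Suc K)"
    proof (rule integral_mono_AE)
      show "AE x in M. weight n s x * real_of_int (from_right K n x) \<le> weight n s x * real_of_int (from_right (Suc K) n x)"
        using AE_nonneg AE_space
      proof eventually_elim
        case (elim x)
        have "x (n, n + 1 - K) \<le> x (n, n - K)" if "K \<ge> 1"
          using elim K that by (intro interlacing_arrays_row_mono) (auto simp: space_M)
        then have "from_right K n x \<le> from_right (Suc K) n x"
          using K elim by (auto simp: from_right_def array_index_def)
        then show ?case using weight_pos[OF s, of n x] by (intro mult_left_mono) auto
      qed
    qed (intro integrable_weight_mult[OF s] integrable_from_right)+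
    moreover have "\<psi> 0 \<le> \<psi> 0 / pgf s"
      using pgf_le_1[OF s] pgf_pos[OF s] psi_0_pos by (simp add: field_simps)
    ultimately have "0 \<le> (\<psi> 0 / pgf s - \<psi> 0) * (?a (Suc K) - ?a K)" by simp
    then show ?thesis by (simp add: algebra_simps)
  qed
  finally show ?thesis .
qed

lemma psi_0_le_1: "\<psi> 0 \<le> 1"
  using pgf_ge[of 0] by (simp add: pgf_0)

text \<open>The recursion contracts by 1 - \<psi> 0 but has a source term, coming from the neighbour
  on the right, that decays itself; giving up half of \<psi> 0 absorbs this term.\<close>

abbreviation "decay_rate \<equiv> 1 - \<psi> 0 / 2"

text \<open>Induction on K through \<open>from_right_decay_step\<close>. The constant depends on K
  but not on s, so that it can bound a derivative on all of [0, \<tau>].\<close>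

lemma from_right_decay:
  "\<exists>C\<ge>0. \<forall>n\<ge>K. \<forall>s\<ge>0. (\<integral>x. weight n s x * from_right K n x \<partial>M) \<le> C * decay_rate ^ n"
proof (induction K)
  case 0
  then show ?case by (intro exI[of _ 0]) (auto simp: from_right_def)
next
  case (Suc K)
  then obtain C where C: "C \<ge> 0"
    "\<And>n s. n \<ge> K \<Longrightarrow> s \<ge> 0 \<Longrightarrow> (\<integral>x. weight n s x * from_right K n x \<partial>M) \<le> C * decay_rate ^ n" by blast
  have r: "0 < decay_rate" using psi_0_le_1 by simp
  define B where "B = (\<integral>x. 1 / \<psi> 0 ^ Suc K * of_int (level_sum (Suc K) x) \<partial>M)"
  \<comment> \<open>The part 2 C lets the induction step close at the rate 1 - \<psi> 0 / 2; the
    other part covers the base level Suc K.\<close>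
  define C' where "C' = max (2 * C) (B / decay_rate ^ Suc K)"
  have "(\<integral>x. weight n s x * from_right (Suc K) n x \<partial>M) \<le> C' * decay_rate ^ n" if "n \<ge> Suc K" "s \<ge> 0" for n s
    using that(1)
  proof (induction n rule: dec_induct)
    case base
    have "(\<integral>x. weight (Suc K) s x * from_right (Suc K) (Suc K) x \<partial>M) \<le> B"
      unfolding B_def
    proof (rule integral_mono_AE)
      show "integrable M (\<lambda>x. weight (Suc K) s x * real_of_int (from_right (Suc K) (Suc K) x))"
        by (rule integrable_weight_mult[OF \<open>s \<ge> 0\<close> integrable_from_right])
      show "integrable M (\<lambda>x. 1 / \<psi> 0 ^ Suc K * real_of_int (level_sum (Suc K) x))"
        by (intro integrable_mult_right integrable_level_sum)
      show "AE x in M. weight (Suc K) s x * real_of_int (from_right (Suc K) (Suc K) x) \<le> 1 / \<psi> 0 ^ Suc K * real_of_int (level_sum (Suc K) x)"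
        using AE_nonneg AE_level_sum_nonneg[of "Suc K"]
      proof eventually_elim
        case (elim x)
        then show ?case
          using weight_le[OF \<open>s \<ge> 0\<close> elim(2)] from_right_bounds[OF elim(1), of "Suc K" "Suc K"] psi_0_pos
          by (intro mult_mono) auto
      qed
    qed
    also have "\<dots> \<le> C' * decay_rate ^ Suc K"
      using r by (simp add: C'_def pos_divide_le_eq[symmetric])
    finally show ?case .
  next
    case (step n)
    have "(\<integral>x. weight (Suc n) s x * from_right (Suc K) (Suc n) x \<partial>M) \<le>
      \<psi> 0 * (\<integral>x. weight n s x * from_right K n x \<partial>M) + (1 - \<psi> 0) * (\<integral>x. weight n s x * from_right (Suc K) n x \<partial>M)"
      by (rule from_right_decay_step[OF that(2)]) (use step(1) in simp)
    also have "\<dots> \<le> \<psi> 0 * (C * decay_rate ^ n) + (1 - \<psi> 0) * (C' * decay_rate ^ n)"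
    proof (intro add_mono mult_left_mono)
      show "(\<integral>x. weight n s x * from_right K n x \<partial>M) \<le> C * decay_rate ^ n"
        using step(1) that(2) by (intro C(2)) simp_all
      show "(\<integral>x. weight n s x * from_right (Suc K) n x \<partial>M) \<le> C' * decay_rate ^ n" by (rule step.IH)
    qed (use psi_0_pos psi_0_le_1 in simp_all)
    also have "\<dots> = (\<psi> 0 * C + (1 - \<psi> 0) * C') * decay_rate ^ n" by (simp add: algebra_simps)
    also have "\<dots> \<le> (C' * decay_rate) * decay_rate ^ n"
    proof (rule mult_right_mono)
      have "2 * C \<le> C'" by (simp add: C'_def)
      then have "\<psi> 0 * (2 * C) \<le> \<psi> 0 * C'" using psi_0_pos by (intro mult_left_mono) auto
      then show "\<psi> 0 * C + (1 - \<psi> 0) * C' \<le> C' * decay_rate" by (simp add: algebra_simps)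
    qed (use r in auto)
    finally show ?case by (simp add: mult_ac)
  qed
  moreover have "C' \<ge> 0" using C by (simp add: C'_def)
  ultimately show ?case by blast
qed

end

section \<open>The generator and its adjoint\<close>

text \<open>Replaces the function \<open>J\<close> by one condition per strip, which is the form in
  which the dynamics uses it. Conversely \<open>J N\<close> may be taken as the first position from
  which row N vanishes.\<close>

lemma eventually_zero_arrays_strip_iff:
  "x \<in> \<S>\<^sup>c \<longleftrightarrow> x \<in> interlacing_arrays \<and> (\<forall>i\<in>array_index. 0 \<le> x i) \<and>
     (\<forall>K. \<exists>n0. \<forall>n j. n0 \<le> n \<and> (n, j) \<in> strip K \<longrightarrow> x (n, j) = 0)"
  (is "_ \<longleftrightarrow> ?R")
proof
  assume "x \<in> \<S>\<^sup>c"
  then obtain J where x: "x \<in> interlacing_arrays" "\<forall>i\<in>array_index. 0 \<le> x i"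
    and J: "filterlim (\<lambda>N. int N - J N) at_top sequentially"
      "\<And>N j. 1 \<le> j \<and> j \<le> N \<and> J N \<le> int j \<Longrightarrow> x (N, j) = 0"
    unfolding eventually_zero_arrays_def by blast
  have "\<exists>n0. \<forall>n j. n0 \<le> n \<and> (n, j) \<in> strip K \<longrightarrow> x (n, j) = 0" for K
  proof -
    have "eventually (\<lambda>N. int K \<le> int N - J N) sequentially"
      using J(1) unfolding filterlim_at_top by blast
    then obtain n0 where n0: "\<And>n. n \<ge> n0 \<Longrightarrow> int K \<le> int n - J n"
      unfolding eventually_sequentially by blast
    have "x (n, j) = 0" if "n0 \<le> n" "(n, j) \<in> strip K" for n j
      using n0[OF that(1)] that(2) by (intro J(2)) (auto simp: strip_def)
    then show ?thesis by blast
  qed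
  with x show ?R by blast
next
  assume R: ?R
  define Q where "Q = (\<lambda>N m. \<forall>j. m \<le> j \<and> 1 \<le> j \<and> j \<le> N \<longrightarrow> x (N, j) = 0)"
  define J where "J = (\<lambda>N. int (Least (Q N)))"
  have "Q N (Suc N)" for N by (simp add: Q_def)
  then have Q: "Q N (Least (Q N))" for N by (rule LeastI)
  have "filterlim (\<lambda>N. int N - J N) at_top sequentially"
    unfolding filterlim_at_top
  proof
    fix Z :: int
    define K where "K = Suc (nat Z)"
    obtain n0 where n0: "\<And>n j. n0 \<le> n \<Longrightarrow> (n, j) \<in> strip K \<Longrightarrow> x (n, j) = 0" using R by blast
    show "eventually (\<lambda>N. Z \<le> int N - J N) sequentially"
      using eventually_ge_at_top[of "max n0 K"]
    proof eventually_elim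
      case (elim N)
      have "Q N (N + 1 - K)"
        using elim n0[of N] by (auto simp: Q_def strip_def)
      then have "Least (Q N) \<le> N + 1 - K" by (rule Least_le)
      then show "Z \<le> int N - J N" using elim by (auto simp: J_def K_def)
    qed
  qed
  moreover have "\<forall>N j. 1 \<le> j \<and> j \<le> N \<and> J N \<le> int j \<longrightarrow> x (N, j) = 0"
  proof (intro allI impI)
    fix N j assume a: "1 \<le> j \<and> j \<le> N \<and> J N \<le> int j"
    have QD: "x (N, j) = 0" if "Q N m" "m \<le> j" for m
      using that a by (simp add: Q_def)
    show "x (N, j) = 0" using a by (intro QD[OF Q]) (simp add: J_def)
  qed
  ultimately show "x \<in> \<S>\<^sup>c"
    unfolding eventually_zero_arrays_def using R by blast
qed

text \<open>Zeros propagate along the diagonal to higher levels by interlacing and to the right by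
  monotonicity of the rows; nonnegativity turns the upper bounds into equalities.\<close>

lemma zero_diagonal_imp_strip_zero:
  assumes x: "x \<in> interlacing_arrays" "\<forall>i\<in>array_index. 0 \<le> x i"
    and K: "1 \<le> K" "K \<le> n" "x (n, n + 1 - K) = 0" and m: "n \<le> m" "(m, j) \<in> strip K"
  shows "x (m, j) = 0"
proof -
  have "x (m, j) \<le> x (m, m + 1 - K)"
    using K m by (intro interlacing_arrays_row_mono[OF x(1)]) (auto simp: strip_def)
  also have "x (n + (m - n), (n + 1 - K) + (m - n)) \<le> x (n, n + 1 - K)"
    using K by (intro interlacing_arrays_diag_mono[OF x(1)]) auto
  then have "x (m, m + 1 - K) \<le> 0" using K m by simp
  finally have "x (m, j) \<le> 0" .
  moreover have "0 \<le> x (m, j)" using x(2) m(2) by (auto simp: strip_def array_index_def)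
  ultimately show ?thesis by simp
qed

text \<open>One zero on each diagonal is enough, so membership reduces to countably many conditions
  on single coordinates. This form serves the measurability of \<open>\<S>\<^sup>c\<close>.\<close>

lemma eventually_zero_arrays_diagonal_iff:
  "x \<in> \<S>\<^sup>c \<longleftrightarrow> x \<in> interlacing_arrays \<and> (\<forall>i\<in>array_index. x i \<in> {0..}) \<and>
     (\<forall>K\<in>{1..}. \<exists>n\<in>{K..}. x (n, n + 1 - K) \<in> {0})"
proof (intro iffI conjI)
  assume x: "x \<in> \<S>\<^sup>c"
  then show "x \<in> interlacing_arrays" "\<forall>i\<in>array_index. x i \<in> {0..}"
    by (auto simp: eventually_zero_arrays_strip_iff)
  show "\<forall>K\<in>{1..}. \<exists>n\<in>{K..}. x (n, n + 1 - K) \<in> {0}"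
  proof
    fix K :: nat assume K: "K \<in> {1..}"
    obtain n0 where n0: "\<And>n j. n0 \<le> n \<Longrightarrow> (n, j) \<in> strip K \<Longrightarrow> x (n, j) = 0"
      using x unfolding eventually_zero_arrays_strip_iff by blast
    have "x (max n0 K, max n0 K + 1 - K) = 0"
      using K by (intro n0) (auto simp: strip_def)
    then show "\<exists>n\<in>{K..}. x (n, n + 1 - K) \<in> {0}" by (intro bexI[of _ "max n0 K"]) auto
  qed
next
  assume x: "x \<in> interlacing_arrays \<and> (\<forall>i\<in>array_index. x i \<in> {0..}) \<and>
     (\<forall>K\<in>{1..}. \<exists>n\<in>{K..}. x (n, n + 1 - K) \<in> {0})"
  then have nn: "\<forall>i\<in>array_index. 0 \<le> x i" by auto
  have "\<exists>n0. \<forall>n j. n0 \<le> n \<and> (n, j) \<in> strip K \<longrightarrow> x (n, j) = 0" for K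
  proof (cases "K = 0")
    case False
    then obtain n where "n \<ge> K" "x (n, n + 1 - K) = 0" using x by (auto dest!: bspec[of _ _ K])
    then have "\<forall>m j. n \<le> m \<and> (m, j) \<in> strip K \<longrightarrow> x (m, j) = 0"
      using zero_diagonal_imp_strip_zero[of x K n] x nn False by auto
    then show ?thesis ..
  qed (auto simp: strip_def)
  then show "x \<in> \<S>\<^sup>c" using x nn unfolding eventually_zero_arrays_strip_iff by blast
qed

lemma eventually_zero_arrays_sets: "\<S>\<^sup>c \<in> sets array_space"
proof -
  have coord: "{x \<in> space array_space. x i \<in> A} \<in> sets array_space" if "i \<in> array_index" for i A
    using coord_set_in_sets[OF that] by (simp add: space_array_space)
  have "\<S>\<^sup>c = {x \<in> space array_space. (\<forall>i\<in>array_index. x i \<in> {0..}) \<and>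
     (\<forall>K\<in>{1..}. \<exists>n\<in>{K..}. x (n, n + 1 - K) \<in> {0})}"
    by (rule Set.set_eqI) (simp only: eventually_zero_arrays_diagonal_iff space_array_space mem_Collect_eq)
  also have "\<dots> \<in> sets array_space"
  proof (rule sets.sets_Collect_conj)
    show "{x \<in> space array_space. \<forall>i\<in>array_index. x i \<in> {0..}} \<in> sets array_space"
      by (rule sets.sets_Collect_countable_All'[OF coord]) auto
    show "{x \<in> space array_space. \<forall>K\<in>{1..}. \<exists>n\<in>{K..}. x (n, n + 1 - K) \<in> {0}} \<in> sets array_space"
      by (intro sets.sets_Collect_countable_All' sets.sets_Collect_countable_Ex' coord)
         (auto simp: array_index_def)
  qed
  finally show ?thesis .
qed

text \<open>Together with \<open>upper\<close> the range that the neighbours on levels k - 1 and k +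
  1 leave to entry (k, j). At j = k, and for \<open>upper\<close> at j = 1, level k - 1 has no
  neighbour on that side.\<close>

definition lower :: "nat \<Rightarrow> nat \<Rightarrow> array \<Rightarrow> int" where
  "lower k j x = (if j < k then max (x (Suc k, Suc j)) (x (k - 1, j)) else x (Suc k, Suc j))"

definition upper :: "nat \<Rightarrow> nat \<Rightarrow> array \<Rightarrow> int" where
  "upper k j x = (if 1 < j then min (x (k - 1, j - 1)) (x (Suc k, j)) else x (Suc k, j))"

lemma jump_allowed_iff: "jump_allowed x k j m \<longleftrightarrow> m \<in> {lower k j x..<x (k, j)}"
  by (auto simp: jump_allowed_def lower_def)

lemma interlacing_upto_bounds:
  assumes x: "interlacing_upto (Suc n) x" and kj: "1 \<le> j" "j \<le> k" "k \<le> n"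
  shows "lower k j x \<le> x (k, j)" "x (k, j) \<le> upper k j x"
proof -
  have *: "x (Suc k', Suc j') \<le> x (k', j')" "x (k', j') \<le> x (Suc k', j')" if "1 \<le> j'" "j' \<le> k'" "k' < Suc n" for k' j'
    using x that by (auto simp: interlacing_upto_def)
  obtain k' where k': "k = Suc k'" using kj by (cases k) auto
  show "lower k j x \<le> x (k, j)" using kj *[of j k] *(2)[of j k'] by (auto simp: lower_def k')
  show "x (k, j) \<le> upper k j x" using kj *[of j k] *(1)[of "j - 1" k'] by (auto simp: upper_def k')
qed

lemma interlacing_arrays_upto: "x \<in> interlacing_arrays \<Longrightarrow> interlacing_upto n x"
  by (simp add: interlacing_arrays_def interlacing_upto_def)

lemma interlacing_upto_update:
  assumes x: "interlacing_upto (Suc n) x" and kj: "1 \<le> j" "j \<le> k" "k \<le> n"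
    and m: "lower k j x \<le> m" "m \<le> upper k j x"
  shows "interlacing_upto (Suc n) (x((k, j) := m))"
  unfolding interlacing_upto_def
proof (intro allI impI)
  fix k' j' assume kj': "1 \<le> j' \<and> j' \<le> k' \<and> k' < Suc n"
  then have *: "x (Suc k', Suc j') \<le> x (k', j')" "x (k', j') \<le> x (Suc k', j')"
    using x by (auto simp: interlacing_upto_def)
  show "(x((k, j) := m)) (Suc k', Suc j') \<le> (x((k, j) := m)) (k', j') \<and> (x((k, j) := m)) (k', j') \<le> (x((k, j) := m)) (Suc k', j')"
    using * m kj kj' by (auto simp: lower_def upper_def split: if_splits)
qed

lemma lower_update [simp]: "lower k j (x((k, j) := m)) = lower k j x"
  by (auto simp: lower_def)

lemma upper_update [simp]: "upper k j (x((k, j) := m)) = upper k j x"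
  by (auto simp: upper_def)

lemma determined_by_lower: "1 \<le> j \<Longrightarrow> j \<le> k \<Longrightarrow> k \<le> n \<Longrightarrow> determined_by (Suc n) (lower k j)"
proof (rule determined_byI)
  fix x y :: array assume kj: "1 \<le> j" "j \<le> k" "k \<le> n" and xy: "\<And>i. i \<in> levels (Suc n) \<Longrightarrow> x i = y i"
  have "x (Suc k, Suc j) = y (Suc k, Suc j)" "j < k \<Longrightarrow> x (k - 1, j) = y (k - 1, j)"
    by (rule xy, unfold levels_iff, use kj in linarith)+
  then show "lower k j x = lower k j y" by (simp add: lower_def)
qed

lemma determined_by_upper: "1 \<le> j \<Longrightarrow> j \<le> k \<Longrightarrow> k \<le> n \<Longrightarrow> determined_by (Suc n) (upper k j)"
proof (rule determined_byI)
  fix x y :: array assume kj: "1 \<le> j" "j \<le> k" "k \<le> n" and xy: "\<And>i. i \<in> levels (Suc n) \<Longrightarrow> x i = y i"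
  have "x (Suc k, j) = y (Suc k, j)" "1 < j \<Longrightarrow> x (k - 1, j - 1) = y (k - 1, j - 1)"
    by (rule xy, unfold levels_iff, use kj in linarith)+
  then show "upper k j x = upper k j y" by (simp add: upper_def)
qed

lemma determined_by_sum_jumps:
  fixes f :: "array \<Rightarrow> 'a :: comm_monoid_add"
  assumes kj: "1 \<le> j" "j \<le> k" "k \<le> n" and f: "determined_by (Suc n) f"
  shows "determined_by (Suc n) (\<lambda>x. \<Sum>m\<in>{lower k j x..<x (k, j)}. f (x((k, j) := m)))"
proof (rule determined_byI)
  fix x y :: array assume xy: "\<And>i. i \<in> levels (Suc n) \<Longrightarrow> x i = y i"
  have "lower k j x = lower k j y" by (rule determined_byD[OF determined_by_lower[OF kj] xy])
  moreover have "x (k, j) = y (k, j)" using kj by (intro xy) auto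
  moreover have "f (x((k, j) := m)) = f (y((k, j) := m))" for m
    using xy by (intro determined_byD[OF f]) auto
  ultimately show "(\<Sum>m\<in>{lower k j x..<x (k, j)}. f (x((k, j) := m))) = (\<Sum>m\<in>{lower k j y..<y (k, j)}. f (y((k, j) := m)))"
    by simp
qed

text \<open>\<open>lower k j\<close> and \<open>upper k (Suc j)\<close> are the maximum and the
  minimum of the same two numbers x (k + 1, j + 1) and x (k - 1, j), so together they give the sum
  of both. The two ends supply the remaining entries of level k + 1.\<close>

lemma sum_lower_upper:
  assumes "1 \<le> k"
  shows "(\<Sum>j=1..k. lower k j x + upper k j x) = level_sum (Suc k) x + level_sum (k - 1) x"
proof -
  obtain k' where k': "k = Suc k'" using assms by (cases k) auto
  have "(\<Sum>j=1..k. lower k j x) = (\<Sum>j=1..k'. max (x (Suc k, Suc j)) (x (k', j))) + x (Suc k, Suc k)"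
    by (simp add: k' lower_def)
  moreover have "(\<Sum>j=1..k. upper k j x) = (\<Sum>j=2..k. min (x (k - 1, j - 1)) (x (Suc k, j))) + x (Suc k, 1)"
  proof -
    have "{1..k} = insert 1 {2..k}" using assms by auto
    then have "(\<Sum>j=1..k. upper k j x) = upper k 1 x + (\<Sum>j=2..k. upper k j x)" by simp
    also have "(\<Sum>j=2..k. upper k j x) = (\<Sum>j=2..k. min (x (k - 1, j - 1)) (x (Suc k, j)))"
      by (intro sum.cong) (auto simp: upper_def)
    finally show ?thesis by (simp add: upper_def)
  qed
  moreover have "(\<Sum>j=2..k. min (x (k - 1, j - 1)) (x (Suc k, j))) = (\<Sum>j=1..k'. min (x (k', j)) (x (Suc k, Suc j)))"
    by (rule sum.reindex_bij_witness[of _ Suc "\<lambda>j. j - 1"]) (auto simp: k')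
  moreover have "(\<Sum>j=1..k'. max (x (Suc k, Suc j)) (x (k', j))) + (\<Sum>j=1..k'. min (x (k', j)) (x (Suc k, Suc j)))
     = (\<Sum>j=1..k'. x (Suc k, Suc j)) + (\<Sum>j=1..k'. x (k', j))"
    by (simp only: sum.distrib[symmetric]) (rule sum.cong, auto)
  moreover have "level_sum (Suc k) x = x (Suc k, 1) + (\<Sum>j=1..k'. x (Suc k, Suc j)) + x (Suc k, Suc k)"
  proof -
    have "{1..Suc k} = insert 1 (insert (Suc k) {2..k})" using assms by auto
    then have "level_sum (Suc k) x = x (Suc k, 1) + (x (Suc k, Suc k) + (\<Sum>j=2..k. x (Suc k, j)))"
      unfolding level_sum_def using assms by simp
    also have "(\<Sum>j=2..k. x (Suc k, j)) = (\<Sum>j=1..k'. x (Suc k, Suc j))"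
      by (rule sum.reindex_bij_witness[of _ Suc "\<lambda>j. j - 1"]) (auto simp: k')
    finally show ?thesis by simp
  qed
  ultimately show ?thesis by (simp add: sum.distrib level_sum_def k')
qed

text \<open>With S_k for the sum of level k, the term k (S_{k+1} - 2 S_k + S_{k-1}) is the
  difference at k and k - 1 of k S_{k+1} - (k + 1) S_k. This is what the choice of the rates k
  achieves.\<close>

lemma sum_level_divergence:
  "(\<Sum>k=1..n. int k * (\<Sum>j=1..k. lower k j x + upper k j x - 2 * x (k, j))) =
     int n * level_sum (Suc n) x - int (Suc n) * level_sum n x"
proof (induction n)
  case 0
  then show ?case by (simp add: level_sum_def)
next
  case (Suc n)
  let ?S = "\<lambda>k. \<Sum>j=1..k. lower k j x + upper k j x - 2 * x (k, j)"
  have "(\<Sum>k=1..Suc n. int k * ?S k) = (\<Sum>k=1..n. int k * ?S k) + int (Suc n) * ?S (Suc n)"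
    by simp
  also have "?S (Suc n) = level_sum (Suc (Suc n)) x + level_sum n x - 2 * level_sum (Suc n) x"
    using sum_lower_upper[of "Suc n" x] unfolding sum_subtractf
    by (simp add: level_sum_def sum_distrib_left[symmetric] del: sum.cl_ivl_Suc)
  finally show ?case unfolding Suc by (simp add: algebra_simps)
qed

definition level_generator :: "nat \<Rightarrow> (array \<Rightarrow> real) \<Rightarrow> array \<Rightarrow> real" where
  "level_generator k g x =
     (\<Sum>j=1..k. \<Sum>m\<in>{lower k j x..<x (k, j)}. real k * (g (x((k, j) := m)) - g x))"

context one_sided_gibbs begin

text \<open>If a diagonal has no zero, \<open>from_right K n\<close> is at least 1 for all n \<ge>
  K. By Markov's inequality this event has probability at most C r^n for every such n, where the
  decay estimate is used at s = 0, with density 1.\<close>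

lemma AE_eventually_zero: "AE x in M. x \<in> \<S>\<^sup>c"
proof -
  have "AE x in M. \<exists>n\<in>{K..}. from_right K n x = 0" for K
  proof -
    define A where "A = {x \<in> space M. \<forall>n\<in>{K..}. from_right K n x \<noteq> 0}"
    have [measurable]: "A \<in> sets M" unfolding A_def by measurable
    obtain C where C: "\<And>n s. n \<ge> K \<Longrightarrow> s \<ge> 0 \<Longrightarrow> (\<integral>x. weight n s x * from_right K n x \<partial>M) \<le> C * decay_rate ^ n"
      using from_right_decay[of K] by blast
    have "measure M A \<le> C * decay_rate ^ n" if "n \<ge> K" for n
    proof -
      have "measure M A = (\<integral>x. indicator A x \<partial>M)" by simp
      also have "\<dots> \<le> (\<integral>x. weight n 0 x * from_right K n x \<partial>M)"
      proof (rule integral_mono_AE)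
        show "integrable M (indicator A :: array \<Rightarrow> real)"
          by (intro integrable_real_indicator) (auto simp: emeasure_eq_measure)
        show "integrable M (\<lambda>x. weight n 0 x * real_of_int (from_right K n x))"
          by (intro integrable_weight_mult integrable_from_right) simp
        show "AE x in M. indicator A x \<le> weight n 0 x * real_of_int (from_right K n x)"
          using AE_nonneg
        proof eventually_elim
          case (elim x)
          have "from_right K n x \<noteq> 0" if "x \<in> A" using that \<open>n \<ge> K\<close> by (auto simp: A_def)
          then have "indicator A x \<le> real_of_int (from_right K n x)"
            using from_right_bounds(1)[OF elim, of K n] by (cases "x \<in> A") (auto simp: indicator_def)
          then show ?case by (simp add: weight_def pgf_0)
        qed
      qed
      also have "\<dots> \<le> C * decay_rate ^ n" using C[OF that, of 0] by simp
      finally show ?thesis .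
    qed
    moreover have lim: "(\<lambda>n. C * decay_rate ^ n) \<longlonglongrightarrow> C * 0"
      using psi_0_pos psi_0_le_1 by (intro tendsto_mult_left LIMSEQ_realpow_zero) auto
    ultimately have "measure M A \<le> C * 0"
      by (intro LIMSEQ_le_const[OF lim] exI[of _ K]) blast
    then have "emeasure M A = 0" using measure_nonneg[of M A] by (simp add: emeasure_eq_measure)
    then have "AE x in M. x \<notin> A" by (intro AE_not_in) (auto simp: null_sets_def)
    then show ?thesis using AE_space by eventually_elim (auto simp: A_def)
  qed
  then have "AE x in M. \<forall>K. \<exists>n\<in>{K..}. from_right K n x = 0" by (simp add: AE_all_countable)
  then show ?thesis using AE_nonneg AE_space
  proof eventually_elim
    case (elim x)
    have "\<exists>n\<in>{K..}. x (n, n + 1 - K) \<in> {0}" if "K \<in> {1..}" for K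
      using elim(1)[rule_format, of K] that by (auto simp: from_right_def)
    then show ?case using elim(2,3) unfolding eventually_zero_arrays_diagonal_iff space_M by auto
  qed
qed

text \<open>The conditional law of an entry given all others is uniform on \<open>{lower..upper}\<close>. Hence
  exchanging the positions before and after a jump is measure preserving.\<close>

lemma nn_integral_jump:
  fixes f :: "array \<Rightarrow> ennreal"
  assumes kj: "1 \<le> j" "j \<le> k" "k \<le> n" and f: "determined_by (Suc n) f"
  shows "(\<integral>\<^sup>+x. (\<Sum>m\<in>{lower k j x..<x (k, j)}. f (x((k, j) := m))) \<partial>M) =
    (\<integral>\<^sup>+x. of_nat (nat (upper k j x - x (k, j))) * f x \<partial>M)"
proof -
  let ?P = "patterns (Suc n)"
  define p where "p = (\<lambda>l. emeasure M (cylinder (Suc n) l))"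
  define \<Phi> where "\<Phi> = (\<lambda>(l, m). f (l((k, j) := m)) * p l * indicator {(l, m). l \<in> ?P \<and> lower k j l \<le> m \<and> m < l (k, j)} (l, m))"
  define \<Phi>' where "\<Phi>' = (\<lambda>(l, r). f l * p l * indicator {(l, r). l \<in> ?P \<and> l (k, j) < r \<and> r \<le> upper k j l} (l, r))"
  \<comment> \<open>The involution that exchanges the current value with the jump target. It turns
    pairs of an array and a target below, summed in \<open>\<Phi>\<close>, into pairs of an array
    and an origin above, summed in \<open>\<Phi>'\<close>.\<close>
  define \<sigma> where "\<sigma> = (\<lambda>(l :: array, m). (l((k, j) := m), l (k, j)))"
  have sum_count: "(\<Sum>m\<in>{a..<b}. h m) = (\<integral>\<^sup>+m. h m * indicator {a..<b} m \<partial>count_space UNIV)"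
    for h :: "int \<Rightarrow> ennreal" and a b
    by (simp add: nn_integral_count_space_indicator[symmetric] nn_integral_count_space_finite)
  have det: "determined_by (Suc n) (\<lambda>x. \<Sum>m\<in>{lower k j x..<x (k, j)}. f (x((k, j) := m)))"
    by (rule determined_by_sum_jumps[OF kj f])
  have "(\<integral>\<^sup>+x. (\<Sum>m\<in>{lower k j x..<x (k, j)}. f (x((k, j) := m))) \<partial>M) =
    (\<integral>\<^sup>+l. (\<Sum>m\<in>{lower k j l..<l (k, j)}. f (l((k, j) := m))) * p l * indicator ?P l \<partial>count_space UNIV)"
    by (subst nn_integral_patterns[OF det]) (simp add: nn_integral_count_space_indicator p_def)
  also have "\<dots> = (\<integral>\<^sup>+l. (\<integral>\<^sup>+m. \<Phi> (l, m) \<partial>count_space UNIV) \<partial>count_space UNIV)"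
  proof (rule nn_integral_cong)
    fix l
    have "(\<Sum>m\<in>{lower k j l..<l (k, j)}. f (l((k, j) := m))) * p l * indicator ?P l =
      (\<Sum>m\<in>{lower k j l..<l (k, j)}. f (l((k, j) := m)) * p l * indicator ?P l)"
      by (simp add: sum_distrib_right)
    also have "\<dots> = (\<integral>\<^sup>+m. \<Phi> (l, m) \<partial>count_space UNIV)"
      unfolding sum_count by (intro nn_integral_cong) (auto simp: \<Phi>_def indicator_def)
    finally show "(\<Sum>m\<in>{lower k j l..<l (k, j)}. f (l((k, j) := m))) * p l * indicator ?P l = (\<integral>\<^sup>+m. \<Phi> (l, m) \<partial>count_space UNIV)" .
  qed
  also have "\<dots> = (\<integral>\<^sup>+z. \<Phi> z \<partial>count_space UNIV)" by (rule nn_integral_fst_count_space)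
  also have "\<dots> = (\<integral>\<^sup>+z. \<Phi>' (\<sigma> z) \<partial>count_space UNIV)"
  proof (rule nn_integral_cong)
    fix z :: "array \<times> int"
    obtain l m where z: "z = (l, m)" by (cases z)
    let ?l = "l((k, j) := m)"
    have ext: "?l \<in> extensional (levels (Suc n)) \<longleftrightarrow> l \<in> extensional (levels (Suc n))"
      using kj by (auto simp: extensional_def simp del: levels_iff) (auto)
    have iff: "(l \<in> ?P \<and> lower k j l \<le> m \<and> m < l (k, j)) \<longleftrightarrow>
      (?l \<in> ?P \<and> m < l (k, j) \<and> l (k, j) \<le> upper k j l)" (is "?A \<longleftrightarrow> ?B")
    proof
      assume A: ?A
      then have il: "interlacing_upto (Suc n) l" by (simp add: patterns_def)
      have up: "l (k, j) \<le> upper k j l" by (rule interlacing_upto_bounds[OF il kj])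
      then have "interlacing_upto (Suc n) ?l" using A by (intro interlacing_upto_update[OF il kj]) auto
      then show ?B using A up ext by (simp add: patterns_def)
    next
      assume B: ?B
      then have il: "interlacing_upto (Suc n) ?l" by (simp add: patterns_def)
      have lo: "lower k j l \<le> m" using interlacing_upto_bounds(1)[OF il kj] by simp
      have "interlacing_upto (Suc n) (?l((k, j) := l (k, j)))"
        using B lo by (intro interlacing_upto_update[OF il kj]) auto
      then show ?A using B lo ext by (simp add: patterns_def)
    qed
    \<comment> \<open>The Gibbs property: the probability of the cylinder depends on its top row n +
      1 only, and k \<le> n.\<close>
    have "p l = p ?l" if "l \<in> ?P" "?l \<in> ?P"
    proof -
      have "measure M (cylinder (Suc n) l) = measure M (cylinder (Suc n) ?l)"
        using that kj by (subst (1 2) measure_cylinder) (auto simp: patterns_def intro!: schur_det_cong)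
      then show ?thesis by (simp add: p_def emeasure_eq_measure)
    qed
    then show "\<Phi> z = \<Phi>' (\<sigma> z)"
      using iff by (auto simp: z \<Phi>_def \<Phi>'_def \<sigma>_def indicator_def)
  qed
  also have "\<dots> = (\<integral>\<^sup>+z. \<Phi>' z \<partial>count_space UNIV)"
  proof (rule nn_integral_bij_count_space)
    have "\<sigma> (\<sigma> z) = z" for z by (cases z) (simp add: \<sigma>_def)
    then show "bij_betw \<sigma> UNIV UNIV" by (intro o_bij[of \<sigma>]) (auto simp: fun_eq_iff)
  qed
  also have "\<dots> = (\<integral>\<^sup>+l. (\<integral>\<^sup>+r. \<Phi>' (l, r) \<partial>count_space UNIV) \<partial>count_space UNIV)"
    by (rule nn_integral_fst_count_space[symmetric])
  also have "\<dots> = (\<integral>\<^sup>+l. of_nat (nat (upper k j l - l (k, j))) * f l * p l * indicator ?P l \<partial>count_space UNIV)"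
  proof (rule nn_integral_cong)
    fix l
    have "(\<integral>\<^sup>+r. \<Phi>' (l, r) \<partial>count_space UNIV) = (\<integral>\<^sup>+r. (f l * p l * indicator ?P l) * indicator {l (k, j) + 1..<upper k j l + 1} r \<partial>count_space UNIV)"
      by (intro nn_integral_cong) (auto simp: \<Phi>'_def indicator_def)
    also have "\<dots> = (\<Sum>r\<in>{l (k, j) + 1..<upper k j l + 1}. f l * p l * indicator ?P l)" by (rule sum_count[symmetric])
    finally show "(\<integral>\<^sup>+r. \<Phi>' (l, r) \<partial>count_space UNIV) = of_nat (nat (upper k j l - l (k, j))) * f l * p l * indicator ?P l"
      by (simp add: mult_ac)
  qed
  also have "\<dots> = (\<integral>\<^sup>+x. of_nat (nat (upper k j x - x (k, j))) * f x \<partial>M)"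
  proof (subst nn_integral_patterns)
    have "determined_by (Suc n) (\<lambda>x. upper k j x - x (k, j))"
      using kj by (intro determined_by_app2[where h = "(-)"] determined_by_upper determined_by_coord) auto
    then show "determined_by (Suc n) (\<lambda>x. of_nat (nat (upper k j x - x (k, j))) * f x)"
      by (rule determined_by_app2[OF determined_by_app[where h = "\<lambda>u. of_nat (nat u)"] f])
  qed (simp add: nn_integral_count_space_indicator p_def)
  finally show ?thesis .
qed

lemma expectation_jump:
  fixes f :: "array \<Rightarrow> real"
  assumes kj: "1 \<le> j" "j \<le> k" "k \<le> n" and f: "determined_by (Suc n) f" "\<And>x. 0 \<le> f x"
    and int: "integrable M (\<lambda>x. of_int (upper k j x - x (k, j)) * f x)"
  shows "has_bochner_integral M (\<lambda>x. \<Sum>m\<in>{lower k j x..<x (k, j)}. f (x((k, j) := m)))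
    (\<integral>x. of_int (upper k j x - x (k, j)) * f x \<partial>M)"
proof (rule has_bochner_integral_nn_integral)
  show "(\<lambda>x. \<Sum>m\<in>{lower k j x..<x (k, j)}. f (x((k, j) := m))) \<in> borel_measurable M"
    by (rule borel_measurable_determined[OF determined_by_sum_jumps[OF kj f(1)]])
  show "AE x in M. 0 \<le> (\<Sum>m\<in>{lower k j x..<x (k, j)}. f (x((k, j) := m)))"
    using f(2) by (auto intro: sum_nonneg)
  have up: "0 \<le> upper k j x - x (k, j)" if "x \<in> space M" for x
  proof -
    have "interlacing_upto (Suc n) x" using that by (simp add: space_M interlacing_arrays_upto)
    from interlacing_upto_bounds(2)[OF this kj] show ?thesis by simp
  qed
  show "0 \<le> (\<integral>x. of_int (upper k j x - x (k, j)) * f x \<partial>M)"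
    using up f(2) by (intro Bochner_Integration.integral_nonneg) simp
  have "(\<integral>\<^sup>+x. ennreal (\<Sum>m\<in>{lower k j x..<x (k, j)}. f (x((k, j) := m))) \<partial>M) =
    (\<integral>\<^sup>+x. (\<Sum>m\<in>{lower k j x..<x (k, j)}. ennreal (f (x((k, j) := m)))) \<partial>M)"
    using f(2) by (simp add: sum_ennreal)
  also have "\<dots> = (\<integral>\<^sup>+x. of_nat (nat (upper k j x - x (k, j))) * ennreal (f x) \<partial>M)"
    by (rule nn_integral_jump[OF kj determined_by_app[OF f(1)]])
  also have "\<dots> = (\<integral>\<^sup>+x. ennreal (of_int (upper k j x - x (k, j)) * f x) \<partial>M)"
  proof (rule nn_integral_cong)
    fix x assume "x \<in> space M"
    then have eq: "of_int (upper k j x - x (k, j)) = real (nat (upper k j x - x (k, j)))"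
      using up[of x] by simp
    have "ennreal (real (nat (upper k j x - x (k, j))) * f x) = ennreal (real (nat (upper k j x - x (k, j)))) * ennreal (f x)"
      by (rule ennreal_mult) (simp_all add: f(2))
    also have "ennreal (real (nat (upper k j x - x (k, j)))) = of_nat (nat (upper k j x - x (k, j)))"
      by (rule ennreal_of_nat_eq_real_of_nat[symmetric])
    finally show "of_nat (nat (upper k j x - x (k, j))) * ennreal (f x) = ennreal (of_int (upper k j x - x (k, j)) * f x)"
      unfolding eq by (rule sym)
  qed
  also have "\<dots> = ennreal (\<integral>x. of_int (upper k j x - x (k, j)) * f x \<partial>M)"
    using up f(2) by (intro nn_integral_eq_integral[OF int] AE_I2) simp
  finally show "(\<integral>\<^sup>+x. ennreal (\<Sum>m\<in>{lower k j x..<x (k, j)}. f (x((k, j) := m))) \<partial>M) =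
    ennreal (\<integral>x. of_int (upper k j x - x (k, j)) * f x \<partial>M)" .
qed

lemma coord_le_level_sum':
  assumes x: "x \<in> interlacing_arrays" "\<forall>i\<in>array_index. 0 \<le> x i" and kj: "1 \<le> j" "j \<le> k" "k \<le> n"
  shows "x (k, j) \<le> level_sum n x"
proof -
  have "x (k, j) \<le> x (n, j)"
    using kj(3)
  proof (induction n rule: dec_induct)
    case (step n)
    then show ?case using interlacing_arraysD(2)[OF x(1), of j n] kj by simp
  qed simp
  also have "\<dots> \<le> level_sum n x" using x(2) kj by (intro coord_le_level_sum) auto
  finally show ?thesis .
qed

lemma jump_bounds:
  assumes x: "x \<in> interlacing_arrays" "\<forall>i\<in>array_index. 0 \<le> x i" and kj: "1 \<le> j" "j \<le> k"
  shows "0 \<le> lower k j x" "lower k j x \<le> x (k, j)" "x (k, j) \<le> upper k j x"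
    "k \<le> n \<Longrightarrow> x (k, j) \<le> level_sum n x" "k \<le> n \<Longrightarrow> upper k j x \<le> level_sum (Suc n) x"
proof -
  have il: "interlacing_upto (Suc k) x" by (rule interlacing_arrays_upto[OF x(1)])
  show "lower k j x \<le> x (k, j)" "x (k, j) \<le> upper k j x"
    using interlacing_upto_bounds[OF il kj] by auto
  have "0 \<le> x (Suc k, Suc j)" using x(2) kj by (simp add: array_index_def)
  then show "0 \<le> lower k j x" by (auto simp: lower_def)
  show "x (k, j) \<le> level_sum n x" if "k \<le> n" by (rule coord_le_level_sum'[OF x kj that])
  have "upper k j x \<le> x (Suc k, j)" by (simp add: upper_def)
  then show "upper k j x \<le> level_sum (Suc n) x" if "k \<le> n"
    using coord_le_level_sum'[OF x, of j "Suc k" "Suc n"] kj that by simp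
qed

lemma integrable_bounded_by_level_sum:
  assumes "f \<in> borel_measurable M"
    and "\<And>x. x \<in> interlacing_arrays \<Longrightarrow> \<forall>i\<in>array_index. 0 \<le> x i \<Longrightarrow> \<bar>f x\<bar> \<le> c * real_of_int (level_sum n x)"
  shows "integrable M f"
proof (rule Bochner_Integration.integrable_bound)
  show "integrable M (\<lambda>x. c * real_of_int (level_sum n x))"
    by (intro integrable_mult_right integrable_level_sum)
  show "AE x in M. norm (f x) \<le> norm (c * real_of_int (level_sum n x))"
    using AE_nonneg AE_space
  proof eventually_elim
    case (elim x)
    then show ?case using assms(2)[of x] by (simp add: space_M)
  qed
qed fact

text \<open>Integration by parts for one entry. Exchanging the ends of the jump turns the gain term
  into g times the distance to \<open>upper\<close>, and the loss term counts the targets, that is,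
  the distance to \<open>lower\<close>.\<close>

lemma expectation_level_generator_entry:
  assumes s: "s \<ge> 0" and kj: "1 \<le> j" "j \<le> k" "k \<le> n"
    and g: "determined_by n g" "\<And>x. 0 \<le> g x" "\<And>x. g x \<le> 1"
  shows "has_bochner_integral M
    (\<lambda>x. weight (Suc n) s x * (\<Sum>m\<in>{lower k j x..<x (k, j)}. g (x((k, j) := m)) - g x))
    (\<integral>x. weight (Suc n) s x * (of_int (lower k j x + upper k j x - 2 * x (k, j)) * g x) \<partial>M)"
proof -
  let ?w = "weight (Suc n) s"
  \<comment> \<open>The density is taken one level above those where jumps occur: it sees only row n
    + 1, which jumps at levels k \<le> n leave alone.\<close>
  have w_upd: "?w (x((k, j) := m)) = ?w x" for x m
    using kj by (auto simp: weight_def level_sum_def intro!: sum.cong)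
  have [measurable]: "g \<in> borel_measurable M" by (rule borel_measurable_determined[OF g(1)])
  have g': "determined_by (Suc n) g" using determined_by_mono[OF g(1)] by simp
  have wg: "determined_by (Suc n) (\<lambda>x. ?w x * g x)"
    by (rule determined_by_app2[OF determined_by_weight[OF order_refl] g'])
  have meas: "(\<lambda>x. real_of_int (h x) * g x) \<in> borel_measurable M" if "determined_by (Suc n) h" for h :: "array \<Rightarrow> int"
    by (rule borel_measurable_determined[OF determined_by_app2[OF determined_by_app[OF that, where h = real_of_int] g']])
  have det_x: "determined_by (Suc n) (\<lambda>x. x (k, j))" using kj by (intro determined_by_coord) auto
  have int_up: "integrable M (\<lambda>x. of_int (upper k j x - x (k, j)) * g x)"
  proof (rule integrable_bounded_by_level_sum[where n = "Suc n" and c = 1])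
    show "(\<lambda>x. of_int (upper k j x - x (k, j)) * g x) \<in> borel_measurable M"
      by (intro meas determined_by_app2[where h = "(-)"] determined_by_upper kj det_x)
    fix x :: array assume x: "x \<in> interlacing_arrays" "\<forall>i\<in>array_index. 0 \<le> x i"
    note b = jump_bounds[OF x kj(1,2)]
    have "\<bar>of_int (upper k j x - x (k, j)) * g x\<bar> \<le> of_int (upper k j x - x (k, j))"
      using b g(2,3)[of x] by (simp add: abs_mult mult_left_le)
    also have "\<dots> \<le> 1 * real_of_int (level_sum (Suc n) x)" using b(1,2) b(5)[OF kj(3)] by simp
    finally show "\<bar>of_int (upper k j x - x (k, j)) * g x\<bar> \<le> 1 * real_of_int (level_sum (Suc n) x)" .
  qed
  have int_lo: "integrable M (\<lambda>x. of_int (x (k, j) - lower k j x) * g x)"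
  proof (rule integrable_bounded_by_level_sum[where n = "Suc n" and c = 1])
    show "(\<lambda>x. of_int (x (k, j) - lower k j x) * g x) \<in> borel_measurable M"
      by (intro meas determined_by_app2[where h = "(-)"] determined_by_lower kj det_x)
    fix x :: array assume x: "x \<in> interlacing_arrays" "\<forall>i\<in>array_index. 0 \<le> x i"
    note b = jump_bounds[OF x kj(1,2)]
    have "\<bar>of_int (x (k, j) - lower k j x) * g x\<bar> \<le> of_int (x (k, j) - lower k j x)"
      using b g(2,3)[of x] by (simp add: abs_mult mult_left_le)
    also have "\<dots> \<le> 1 * real_of_int (level_sum (Suc n) x)" using b(1,2,3) b(5)[OF kj(3)] by simp
    finally show "\<bar>of_int (x (k, j) - lower k j x) * g x\<bar> \<le> 1 * real_of_int (level_sum (Suc n) x)" .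
  qed
  note wint = integrable_weight_mult[OF s int_up, of "Suc n"] integrable_weight_mult[OF s int_lo, of "Suc n"]
  have "has_bochner_integral M (\<lambda>x. \<Sum>m\<in>{lower k j x..<x (k, j)}. ?w (x((k, j) := m)) * g (x((k, j) := m)))
    (\<integral>x. of_int (upper k j x - x (k, j)) * (?w x * g x) \<partial>M)"
    using wint(1) less_imp_le[OF weight_pos[OF s]] g(2)
    by (intro expectation_jump[OF kj wg]) (auto simp: mult_ac)
  then have 1: "has_bochner_integral M (\<lambda>x. \<Sum>m\<in>{lower k j x..<x (k, j)}. ?w x * g (x((k, j) := m)))
    (\<integral>x. ?w x * (of_int (upper k j x - x (k, j)) * g x) \<partial>M)"
    by (simp add: w_upd mult_ac)
  have 2: "has_bochner_integral M (\<lambda>x. ?w x * (of_int (x (k, j) - lower k j x) * g x))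
    (\<integral>x. ?w x * (of_int (x (k, j) - lower k j x) * g x) \<partial>M)"
    using wint(2) by (rule has_bochner_integral_integrable)
  have "has_bochner_integral M (\<lambda>x. (\<Sum>m\<in>{lower k j x..<x (k, j)}. ?w x * g (x((k, j) := m))) - ?w x * (of_int (x (k, j) - lower k j x) * g x))
    ((\<integral>x. ?w x * (of_int (upper k j x - x (k, j)) * g x) \<partial>M) - (\<integral>x. ?w x * (of_int (x (k, j) - lower k j x) * g x) \<partial>M))"
    by (rule has_bochner_integral_diff[OF 1 2])
  also have "(\<integral>x. ?w x * (of_int (upper k j x - x (k, j)) * g x) \<partial>M) - (\<integral>x. ?w x * (of_int (x (k, j) - lower k j x) * g x) \<partial>M)
    = (\<integral>x. ?w x * (of_int (upper k j x - x (k, j)) * g x) - ?w x * (of_int (x (k, j) - lower k j x) * g x) \<partial>M)"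
    using wint by (rule Bochner_Integration.integral_diff[symmetric])
  also have "\<dots> = (\<integral>x. ?w x * (of_int (lower k j x + upper k j x - 2 * x (k, j)) * g x) \<partial>M)"
    by (rule Bochner_Integration.integral_cong) (auto simp: algebra_simps)
  finally show ?thesis
  proof (rule has_bochner_integral_cong[THEN iffD1, rotated -1])
    fix x assume "x \<in> space M"
    then have "lower k j x \<le> x (k, j)"
      using kj by (intro interlacing_upto_bounds(1)) (auto simp: space_M interlacing_arrays_upto)
    then have c: "real (card {lower k j x..<x (k, j)}) = of_int (x (k, j) - lower k j x)" by simp
    have "(\<Sum>m\<in>{lower k j x..<x (k, j)}. g (x((k, j) := m)) - g x) =
      (\<Sum>m\<in>{lower k j x..<x (k, j)}. g (x((k, j) := m))) - of_int (x (k, j) - lower k j x) * g x"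
      unfolding sum_subtractf sum_constant c ..
    then show "(\<Sum>m\<in>{lower k j x..<x (k, j)}. ?w x * g (x((k, j) := m))) - ?w x * (of_int (x (k, j) - lower k j x) * g x) =
      ?w x * (\<Sum>m\<in>{lower k j x..<x (k, j)}. g (x((k, j) := m)) - g x)"
      by (simp add: right_diff_distrib sum_distrib_left)
  qed auto
qed

text \<open>The sum over the divergences of all levels telescopes, and its expectation given the first
  \<open>n\<close> levels is the time derivative of the density.\<close>

lemma expectation_generator:
  assumes s: "s \<ge> 0" and g: "determined_by n g" "\<And>x. 0 \<le> g x" "\<And>x. g x \<le> 1"
  shows "has_bochner_integral M (\<lambda>x. weight (Suc n) s x * (\<Sum>k=1..n. level_generator k g x))
    (\<integral>x. weight n s x * (n * (pgf' s / pgf s) - of_int (level_sum n x)) * g x \<partial>M)"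
proof -
  let ?w = "weight (Suc n) s"
  have [measurable]: "g \<in> borel_measurable M" by (rule borel_measurable_determined[OF g(1)])
  have intg: "integrable M g"
    by (rule integrable_const_bound[where B = 1]) (use g in auto)
  have gl: "determined_by n (\<lambda>x. of_int (level_sum n x) * g x)"
    by (rule determined_by_app2[OF determined_by_app[OF determined_by_level_sum[OF order_refl]] g(1)])
  have intl: "integrable M (\<lambda>x. of_int (level_sum n x) * g x)"
  proof (rule integrable_bounded_by_level_sum[where n = n and c = 1])
    show "(\<lambda>x. of_int (level_sum n x) * g x) \<in> borel_measurable M"
      by (rule borel_measurable_determined[OF gl])
    fix x :: array assume "x \<in> interlacing_arrays" "\<forall>i\<in>array_index. 0 \<le> x i"
    then have "0 \<le> level_sum n x" by (intro level_sum_nonneg)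
    then show "\<bar>of_int (level_sum n x) * g x\<bar> \<le> 1 * real_of_int (level_sum n x)"
      using g(2,3)[of x] by (simp add: abs_mult mult_left_le)
  qed
  let ?J = "\<lambda>k j x. of_int (lower k j x + upper k j x - 2 * x (k, j)) * g x"
  have entry: "has_bochner_integral M
    (\<lambda>x. ?w x * (\<Sum>m\<in>{lower k j x..<x (k, j)}. g (x((k, j) := m)) - g x)) (\<integral>x. ?w x * ?J k j x \<partial>M)"
    if "1 \<le> j" "j \<le> k" "k \<le> n" for k j
    by (rule expectation_level_generator_entry[OF s that g])
  have wJ: "integrable M (\<lambda>x. ?w x * ?J k j x)" if kj: "1 \<le> j" "j \<le> k" "k \<le> n" for k j
  proof (rule integrable_weight_mult[OF s], rule integrable_bounded_by_level_sum[where n = "Suc n" and c = 2])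
    have "determined_by (Suc n) (\<lambda>x. lower k j x + upper k j x - 2 * x (k, j))"
      using kj by (intro determined_by_app2[where h = "(-)"] determined_by_app2[where h = "(+)"] determined_by_lower
        determined_by_upper determined_by_app[where h = "\<lambda>u. 2 * u"] determined_by_coord) auto
    then show "?J k j \<in> borel_measurable M"
      by (intro borel_measurable_determined[OF determined_by_app2[OF determined_by_app[where h = real_of_int] determined_by_mono[OF g(1)]]]) auto
    fix x :: array assume x: "x \<in> interlacing_arrays" "\<forall>i\<in>array_index. 0 \<le> x i"
    note b = jump_bounds[OF x kj(1,2)]
    have "\<bar>?J k j x\<bar> \<le> \<bar>of_int (lower k j x + upper k j x - 2 * x (k, j))\<bar>"
      using g(2,3)[of x] by (simp add: abs_mult mult_left_le)
    also have "\<dots> \<le> 2 * real_of_int (level_sum (Suc n) x)"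
      using b(1-3) b(5)[OF kj(3)] by linarith
    finally show "\<bar>?J k j x\<bar> \<le> 2 * real_of_int (level_sum (Suc n) x)" .
  qed
  have "has_bochner_integral M (\<lambda>x. \<Sum>k=1..n. \<Sum>j=1..k. real k * (?w x * (\<Sum>m\<in>{lower k j x..<x (k, j)}. g (x((k, j) := m)) - g x)))
     (\<Sum>k=1..n. \<Sum>j=1..k. real k * (\<integral>x. ?w x * ?J k j x \<partial>M))"
    by (intro has_bochner_integral_sum has_bochner_integral_mult_right entry) auto
  also have "(\<lambda>x. \<Sum>k=1..n. \<Sum>j=1..k. real k * (?w x * (\<Sum>m\<in>{lower k j x..<x (k, j)}. g (x((k, j) := m)) - g x))) =
     (\<lambda>x. ?w x * (\<Sum>k=1..n. level_generator k g x))"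
    by (simp add: level_generator_def sum_distrib_left mult_ac)
  also have "(\<Sum>k=1..n. \<Sum>j=1..k. real k * (\<integral>x. ?w x * ?J k j x \<partial>M)) =
    (\<integral>x. (\<Sum>k=1..n. \<Sum>j=1..k. real k * (?w x * ?J k j x)) \<partial>M)"
    using wJ by (subst Bochner_Integration.integral_sum, force)
      (intro sum.cong refl, subst Bochner_Integration.integral_sum, auto)
  \<comment> \<open>With S_k for the sum of level k, n S_{n+1} - (n + 1) S_n = n (S_{n+1} - S_n) -
    S_n: an increment that is independent of g, and a term of level n.\<close>
  also have "\<dots> = (\<integral>x. real n * (?w x * of_int (level_diff n x) * g x) - ?w x * of_int (level_sum n x) * g x \<partial>M)"
  proof (rule Bochner_Integration.integral_cong[OF refl])
    fix x
    have "(\<Sum>k=1..n. \<Sum>j=1..k. real k * (?w x * ?J k j x)) =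
      ?w x * g x * of_int (\<Sum>k=1..n. int k * (\<Sum>j=1..k. lower k j x + upper k j x - 2 * x (k, j)))"
      by (simp add: sum_distrib_left mult_ac)
    also have "\<dots> = real n * (?w x * of_int (level_diff n x) * g x) - ?w x * of_int (level_sum n x) * g x"
      unfolding sum_level_divergence by (simp add: level_diff_def algebra_simps)
    finally show "(\<Sum>k=1..n. \<Sum>j=1..k. real k * (?w x * ?J k j x)) =
      real n * (?w x * of_int (level_diff n x) * g x) - ?w x * of_int (level_sum n x) * g x" .
  qed
  also have "\<dots> = real n * (pgf' s / pgf s * (\<integral>x. weight n s x * g x \<partial>M)) - (\<integral>x. weight n s x * of_int (level_sum n x) * g x \<partial>M)"
  proof -
    have 1: "has_bochner_integral M (\<lambda>x. ?w x * of_int (level_diff n x) * g x) (pgf' s / pgf s * (\<integral>x. weight n s x * g x \<partial>M))"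
      using g(2) by (intro expectation_weight_level_diff s g(1) intg) auto
    have "AE x in M. 0 \<le> of_int (level_sum n x) * g x"
      using AE_level_sum_nonneg[of n] by eventually_elim (simp add: g(2))
    then have 2: "(\<integral>x. ?w x * (of_int (level_sum n x) * g x) \<partial>M) = (\<integral>x. weight n s x * (of_int (level_sum n x) * g x) \<partial>M)"
      by (rule expectation_weight_Suc[OF s gl _ intl])
    have "integrable M (\<lambda>x. ?w x * (of_int (level_sum n x) * g x))"
      by (rule integrable_weight_mult[OF s intl])
    then show ?thesis using 2 1 integrable.intros[OF 1] has_bochner_integral_integral_eq[OF 1]
      by (subst Bochner_Integration.integral_diff) (auto simp: mult.assoc)
  qed
  also have "\<dots> = (\<integral>x. real n * (pgf' s / pgf s) * (weight n s x * g x) - weight n s x * (of_int (level_sum n x) * g x) \<partial>M)"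
    using integrable_weight_mult[OF s intg, of n] integrable_weight_mult[OF s intl, of n]
    by (subst Bochner_Integration.integral_diff) (auto simp: mult.assoc)
  also have "\<dots> = (\<integral>x. weight n s x * (n * (pgf' s / pgf s) - of_int (level_sum n x)) * g x \<partial>M)"
    by (rule Bochner_Integration.integral_cong) (auto simp: algebra_simps)
  finally show ?thesis .
qed

end

section \<open>The dynamics on a strip\<close>

definition semigroup_series :: "((array \<Rightarrow> real) \<Rightarrow> array \<Rightarrow> real) \<Rightarrow> real \<Rightarrow> (array \<Rightarrow> real) \<Rightarrow> array \<Rightarrow> real" where
  "semigroup_series G t f x = (\<Sum>n. t ^ n / fact n * (G ^^ n) f x)"

text \<open>\<open>D\<close> acts as a set of states closed under jumps: by linearity, the case B =
  0 of \<open>bound\<close> says that G f on \<open>D\<close> depends only on f on \<open>D\<close>.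
  So exp (t G) can be handled like the exponential of a bounded operator, without passing to
  matrices.\<close>

locale bounded_generator =
  fixes G :: "(array \<Rightarrow> real) \<Rightarrow> array \<Rightarrow> real" and D :: "array set" and C :: real
  assumes C_nonneg: "0 \<le> C"
    and bound: "\<And>f B. (\<And>x. x \<in> D \<Longrightarrow> \<bar>f x\<bar> \<le> B) \<Longrightarrow> (\<And>x. x \<in> D \<Longrightarrow> \<bar>G f x\<bar> \<le> C * B)"
    and linear: "\<And>a b f g. G (\<lambda>x. a * f x + b * g x) = (\<lambda>x. a * G f x + b * G g x)"
begin

lemma power_bound:
  assumes "\<And>x. x \<in> D \<Longrightarrow> \<bar>f x\<bar> \<le> B" "x \<in> D"
  shows "\<bar>(G ^^ n) f x\<bar> \<le> C ^ n * B"
  using assms(2)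
proof (induction n arbitrary: x)
  case (Suc n)
  then show ?case using bound[of "(G ^^ n) f" "C ^ n * B"] by (simp add: mult.assoc)
qed (use assms in simp)

lemma power_linear: "(G ^^ n) (\<lambda>x. a * f x + b * g x) = (\<lambda>x. a * (G ^^ n) f x + b * (G ^^ n) g x)"
  by (induction n) (simp_all add: linear)

lemma power_local:
  assumes "\<And>x. x \<in> D \<Longrightarrow> f x = g x" "x \<in> D" shows "(G ^^ n) f x = (G ^^ n) g x"
proof -
  have "\<bar>(G ^^ n) (\<lambda>x. 1 * f x + (-1) * g x) x\<bar> \<le> C ^ n * 0"
    using assms by (intro power_bound) auto
  then show ?thesis unfolding power_linear by simp
qed

lemma power_sum:
  assumes "finite Y" shows "(G ^^ n) (\<lambda>x. \<Sum>y\<in>Y. f y x) = (\<lambda>x. \<Sum>y\<in>Y. (G ^^ n) (f y) x)"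
  using assms
proof (induction Y rule: finite_induct)
  case empty
  show ?case using power_linear[where n = n and a = 0 and b = 0] by simp
next
  case (insert y Y)
  then show ?case using power_linear[where n = n and a = 1 and b = 1 and f = "f y" and g = "\<lambda>x. \<Sum>y\<in>Y. f y x"] by simp
qed

lemma series_summable:
  assumes "\<And>x. x \<in> D \<Longrightarrow> \<bar>f x\<bar> \<le> B" "x \<in> D"
  shows "summable (\<lambda>n. t ^ n / fact n * (G ^^ n) f x)"
proof (rule summable_comparison_test')
  show "summable (\<lambda>n. (inverse (fact n) * (\<bar>t\<bar> * C) ^ n) * B)"
    by (intro summable_mult2 summable_exp)
  show "norm (t ^ n / fact n * (G ^^ n) f x) \<le> (inverse (fact n) * (\<bar>t\<bar> * C) ^ n) * B" for n
  proof -
    have "norm (t ^ n / fact n * (G ^^ n) f x) \<le> \<bar>t\<bar> ^ n / fact n * (C ^ n * B)"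
      unfolding norm_mult using power_bound[OF assms, where n = n]
      by (intro mult_mono) (auto simp: power_abs)
    then show ?thesis by (simp add: power_mult_distrib field_simps)
  qed
qed

lemma series_local:
  assumes "\<And>x. x \<in> D \<Longrightarrow> f x = g x" "x \<in> D"
  shows "semigroup_series G t f x = semigroup_series G t g x"
  unfolding semigroup_series_def by (simp add: power_local[OF assms])

lemma series_sum:
  assumes "finite Y" "\<And>y x. y \<in> Y \<Longrightarrow> x \<in> D \<Longrightarrow> \<bar>f y x\<bar> \<le> B" "x \<in> D"
  shows "semigroup_series G t (\<lambda>x. \<Sum>y\<in>Y. f y x) x = (\<Sum>y\<in>Y. semigroup_series G t (f y) x)"
  unfolding semigroup_series_def power_sum[OF assms(1)] sum_distrib_left
  using assms by (intro suminf_sum series_summable[where B = B]) auto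

lemma series_DERIV:
  assumes "\<And>x. x \<in> D \<Longrightarrow> \<bar>f x\<bar> \<le> B" "x \<in> D"
  shows "((\<lambda>t. semigroup_series G t f x) has_real_derivative (\<Sum>n. t ^ n / fact n * (G ^^ Suc n) f x)) (at t)"
proof -
  let ?c = "\<lambda>n. (G ^^ n) f x / fact n"
  have "((\<lambda>t. \<Sum>n. ?c n * t ^ n) has_real_derivative (\<Sum>n. diffs ?c n * t ^ n)) (at t)"
    using series_summable[OF assms] by (intro termdiffs_strong_converges_everywhere) (simp add: mult_ac)
  moreover have "diffs ?c n * t ^ n = t ^ n / fact n * (G ^^ Suc n) f x" for n
    by (simp add: diffs_def fact_Suc del: of_nat_Suc)
  ultimately show ?thesis by (simp add: semigroup_series_def mult_ac)
qed

end

section \<open>Finiteness and backward equation of the chain on a strip\<close>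

lemma strip_generator_linear:
  "strip_generator K (\<lambda>x. a * f x + b * g x) = (\<lambda>x. a * strip_generator K f x + b * strip_generator K g x)"
  unfolding strip_generator_def
  by (rule ext) (simp add: sum_distrib_left sum.distrib[symmetric] case_prod_unfold algebra_simps)

text \<open>Contains all states reachable from \<open>x\<close>, since jumps only lower entries, and
  is easier to describe than the reachable set while still finite and closed under jumps.\<close>

definition strip_below :: "nat \<Rightarrow> array \<Rightarrow> array set" where
  "strip_below K x = (\<lambda>z. restrict z (strip K)) ` {z \<in> \<S>\<^sup>c. \<forall>i\<in>strip K. z i \<le> x i}"

lemma strip_subset_array_index: "strip K \<subseteq> array_index"
  by (auto simp: strip_def array_index_def)

lemma eventually_zero_arraysD:
  assumes "x \<in> \<S>\<^sup>c" shows "x \<in> interlacing_arrays" "\<forall>i\<in>array_index. 0 \<le> x i"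
  using assms by (auto simp: eventually_zero_arrays_strip_iff)

lemma jump_allowed_restrict:
  "(k, j) \<in> strip K \<Longrightarrow> jump_allowed (restrict x (strip K)) k j m \<longleftrightarrow> jump_allowed x k j m"
  by (auto simp: jump_allowed_def strip_def)

lemma jump_eventually_zero:
  assumes x: "x \<in> \<S>\<^sup>c" and kj: "1 \<le> j" "j \<le> k" and m: "jump_allowed x k j m"
  shows "x((k, j) := m) \<in> \<S>\<^sup>c"
  unfolding eventually_zero_arrays_strip_iff
proof (intro conjI)
  note xI = eventually_zero_arraysD[OF x]
  have il: "interlacing_upto n x" for n by (rule interlacing_arrays_upto[OF xI(1)])
  have m': "lower k j x \<le> m" "m < x (k, j)" using m by (auto simp: jump_allowed_iff)
  have "m \<le> upper k j x" using interlacing_upto_bounds(2)[OF il kj order_refl] m' by simp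
  then have upd: "interlacing_upto (Suc n) (x((k, j) := m))" if "k \<le> n" for n
    using m' that by (intro interlacing_upto_update[OF il kj])
  show "x((k, j) := m) \<in> interlacing_arrays"
    unfolding interlacing_arrays_def
  proof (intro CollectI conjI allI impI)
    show "x((k, j) := m) \<in> extensional array_index"
      using xI(1) kj by (auto simp: interlacing_arrays_def extensional_def array_index_def)
    fix k' j' assume "1 \<le> j' \<and> j' \<le> (k' :: nat)"
    then show "(x((k, j) := m)) (Suc k', Suc j') \<le> (x((k, j) := m)) (k', j')"
      "(x((k, j) := m)) (k', j') \<le> (x((k, j) := m)) (Suc k', j')"
      using upd[of "max k k'"] unfolding interlacing_upto_def by (meson le_imp_less_Suc max.cobounded1 max.cobounded2)+
  qed
  have "0 \<le> x (Suc k, Suc j)" using xI(2) kj by (simp add: array_index_def)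
  then have "0 \<le> m" using m' by (auto simp: lower_def split: if_splits)
  then show "\<forall>i\<in>array_index. 0 \<le> (x((k, j) := m)) i" using xI(2) by auto
  show "\<forall>K. \<exists>n0. \<forall>n j'. n0 \<le> n \<and> (n, j') \<in> strip K \<longrightarrow> (x((k, j) := m)) (n, j') = 0"
  proof
    fix K
    obtain n0 where n0: "\<And>n j. n0 \<le> n \<Longrightarrow> (n, j) \<in> strip K \<Longrightarrow> x (n, j) = 0"
      using x unfolding eventually_zero_arrays_strip_iff by blast
    show "\<exists>n0. \<forall>n j'. n0 \<le> n \<and> (n, j') \<in> strip K \<longrightarrow> (x((k, j) := m)) (n, j') = 0"
      by (intro exI[of _ "max n0 (Suc k)"]) (use n0 in auto)
  qed
qed

lemma strip_support_finite:
  assumes "x \<in> \<S>\<^sup>c" shows "finite {i \<in> strip K. x i \<noteq> 0}"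
proof -
  obtain n0 where n0: "\<And>n j. n0 \<le> n \<Longrightarrow> (n, j) \<in> strip K \<Longrightarrow> x (n, j) = 0"
    using assms unfolding eventually_zero_arrays_strip_iff by blast
  have "{i \<in> strip K. x i \<noteq> 0} \<subseteq> {..n0} \<times> {..n0}"
  proof
    fix i assume i: "i \<in> {i \<in> strip K. x i \<noteq> 0}"
    obtain n j where nj: "i = (n, j)" by (cases i)
    have "\<not> n0 \<le> n" using n0[of n j] i nj by auto
    moreover have "j \<le> n" using i nj by (auto simp: strip_def)
    ultimately show "i \<in> {..n0} \<times> {..n0}" using nj by simp
  qed
  then show ?thesis by (rule finite_subset) auto
qed

text \<open>Where \<open>x\<close> vanishes the entries are squeezed to 0. Only finitely many
  positions of the strip remain, each with values between 0 and that of \<open>x\<close>.\<close>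

lemma strip_below_finite:
  assumes x: "x \<in> \<S>\<^sup>c" shows "finite (strip_below K x)"
proof -
  let ?S = "{i \<in> strip K. x i \<noteq> 0}"
  have zero: "z i = 0" if "z \<in> \<S>\<^sup>c" "\<forall>i\<in>strip K. z i \<le> x i" "i \<in> strip K" "i \<notin> ?S" for z i
  proof -
    have "0 \<le> z i" using eventually_zero_arraysD(2)[OF that(1)] that(3) strip_subset_array_index[of K] by blast
    moreover have "z i \<le> 0" using that by force
    ultimately show ?thesis by simp
  qed
  have "inj_on (\<lambda>y. restrict y ?S) (strip_below K x)"
  proof (rule inj_onI)
    fix y y' assume y: "y \<in> strip_below K x" "y' \<in> strip_below K x" and eq: "restrict y ?S = restrict y' ?S"
    obtain z z' where z: "y = restrict z (strip K)" "z \<in> \<S>\<^sup>c" "\<forall>i\<in>strip K. z i \<le> x i"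
      "y' = restrict z' (strip K)" "z' \<in> \<S>\<^sup>c" "\<forall>i\<in>strip K. z' i \<le> x i"
      using y unfolding strip_below_def by blast
    show "y = y'"
    proof (rule ext)
      fix i
      consider "i \<notin> strip K" | "i \<in> strip K" "i \<in> ?S" | "i \<in> strip K" "i \<notin> ?S" by blast
      then show "y i = y' i"
      proof cases
        case 2
        then show ?thesis using fun_cong[OF eq, of i] by simp
      next
        case 3
        then show ?thesis using zero[OF z(2,3) 3] zero[OF z(5,6) 3] by (simp add: z)
      qed (simp add: z)
    qed
  qed
  moreover have "(\<lambda>y. restrict y ?S) ` strip_below K x \<subseteq> Pi\<^sub>E ?S (\<lambda>i. {0..x i})"
  proof
    fix w assume "w \<in> (\<lambda>y. restrict y ?S) ` strip_below K x"
    then obtain z where z: "z \<in> \<S>\<^sup>c" "\<forall>i\<in>strip K. z i \<le> x i" "w = restrict (restrict z (strip K)) ?S"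
      unfolding strip_below_def by blast
    show "w \<in> Pi\<^sub>E ?S (\<lambda>i. {0..x i})"
    proof (rule PiE_I)
      fix i assume i: "i \<in> ?S"
      then have "i \<in> array_index" using strip_subset_array_index by blast
      then have "0 \<le> z i" using eventually_zero_arraysD(2)[OF z(1)] by blast
      moreover have "z i \<le> x i" using z(2) i by blast
      ultimately show "w i \<in> {0..x i}" using i by (simp add: z(3))
    qed (auto simp: z(3))
  qed
  moreover have "finite (Pi\<^sub>E ?S (\<lambda>i. {0..x i}))"
    by (intro finite_PiE strip_support_finite[OF x]) auto
  ultimately show ?thesis using finite_imageD finite_subset by blast
qed

lemma strip_below_self: "x \<in> \<S>\<^sup>c \<Longrightarrow> restrict x (strip K) \<in> strip_below K x"
  by (auto simp: strip_below_def)

lemma strip_move_below: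
  assumes "y \<in> strip_below K x" "((k, j), m) \<in> strip_moves K y"
  shows "y((k, j) := m) \<in> strip_below K x"
proof -
  obtain z where z: "y = restrict z (strip K)" "z \<in> \<S>\<^sup>c" "\<forall>i\<in>strip K. z i \<le> x i"
    using assms(1) unfolding strip_below_def by blast
  have kj: "(k, j) \<in> strip K" using assms(2) by (auto simp: strip_moves_def)
  then have kj': "1 \<le> j" "j \<le> k" by (auto simp: strip_def)
  have jump: "jump_allowed z k j m"
    using assms(2) jump_allowed_restrict[OF kj] by (auto simp: strip_moves_def z(1))
  have "z((k, j) := m) \<in> \<S>\<^sup>c" by (rule jump_eventually_zero[OF z(2) kj' jump])
  moreover have "\<forall>i\<in>strip K. (z((k, j) := m)) i \<le> x i"
    using z(3) jump kj by (force simp: jump_allowed_def)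
  moreover have "y((k, j) := m) = restrict (z((k, j) := m)) (strip K)"
    using kj by (auto simp: z(1))
  ultimately show ?thesis unfolding strip_below_def by blast
qed

lemma bounded_generator_strip:
  assumes x: "x \<in> \<S>\<^sup>c"
  obtains C where "bounded_generator (strip_generator K) (strip_below K x) C"
proof
  define rate where "rate = (\<lambda>y. \<Sum>((k, j), m)\<in>strip_moves K y. real k)"
  \<comment> \<open>A difference of two values costs 2 B, and the sum of the exit rates over the
    finite set bounds each single rate.\<close>
  define C where "C = 2 * (\<Sum>y\<in>strip_below K x. rate y)"
  have rate_nonneg: "0 \<le> rate y" for y unfolding rate_def by (intro sum_nonneg) auto
  show "bounded_generator (strip_generator K) (strip_below K x) C"
  proof
    show "0 \<le> C" unfolding C_def using rate_nonneg by (intro mult_nonneg_nonneg sum_nonneg) auto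
    show "strip_generator K (\<lambda>x. a * f x + b * g x) = (\<lambda>x. a * strip_generator K f x + b * strip_generator K g x)" for a b f g
      by (rule strip_generator_linear)
    fix f :: "array \<Rightarrow> real" and B y
    assume f: "\<And>x'. x' \<in> strip_below K x \<Longrightarrow> \<bar>f x'\<bar> \<le> B" and y: "y \<in> strip_below K x"
    have B: "0 \<le> B" using f[OF y] by linarith
    have "strip_generator K f y = (\<Sum>p\<in>strip_moves K y. real (fst (fst p)) * (f (y(fst p := snd p)) - f y))"
      by (simp add: strip_generator_def case_prod_unfold)
    then have "\<bar>strip_generator K f y\<bar> \<le> (\<Sum>p\<in>strip_moves K y. \<bar>real (fst (fst p)) * (f (y(fst p := snd p)) - f y)\<bar>)"
      by simp
    also have "\<dots> \<le> (\<Sum>p\<in>strip_moves K y. real (fst (fst p)) * (2 * B))"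
    proof (rule sum_mono)
      fix p assume p: "p \<in> strip_moves K y"
      obtain k j m where kjm: "p = ((k, j), m)" by (cases p) auto
      have "\<bar>f (y((k, j) := m))\<bar> \<le> B" using strip_move_below[OF y] p kjm by (intro f) auto
      with f[OF y] have "\<bar>f (y((k, j) := m)) - f y\<bar> \<le> 2 * B" by linarith
      then show "\<bar>real (fst (fst p)) * (f (y(fst p := snd p)) - f y)\<bar> \<le> real (fst (fst p)) * (2 * B)"
        unfolding kjm by (simp add: abs_mult mult_left_mono)
    qed
    also have "\<dots> = 2 * rate y * B"
      unfolding rate_def by (simp add: sum_distrib_left sum_distrib_right case_prod_unfold mult_ac)
    also have "\<dots> \<le> C * B"
    proof (rule mult_right_mono[OF _ B])
      have "rate y \<le> (\<Sum>y\<in>strip_below K x. rate y)"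
        using y strip_below_finite[OF x] rate_nonneg by (intro member_le_sum) auto
      then show "2 * rate y \<le> C" by (simp add: C_def)
    qed
    finally show "\<bar>strip_generator K f y\<bar> \<le> C * B" .
  qed
qed

lemma strip_transition_eq: "strip_transition K t x y = semigroup_series (strip_generator K) t (\<lambda>z. if z = y then 1 else 0) x"
  by (simp add: strip_transition_def semigroup_series_def)

abbreviation strip_semigroup :: "nat \<Rightarrow> real \<Rightarrow> (array \<Rightarrow> real) \<Rightarrow> array \<Rightarrow> real" where
  "strip_semigroup K \<equiv> semigroup_series (strip_generator K)"

text \<open>Conservation of mass, as the generator annihilates constants. It shows later that
  \<open>strip_below\<close> carries the whole mass of the transition probabilities.\<close>

lemma strip_semigroup_const: "strip_semigroup K t (\<lambda>_. 1) x = 1"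
proof -
  have "(strip_generator K ^^ n) (\<lambda>_. 1) = (\<lambda>_. 0)" if "n > 0" for n
    using that
  proof (induction n)
    case (Suc n)
    have "strip_generator K (\<lambda>_. c) = (\<lambda>_. 0)" for c
      by (rule ext) (simp add: strip_generator_def case_prod_unfold)
    then show ?case using Suc by (cases n) auto
  qed simp
  then have "strip_semigroup K t (\<lambda>_. 1) x = (\<Sum>n\<in>{0}. t ^ n / fact n * (strip_generator K ^^ n) (\<lambda>_. 1) x)"
    unfolding semigroup_series_def by (intro suminf_finite) auto
  then show ?thesis by simp
qed

lemma strip_semigroup_0: "strip_semigroup K 0 f x = f x"
proof -
  have "strip_semigroup K 0 f x = (\<Sum>n\<in>{0}. 0 ^ n / fact n * (strip_generator K ^^ n) f x)"
    unfolding semigroup_series_def by (intro suminf_finite) auto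
  then show ?thesis by simp
qed

text \<open>The backward equation. The generator can be pulled out of the series, because at a given
  state it is a finite sum over moves that stay in \<open>strip_below\<close>.\<close>

lemma strip_semigroup_DERIV:
  assumes x: "x \<in> \<S>\<^sup>c" and f: "\<And>y. \<bar>f y\<bar> \<le> B"
  shows "((\<lambda>t. strip_semigroup K t f (restrict x (strip K))) has_real_derivative
    strip_generator K (strip_semigroup K t f) (restrict x (strip K))) (at t)"
proof -
  let ?x = "restrict x (strip K)"
  obtain C where "bounded_generator (strip_generator K) (strip_below K x) C" by (rule bounded_generator_strip[OF x])
  then interpret bounded_generator "strip_generator K" "strip_below K x" C .
  note self = strip_below_self[OF x, of K]
  have sm: "(\<lambda>n. t ^ n / fact n * (strip_generator K ^^ n) f y) sums strip_semigroup K t f y" if "y \<in> strip_below K x" for y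
    unfolding semigroup_series_def using series_summable[of f B y t] f that by (intro summable_sums) auto
  have "(\<lambda>n. \<Sum>p\<in>strip_moves K ?x. real (fst (fst p)) *
      (t ^ n / fact n * (strip_generator K ^^ n) f (?x(fst p := snd p)) - t ^ n / fact n * (strip_generator K ^^ n) f ?x)) sums
    (\<Sum>p\<in>strip_moves K ?x. real (fst (fst p)) * (strip_semigroup K t f (?x(fst p := snd p)) - strip_semigroup K t f ?x))"
  proof (intro sums_sum sums_mult sums_diff sm self)
    fix p assume "p \<in> strip_moves K ?x"
    then show "?x(fst p := snd p) \<in> strip_below K x"
      using strip_move_below[OF self] by (cases p; cases "fst p") auto
  qed
  moreover have "(\<Sum>p\<in>strip_moves K ?x. real (fst (fst p)) *
      (t ^ n / fact n * (strip_generator K ^^ n) f (?x(fst p := snd p)) - t ^ n / fact n * (strip_generator K ^^ n) f ?x))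
    = t ^ n / fact n * (strip_generator K ^^ Suc n) f ?x" for n
    by (simp add: strip_generator_def sum_distrib_left case_prod_unfold algebra_simps)
  ultimately have "(\<lambda>n. t ^ n / fact n * (strip_generator K ^^ Suc n) f ?x) sums strip_generator K (strip_semigroup K t f) ?x"
    by (simp add: strip_generator_def case_prod_unfold)
  then have "(\<Sum>n. t ^ n / fact n * (strip_generator K ^^ Suc n) f ?x) = strip_generator K (strip_semigroup K t f) ?x"
    by (rule sums_unique[symmetric])
  then show ?thesis using series_DERIV[of f B ?x t] f self by simp
qed

section \<open>From strip events to cylinders\<close>

lemma space_eventually_zero: "space (restrict_space array_space \<S>\<^sup>c) = \<S>\<^sup>c"
  by (auto simp: space_restrict_space space_array_space eventually_zero_arraysD)

lemma sets_eventually_zeroI: "A \<in> sets array_space \<Longrightarrow> A \<subseteq> \<S>\<^sup>c \<Longrightarrow> A \<in> sets (restrict_space array_space \<S>\<^sup>c)"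
  using eventually_zero_arrays_sets by (auto simp: sets_restrict_space_iff sets.Int_space_eq2)

lemma strip_event_sets:
  assumes "y \<in> \<S>\<^sup>c"
  shows "{z \<in> \<S>\<^sup>c. restrict z (strip K) = restrict y (strip K)} \<in> sets (restrict_space array_space \<S>\<^sup>c)"
proof (rule sets_eventually_zeroI)
  have "{z \<in> \<S>\<^sup>c. restrict z (strip K) = restrict y (strip K)} =
    \<S>\<^sup>c \<inter> {z \<in> space array_space. \<forall>i\<in>strip K. z i \<in> {y i}}"
    by (auto simp: space_array_space eventually_zero_arraysD restrict_def fun_eq_iff simp del: split_paired_All)
  also have "\<dots> \<in> sets array_space"
  proof (intro sets.Int eventually_zero_arrays_sets sets.sets_Collect_countable_All')
    fix i assume "i \<in> strip K"
    then show "{z \<in> space array_space. z i \<in> {y i}} \<in> sets array_space"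
      using coord_set_in_sets[of i "{y i}"] strip_subset_array_index[of K] by (auto simp: space_array_space)
  qed simp
  finally show "{z \<in> \<S>\<^sup>c. restrict z (strip K) = restrict y (strip K)} \<in> sets array_space" .
qed auto

text \<open>The first N levels lie in \<open>strip N\<close>, so that strip decides the cylinder.
  The prescribed probabilities of single states add up over the finite set
  \<open>strip_below\<close>.\<close>

lemma transition_cylinder:
  assumes L: "is_backward_semigroup L" and "\<tau> \<ge> 0" and x: "x \<in> \<S>\<^sup>c"
  shows "measure (L \<tau> x) (cylinder N l \<inter> \<S>\<^sup>c) =
    strip_semigroup N \<tau> (\<lambda>z. if \<forall>i\<in>levels N. z i = l i then 1 else 0) (restrict x (strip N))"
proof -
  let ?R = "restrict_space array_space \<S>\<^sup>c"
  let ?r = "\<lambda>z. restrict z (strip N)"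
  let ?D = "strip_below N x"
  let ?ev = "\<lambda>d. {z \<in> \<S>\<^sup>c. ?r z = d}"
  define A where "A = {d. \<forall>i\<in>levels N. d i = (l i :: int)}"
  have "L \<tau> \<in> ?R \<rightarrow>\<^sub>M prob_algebra ?R" using L \<open>\<tau> \<ge> 0\<close> by (auto simp: is_backward_semigroup_def)
  then have "L \<tau> x \<in> space (prob_algebra ?R)" by (rule measurable_space) (simp add: space_eventually_zero x)
  then have P: "prob_space (L \<tau> x)" and sets_L: "sets (L \<tau> x) = sets ?R" by (auto simp: space_prob_algebra)
  interpret P: prob_space "L \<tau> x" by fact
  obtain C where "bounded_generator (strip_generator N) ?D C" by (rule bounded_generator_strip[OF x])
  then interpret bounded_generator "strip_generator N" ?D C .
  note self = strip_below_self[OF x, of N] and finD = strip_below_finite[OF x, of N]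
  have ev: "?ev d \<in> sets (L \<tau> x)" "measure (L \<tau> x) (?ev d) = strip_semigroup N \<tau> (\<lambda>z. if z = d then 1 else 0) (?r x)"
    if d: "d \<in> ?D" for d
  proof -
    obtain y where y: "y \<in> \<S>\<^sup>c" "d = ?r y" using d by (auto simp: strip_below_def)
    show "?ev d \<in> sets (L \<tau> x)" unfolding sets_L y(2) by (rule strip_event_sets[OF y(1)])
    show "measure (L \<tau> x) (?ev d) = strip_semigroup N \<tau> (\<lambda>z. if z = d then 1 else 0) (?r x)"
      using L \<open>\<tau> \<ge> 0\<close> x y by (auto simp: is_backward_semigroup_def strip_transition_eq)
  qed
  have union: "measure (L \<tau> x) (\<Union>d\<in>E. ?ev d) = strip_semigroup N \<tau> (\<lambda>z. if z \<in> E then 1 else 0) (?r x)"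
    if E: "E \<subseteq> ?D" for E
  proof -
    have fE: "finite E" using E finD finite_subset by blast
    have "measure (L \<tau> x) (\<Union>d\<in>E. ?ev d) = (\<Sum>d\<in>E. measure (L \<tau> x) (?ev d))"
      using E ev(1) by (intro P.finite_measure_finite_Union fE) (auto simp: disjoint_family_on_def)
    also have "\<dots> = (\<Sum>d\<in>E. strip_semigroup N \<tau> (\<lambda>z. if z = d then 1 else 0) (?r x))"
      using E by (intro sum.cong ev(2)) auto
    also have "\<dots> = strip_semigroup N \<tau> (\<lambda>z. \<Sum>d\<in>E. if z = d then 1 else 0) (?r x)"
      by (rule series_sum[symmetric, where B = 1]) (auto simp: fE self)
    also have "(\<lambda>z. \<Sum>d\<in>E. if z = d then 1 else 0 :: real) = (\<lambda>z. if z \<in> E then 1 else 0)"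
      by (rule ext) (simp add: fE del: split_paired_All)
    finally show ?thesis .
  qed
  \<comment> \<open>The listed states exhaust the mass, so no state outside
    \<open>strip_below\<close> can contribute to the cylinder.\<close>
  have "measure (L \<tau> x) (\<Union>d\<in>?D. ?ev d) = strip_semigroup N \<tau> (\<lambda>_. 1) (?r x)"
    unfolding union[OF subset_refl] by (rule series_local) (auto simp: self)
  then have full: "measure (L \<tau> x) (\<Union>d\<in>?D. ?ev d) = 1" by (simp add: strip_semigroup_const)
  have lev: "levels N \<subseteq> strip N" by (auto simp: strip_def)
  have cyl: "cylinder N l \<inter> \<S>\<^sup>c \<in> sets (L \<tau> x)"
    unfolding sets_L by (intro sets_eventually_zeroI sets.Int cylinder_in_sets eventually_zero_arrays_sets) auto
  have in_cyl: "z \<in> cylinder N l \<inter> \<S>\<^sup>c \<longleftrightarrow> z \<in> \<S>\<^sup>c \<and> ?r z \<in> A" for z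
  proof -
    have "?r z \<in> A \<longleftrightarrow> (\<forall>i\<in>levels N. z i = l i)" using lev unfolding A_def by (simp add: subset_iff del: split_paired_All levels_iff)
    also have "(\<forall>i\<in>levels N. z i = l i) \<longleftrightarrow> (\<forall>k j. 1 \<le> j \<and> j \<le> k \<and> k \<le> N \<longrightarrow> z (k, j) = l (k, j))"
      by (auto simp: levels_def array_index_def)
    finally show ?thesis using eventually_zero_arraysD(1)[of z] unfolding cylinder_def by blast
  qed
  have "AE z in L \<tau> x. z \<in> (\<Union>d\<in>?D. ?ev d)"
    by (rule P.AE_prob_1[OF full])
  then have "measure (L \<tau> x) (cylinder N l \<inter> \<S>\<^sup>c) = measure (L \<tau> x) (\<Union>d\<in>?D \<inter> A. ?ev d)"
  proof (intro P.finite_measure_eq_AE)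
    assume "AE z in L \<tau> x. z \<in> (\<Union>d\<in>?D. ?ev d)"
    then show "AE z in L \<tau> x. (z \<in> cylinder N l \<inter> \<S>\<^sup>c) = (z \<in> (\<Union>d\<in>?D \<inter> A. ?ev d))"
      by eventually_elim (subst in_cyl, auto)
    show "(\<Union>d\<in>?D \<inter> A. ?ev d) \<in> sets (L \<tau> x)"
      using ev(1) finD by (intro sets.finite_UN) auto
  qed (rule cyl)
  also have "\<dots> = strip_semigroup N \<tau> (\<lambda>z. if z \<in> ?D \<inter> A then 1 else 0) (?r x)" by (rule union) auto
  also have "\<dots> = strip_semigroup N \<tau> (\<lambda>z. if \<forall>i\<in>levels N. z i = l i then 1 else 0) (?r x)"
    by (rule series_local) (auto simp: self A_def)
  finally show ?thesis .
qed

section \<open>The dynamics on finitely many levels\<close>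

text \<open>By the mean value inequality \<open>B\<close> dominates the difference quotients along
  any sequence. Working within a convex set covers the one-sided derivatives at the ends of
  [0, \<tau>].\<close>

lemma has_real_derivative_integral:
  fixes k k' :: "real \<Rightarrow> 'a \<Rightarrow> real"
  assumes S: "convex S" "s \<in> S"
    and int: "\<And>u. u \<in> S \<Longrightarrow> integrable M (k u)"
    and deriv: "AE x in M. \<forall>u\<in>S. ((\<lambda>u. k u x) has_real_derivative k' u x) (at u within S) \<and> \<bar>k' u x\<bar> \<le> B x"
    and B: "integrable M B" and meas: "k' s \<in> borel_measurable M"
  shows "((\<lambda>u. \<integral>x. k u x \<partial>M) has_real_derivative (\<integral>x. k' s x \<partial>M)) (at s within S)"
  unfolding has_field_derivative_iff tendsto_at_iff_sequentially
proof (intro allI impI)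
  fix X :: "nat \<Rightarrow> real" assume X: "\<forall>i. X i \<in> S - {s}" "X \<longlonglongrightarrow> s"
  have lim: "(\<lambda>i. \<integral>x. (k (X i) x - k s x) / (X i - s) \<partial>M) \<longlonglongrightarrow> (\<integral>x. k' s x \<partial>M)"
  proof (rule integral_dominated_convergence[OF meas _ B])
    show "(\<lambda>x. (k (X i) x - k s x) / (X i - s)) \<in> borel_measurable M" for i
      using int[of "X i"] int[OF S(2)] X(1) by auto
    show "AE x in M. (\<lambda>i. (k (X i) x - k s x) / (X i - s)) \<longlonglongrightarrow> k' s x"
      using deriv
    proof eventually_elim
      case (elim x)
      then have "((\<lambda>u. k u x) has_real_derivative k' s x) (at s within S)" using S(2) by blast
      then have "((\<lambda>y. (k y x - k s x) / (y - s)) \<longlongrightarrow> k' s x) (at s within S)"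
        by (simp add: has_field_derivative_iff)
      then have "((\<lambda>y. (k y x - k s x) / (y - s)) \<circ> X) \<longlonglongrightarrow> k' s x"
        using X unfolding tendsto_at_iff_sequentially by blast
      then show ?case by (simp add: o_def)
    qed
    show "AE x in M. norm ((k (X i) x - k s x) / (X i - s)) \<le> B x" for i
      using deriv
    proof eventually_elim
      case (elim x)
      have "norm (k (X i) x - k s x) \<le> B x * norm (X i - s)"
        by (rule field_differentiable_bound[of S "\<lambda>u. k u x" "\<lambda>u. k' u x"]) (use S X(1) elim in auto)
      then show ?case using X(1) by (auto simp: divide_le_eq)
    qed
  qed
  have eq: "(\<integral>x. (k (X i) x - k s x) / (X i - s) \<partial>M) = ((\<integral>x. k (X i) x \<partial>M) - (\<integral>x. k s x \<partial>M)) / (X i - s)" for i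
    using int[of "X i"] int[OF S(2)] X(1) by simp
  show "((\<lambda>y. ((\<integral>x. k y x \<partial>M) - (\<integral>x. k s x \<partial>M)) / (y - s)) \<circ> X) \<longlonglongrightarrow> (\<integral>x. k' s x \<partial>M)"
    using lim unfolding o_def eq .
qed

text \<open>Continues the first \<open>n\<close> levels by appending zeros to level \<open>n\<close>. Taking the maximum with \<open>0\<close>
  yields an element of \<open>\<S>\<^sup>c\<close> also for arrays with negative entries.\<close>

definition pad :: "nat \<Rightarrow> array \<Rightarrow> array" where
  "pad n x = restrict (\<lambda>i. if snd i \<le> n then max 0 (x (min (fst i) n, snd i)) else 0) array_index"

lemma pad_apply: "1 \<le> j \<Longrightarrow> j \<le> k \<Longrightarrow> pad n x (k, j) = (if j \<le> n then max 0 (x (min k n, j)) else 0)"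
  by (simp add: pad_def array_index_def)

lemma pad_eventually_zero:
  assumes x: "x \<in> interlacing_arrays" shows "pad n x \<in> \<S>\<^sup>c"
  unfolding eventually_zero_arrays_strip_iff
proof (intro conjI)
  show "pad n x \<in> interlacing_arrays"
    unfolding interlacing_arrays_def
  proof (intro CollectI conjI allI impI)
    show "pad n x \<in> extensional array_index" by (simp add: pad_def)
    fix k j :: nat assume kj: "1 \<le> j \<and> j \<le> k"
    have "x (min (Suc k) n, Suc j) \<le> x (min k n, j)" if "Suc j \<le> n"
    proof (cases "k < n")
      case True
      then show ?thesis using interlacing_arraysD(1)[OF x, of j k] kj by simp
    next
      case False
      then show ?thesis using interlacing_arrays_row_mono[OF x, of j "Suc j" n] kj that by simp
    qed
    then show "pad n x (Suc k, Suc j) \<le> pad n x (k, j)"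
      using kj by (auto simp: pad_apply)
    have "x (min k n, j) \<le> x (min (Suc k) n, j)" if "j \<le> n"
    proof (cases "k < n")
      case True
      then show ?thesis using interlacing_arraysD(2)[OF x, of j k] kj by simp
    qed simp
    then show "pad n x (k, j) \<le> pad n x (Suc k, j)"
      using kj by (auto simp: pad_apply)
  qed
  show "\<forall>i\<in>array_index. 0 \<le> pad n x i" by (simp add: pad_def)
  show "\<forall>K. \<exists>n0. \<forall>n' j. n0 \<le> n' \<and> (n', j) \<in> strip K \<longrightarrow> pad n x (n', j) = 0"
  proof
    fix K
    show "\<exists>n0. \<forall>n' j. n0 \<le> n' \<and> (n', j) \<in> strip K \<longrightarrow> pad n x (n', j) = 0"
      by (rule exI[of _ "n + K"]) (auto simp: strip_def pad_apply)
  qed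
qed

lemma determined_by_pad: "determined_by n (pad n)"
proof (rule determined_byI)
  fix x y :: array assume xy: "\<And>i. i \<in> levels n \<Longrightarrow> x i = y i"
  have "x (min k n, j) = y (min k n, j)" if "1 \<le> j" "j \<le> k" "j \<le> n" for k j
    using that by (intro xy) simp
  then show "pad n x = pad n y" by (auto simp: pad_def array_index_def intro!: restrict_ext)
qed

lemma pad_eq:
  assumes "x \<in> \<S>\<^sup>c" "1 \<le> j" "j \<le> k" "k \<le> n" shows "pad n x (k, j) = x (k, j)"
  using assms eventually_zero_arraysD(2)[OF assms(1)] by (simp add: pad_apply array_index_def)

text \<open>Level n is copied to all higher levels by \<open>pad\<close>, so only changes strictly
  below level n commute with it.\<close>

lemma pad_update:
  assumes "1 \<le> j" "j \<le> k" "k < n" "0 \<le> m"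
  shows "pad n (x((k, j) := m)) = (pad n x)((k, j) := m)"
  using assms by (auto simp: pad_def fun_eq_iff array_index_def restrict_def)

text \<open>If \<open>x\<close> vanishes in the strip from level n on, the copies of level n that
  fall into the strip are copies of zeros.\<close>

lemma restrict_pad_eventually:
  assumes x: "x \<in> \<S>\<^sup>c"
  shows "\<forall>\<^sub>F n in sequentially. restrict (pad n x) (strip K) = restrict x (strip K)"
proof -
  obtain n0 where n0: "\<And>n j. n0 \<le> n \<Longrightarrow> (n, j) \<in> strip K \<Longrightarrow> x (n, j) = 0"
    using x unfolding eventually_zero_arrays_strip_iff by blast
  show ?thesis using eventually_ge_at_top[of n0]
  proof eventually_elim
    case (elim n)
    have "pad n x (k, j) = x (k, j)" if kj: "(k, j) \<in> strip K" for k j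
    proof (cases "k \<le> n")
      case True
      then show ?thesis using kj by (intro pad_eq[OF x]) (auto simp: strip_def)
    next
      case False
      have "x (n, j) = 0" if "j \<le> n" using that kj False elim by (intro n0) (auto simp: strip_def)
      moreover have "x (k, j) = 0" using elim False kj by (intro n0) auto
      ultimately show ?thesis using kj False by (auto simp: pad_apply strip_def)
    qed
    then show ?case by (auto intro: restrict_ext)
  qed
qed

lemma lower_pad:
  assumes "x \<in> \<S>\<^sup>c" "1 \<le> j" "j \<le> k" "k < n" shows "lower k j (pad n x) = lower k j x"
  using assms by (auto simp: lower_def pad_eq[OF assms(1)])

text \<open>Above level n an entry equals its neighbour on the level below, which blocks it; at the
  right edge it is 0. Hence a padded array has finitely many levels with jumps.\<close>

lemma pad_no_moves:
  assumes x: "x \<in> \<S>\<^sup>c" and kj: "1 \<le> j" "j \<le> k" "n < k"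
  shows "pad n x (k, j) \<le> lower k j (pad n x)"
proof (cases "j < k")
  case True
  then have "pad n x (k - 1, j) = pad n x (k, j)" using kj by (simp add: pad_apply)
  then show ?thesis using True by (simp add: lower_def)
next
  case False
  then have "pad n x (k, j) = 0" using kj by (simp add: pad_apply)
  moreover have "0 \<le> pad n x (Suc k, Suc j)" using kj by (simp add: pad_apply)
  ultimately show ?thesis using False by (simp add: lower_def)
qed

lemma determined_by_level_generator:
  assumes "k \<le> n" and g: "determined_by (Suc n) g"
  shows "determined_by (Suc n) (level_generator k g)"
proof (rule determined_byI)
  fix x y :: array assume xy: "\<And>i. i \<in> levels (Suc n) \<Longrightarrow> x i = y i"
  have "lower k j x = lower k j y" "x (k, j) = y (k, j)" if "j \<in> {1..k}" for j
    using that assms(1) by (auto intro!: determined_byD[OF determined_by_lower xy] xy)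
  moreover have "g (x((k, j) := m)) = g (y((k, j) := m))" for j m
    using xy by (intro determined_byD[OF g]) auto
  moreover have "g x = g y" by (rule determined_byD[OF g xy])
  ultimately show "level_generator k g x = level_generator k g y"
    unfolding level_generator_def by (intro sum.cong) auto
qed

context one_sided_gibbs begin

lemma expectation_weight_Suc_signed:
  assumes s: "s \<ge> 0" and f: "determined_by n f" "integrable M f"
  shows "(\<integral>x. weight (Suc n) s x * f x \<partial>M) = (\<integral>x. weight n s x * f x \<partial>M)"
proof -
  let ?p = "\<lambda>x. max (f x) 0" and ?m = "\<lambda>x. max (- f x) 0"
  have int: "integrable M ?p" "integrable M ?m"
    using f(2) by (auto intro!: integrable_max)
  have det: "determined_by n ?p" "determined_by n ?m"
    by (rule determined_by_app[OF f(1)])+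
  have split: "(\<integral>x. weight m s x * f x \<partial>M) = (\<integral>x. weight m s x * ?p x \<partial>M) - (\<integral>x. weight m s x * ?m x \<partial>M)" for m
  proof -
    have "(\<integral>x. weight m s x * f x \<partial>M) = (\<integral>x. weight m s x * ?p x - weight m s x * ?m x \<partial>M)"
      by (intro Bochner_Integration.integral_cong) (auto simp: max_def)
    also have "\<dots> = (\<integral>x. weight m s x * ?p x \<partial>M) - (\<integral>x. weight m s x * ?m x \<partial>M)"
      by (intro Bochner_Integration.integral_diff integrable_weight_mult s int)
    finally show ?thesis .
  qed
  show ?thesis
    unfolding split using expectation_weight_Suc[OF s det(1) _ int(1)] expectation_weight_Suc[OF s det(2) _ int(2)] by simp
qed

text \<open>The bracket is the logarithmic derivative of the density, and it is the bracket that
  \<open>expectation_generator\<close> produces.\<close>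

lemma weight_DERIV:
  assumes "s \<ge> 0"
  shows "((\<lambda>s. weight n s x) has_real_derivative
    weight n s x * (n * (pgf' s / pgf s) - of_int (level_sum n x))) (at s)"
proof -
  have p: "pgf s \<noteq> 0" using pgf_pos[OF assms] by simp
  have inv: "((\<lambda>s. inverse (pgf s)) has_real_derivative pgf' s / pgf s * inverse (pgf s)) (at s)"
    using p by (auto intro!: derivative_eq_intros DERIV_pgf[OF assms] simp: field_simps)
  have pow: "((\<lambda>s. inverse (pgf s) ^ n) has_real_derivative real n * (pgf' s / pgf s) * inverse (pgf s) ^ n) (at s)"
  proof (induction n)
    case (Suc n)
    show ?case using DERIV_mult[OF inv Suc] by (simp add: algebra_simps add_divide_distrib)
  qed simp
  have "((\<lambda>s. exp (- s * of_int (level_sum n x))) has_real_derivative exp (- s * of_int (level_sum n x)) * - of_int (level_sum n x)) (at s)"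
    by (auto intro!: derivative_eq_intros)
  from DERIV_mult[OF this pow] show ?thesis
    by (simp add: weight_def divide_inverse power_inverse algebra_simps)
qed

lemma integrable_AE_level_sum:
  assumes "f \<in> borel_measurable M"
    and "\<And>x. x \<in> \<S>\<^sup>c \<Longrightarrow> \<bar>f x\<bar> \<le> c * real_of_int (level_sum n x)"
  shows "integrable M f"
proof (rule Bochner_Integration.integrable_bound)
  show "integrable M (\<lambda>x. c * real_of_int (level_sum n x))"
    by (intro integrable_mult_right integrable_level_sum)
  show "AE x in M. norm (f x) \<le> norm (c * real_of_int (level_sum n x))"
    using AE_eventually_zero
  proof eventually_elim
    case (elim x)
    then show ?case using assms(2)[of x] by simp
  qed
qed fact

end

section \<open>Interpolation between the tilted and the evolved measure\<close>

locale backward_cylinder = one_sided_gibbs +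
  fixes L :: "real \<Rightarrow> array \<Rightarrow> array measure" and N :: nat and l :: array
  assumes L: "is_backward_semigroup L"
begin

definition hit :: "real \<Rightarrow> array \<Rightarrow> real" where
  "hit t x = measure (L t x) (cylinder N l \<inter> \<S>\<^sup>c)"

text \<open>The default 0 keeps the values in [0, 1] also at arrays that do not interlace, since
  \<open>expectation_generator\<close> asks for these bounds everywhere.\<close>

definition hit_pad :: "nat \<Rightarrow> real \<Rightarrow> array \<Rightarrow> real" where
  "hit_pad n t x = (if pad n x \<in> \<S>\<^sup>c then hit t (pad n x) else 0)"

abbreviation "target \<equiv> \<lambda>z :: array. if \<forall>i\<in>levels N. z i = l i then 1 else 0 :: real"

lemma hit_eq: "t \<ge> 0 \<Longrightarrow> x \<in> \<S>\<^sup>c \<Longrightarrow> hit t x = strip_semigroup N t target (restrict x (strip N))"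
  unfolding hit_def by (rule transition_cylinder[OF L])

lemma hit_bounds:
  assumes "t \<ge> 0" "x \<in> \<S>\<^sup>c" shows "0 \<le> hit t x" "hit t x \<le> 1"
proof -
  have "L t \<in> restrict_space array_space \<S>\<^sup>c \<rightarrow>\<^sub>M prob_algebra (restrict_space array_space \<S>\<^sup>c)"
    using L assms by (auto simp: is_backward_semigroup_def)
  then have "L t x \<in> space (prob_algebra (restrict_space array_space \<S>\<^sup>c))"
    by (rule measurable_space) (simp add: space_eventually_zero assms)
  then interpret P: prob_space "L t x" by (simp add: space_prob_algebra)
  show "0 \<le> hit t x" "hit t x \<le> 1" by (simp_all add: hit_def)
qed

lemma hit_pad_bounds:
  assumes "t \<ge> 0" shows "0 \<le> hit_pad n t x" "hit_pad n t x \<le> 1"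
  using hit_bounds[OF assms] by (auto simp: hit_pad_def)

lemma hit_cong:
  "t \<ge> 0 \<Longrightarrow> x \<in> \<S>\<^sup>c \<Longrightarrow> y \<in> \<S>\<^sup>c \<Longrightarrow> restrict x (strip N) = restrict y (strip N) \<Longrightarrow> hit t x = hit t y"
  by (simp add: hit_eq)

lemma determined_by_hit_pad: "determined_by n (hit_pad n t)"
  unfolding hit_pad_def[abs_def] by (rule determined_by_app[OF determined_by_pad])

lemma hit_pad_eq: "x \<in> \<S>\<^sup>c \<Longrightarrow> hit_pad n t x = hit t (pad n x)"
  by (simp add: hit_pad_def pad_eventually_zero eventually_zero_arraysD)

text \<open>The derivative is one-sided at t = 0, because \<open>L\<close> is specified for
  nonnegative times only.\<close>

lemma hit_DERIV:
  assumes x: "x \<in> \<S>\<^sup>c" and "t \<ge> 0"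
  shows "((\<lambda>t. hit t x) has_real_derivative
    strip_generator N (strip_semigroup N t target) (restrict x (strip N))) (at t within {0..})"
proof (rule has_field_derivative_transform_within[where f = "\<lambda>t. strip_semigroup N t target (restrict x (strip N))" and d = 1])
  show "((\<lambda>t. strip_semigroup N t target (restrict x (strip N))) has_real_derivative
    strip_generator N (strip_semigroup N t target) (restrict x (strip N))) (at t within {0..})"
    by (rule has_field_derivative_at_within[OF strip_semigroup_DERIV[OF x, where B = 1]]) simp
qed (use assms hit_eq in auto)

text \<open>The jumps at level \<open>n\<close> of a padded array, which are not jumps of the dynamics on levels
  below \<open>n\<close>.\<close>

definition boundary :: "nat \<Rightarrow> real \<Rightarrow> array \<Rightarrow> real" where
  "boundary n t x = (\<Sum>j\<in>{j \<in> {1..n}. n < j + N}. \<Sum>m\<in>{lower n j (pad n x)..<pad n x (n, j)}.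
     real n * (hit t ((pad n x)((n, j) := m)) - hit t (pad n x)))"

lemma determined_by_boundary: "determined_by n (boundary n t)"
  unfolding boundary_def[abs_def] by (rule determined_by_app[OF determined_by_pad])

text \<open>Below level n the padded array has the same jumps as \<open>x\<close>, above it has
  none. At level n the true level n + 1 is replaced by the padded one, which changes the lower
  bounds; these jumps are kept apart.\<close>

lemma strip_generator_pad:
  assumes t: "t \<ge> 0" and x: "x \<in> \<S>\<^sup>c" and n: "n > 0"
  shows "strip_generator N (strip_semigroup N t target) (restrict (pad n x) (strip N)) =
    (\<Sum>k=1..<n. level_generator k (hit_pad n t) x) + boundary n t x"
proof -
  let ?y = "pad n x"
  let ?r = "\<lambda>z. restrict z (strip N)"
  let ?I = "\<lambda>k. {j \<in> {1..k}. k < j + N}"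
  have y: "?y \<in> \<S>\<^sup>c" using x by (intro pad_eventually_zero eventually_zero_arraysD)
  let ?T = "\<lambda>k j. \<Sum>m\<in>{lower k j ?y..<?y (k, j)}. real k * (hit t (?y((k, j) := m)) - hit t ?y)"
  have moves: "strip_moves N (?r ?y) = (SIGMA p:(SIGMA k:{1..n}. ?I k). {lower (fst p) (snd p) ?y..<?y p})" (is "?A = ?B")
  proof (rule Set.set_eqI)
    fix z :: "(nat \<times> nat) \<times> int"
    obtain k j m where z: "z = ((k, j), m)" by (metis prod.exhaust)
    have "z \<in> ?A \<longleftrightarrow> (k, j) \<in> strip N \<and> m \<in> {lower k j ?y..<?y (k, j)}"
      using jump_allowed_restrict[of k j N ?y m] by (auto simp: z strip_moves_def jump_allowed_iff)
    also have "\<dots> \<longleftrightarrow> (k, j) \<in> strip N \<and> k \<le> n \<and> m \<in> {lower k j ?y..<?y (k, j)}"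
      using pad_no_moves[OF x, of j k n] by (cases "k \<le> n") (auto simp: strip_def not_le)
    also have "\<dots> \<longleftrightarrow> z \<in> ?B" by (auto simp: z strip_def)
    finally show "z \<in> ?A \<longleftrightarrow> z \<in> ?B" .
  qed
  have jump: "?y((k, j) := m) \<in> \<S>\<^sup>c" if "1 \<le> j" "j \<le> k" "m \<in> {lower k j ?y..<?y (k, j)}" for k j m
    using that by (intro jump_eventually_zero[OF y]) (auto simp: jump_allowed_iff)
  have "strip_generator N (strip_semigroup N t target) (?r ?y) =
    (\<Sum>p\<in>(SIGMA k:{1..n}. ?I k). \<Sum>m\<in>{lower (fst p) (snd p) ?y..<?y p}.
      real (fst p) * (strip_semigroup N t target ((?r ?y)(p := m)) - strip_semigroup N t target (?r ?y)))"
    unfolding strip_generator_def moves by (subst sum.Sigma) (auto simp: case_prod_unfold intro!: sum.cong)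
  also have "\<dots> = (\<Sum>k=1..n. \<Sum>j\<in>?I k. \<Sum>m\<in>{lower k j ?y..<?y (k, j)}.
      real k * (strip_semigroup N t target ((?r ?y)((k, j) := m)) - strip_semigroup N t target (?r ?y)))"
    by (subst sum.Sigma) (auto simp: case_prod_unfold intro!: sum.cong)
  also have "\<dots> = (\<Sum>k=1..n. \<Sum>j\<in>?I k. ?T k j)"
  proof (intro sum.cong refl)
    fix k j m assume kj: "k \<in> {1..n}" "j \<in> ?I k" and m: "m \<in> {lower k j ?y..<?y (k, j)}"
    have "(?r ?y)((k, j) := m) = ?r (?y((k, j) := m))" using kj by (auto simp: strip_def)
    then show "real k * (strip_semigroup N t target ((?r ?y)((k, j) := m)) - strip_semigroup N t target (?r ?y)) =
      real k * (hit t (?y((k, j) := m)) - hit t ?y)"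
      using kj m by (simp add: hit_eq[OF t] jump y)
  qed
  also have "\<dots> = (\<Sum>k=1..<n. \<Sum>j\<in>?I k. ?T k j) + (\<Sum>j\<in>?I n. ?T n j)"
  proof -
    have "(\<Sum>k=1..n. F k) = (\<Sum>k=1..<n. F k) + F n" for F :: "nat \<Rightarrow> real"
      using n by (cases n) (simp_all add: atLeastLessThanSuc_atLeastAtMost)
    then show ?thesis .
  qed
  also have "(\<Sum>k=1..<n. \<Sum>j\<in>?I k. ?T k j) = (\<Sum>k=1..<n. level_generator k (hit_pad n t) x)"
  proof (rule sum.cong[OF refl])
    fix k assume k: "k \<in> {1..<n}"
    \<comment> \<open>Jumps outside the strip leave \<open>hit\<close> unchanged, so the sum extends
      to the whole level.\<close>
    have "(\<Sum>j\<in>?I k. ?T k j) = (\<Sum>j=1..k. ?T k j)"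
    proof (rule sum.mono_neutral_left)
      show "\<forall>j\<in>{1..k} - ?I k. ?T k j = 0"
      proof (intro ballI sum.neutral)
        fix j m assume j: "j \<in> {1..k} - ?I k" and m: "m \<in> {lower k j ?y..<?y (k, j)}"
        have "?r (?y((k, j) := m)) = ?r ?y" using j by (auto simp: strip_def restrict_def)
        then have "hit t (?y((k, j) := m)) = hit t ?y"
          using j m by (intro hit_cong[OF t _ y] jump) auto
        then show "real k * (hit t (?y((k, j) := m)) - hit t ?y) = 0" by simp
      qed
    qed auto
    also have "\<dots> = level_generator k (hit_pad n t) x"
      unfolding level_generator_def
    proof (intro sum.cong)
      fix j assume j: "j \<in> {1..k}"
      show "{lower k j ?y..<?y (k, j)} = {lower k j x..<x (k, j)}"
        using j k lower_pad[OF x, of j k n] pad_eq[OF x, of j k n] by simp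
      fix m assume m: "m \<in> {lower k j x..<x (k, j)}"
      have m': "m \<in> {lower k j ?y..<?y (k, j)}"
        using j k m lower_pad[OF x, of j k n] pad_eq[OF x, of j k n] by simp
      have "0 \<le> lower k j x" using j by (intro jump_bounds(1)[OF eventually_zero_arraysD[OF x]]) auto
      then have "pad n (x((k, j) := m)) = ?y((k, j) := m)" using j k m by (intro pad_update) auto
      then have "hit_pad n t (x((k, j) := m)) = hit t (?y((k, j) := m))"
        using jump[of j k m] j m' by (simp add: hit_pad_def)
      then show "real k * (hit t (?y((k, j) := m)) - hit t ?y) = real k * (hit_pad n t (x((k, j) := m)) - hit_pad n t x)"
        by (simp add: hit_pad_eq[OF x])
    qed simp
    finally show "(\<Sum>j\<in>?I k. ?T k j) = level_generator k (hit_pad n t) x" .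
  qed
  also have "(\<Sum>j\<in>?I n. ?T n j) = boundary n t x" by (simp add: boundary_def)
  finally show ?thesis .
qed

lemma sum_jump_bound:
  fixes d :: "int \<Rightarrow> real"
  assumes "\<And>m. m \<in> {a..<b} \<Longrightarrow> \<bar>d m\<bar> \<le> 1" "0 \<le> a" "0 \<le> b"
  shows "\<bar>\<Sum>m\<in>{a..<b}. real k * d m\<bar> \<le> real k * of_int b"
proof -
  have "\<bar>\<Sum>m\<in>{a..<b}. real k * d m\<bar> \<le> (\<Sum>m\<in>{a..<b}. \<bar>real k * d m\<bar>)" by (rule sum_abs)
  also have "\<dots> \<le> (\<Sum>m\<in>{a..<b}. real k)"
    using assms(1) by (intro sum_mono) (auto simp: abs_mult mult_left_le)
  also have "\<dots> = real k * real (nat (b - a))" by simp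
  also have "\<dots> \<le> real k * of_int b" using assms(2,3) by (intro mult_left_mono) auto
  finally show ?thesis .
qed

lemma sum_strip_le:
  assumes x: "x \<in> \<S>\<^sup>c" and n: "N \<le> n"
  shows "(\<Sum>j\<in>{j \<in> {1..n}. n < j + N}. real_of_int (x (n, j))) \<le> real N * of_int (from_right N n x)"
proof (cases "N = 0")
  case False
  let ?I = "{j \<in> {1..n}. n < j + N}"
  have "x (n, j) \<le> from_right N n x" if "j \<in> ?I" for j
  proof -
    have "x (n, j) \<le> x (n, n + 1 - N)"
      using that n False by (intro interlacing_arrays_row_mono[OF eventually_zero_arraysD(1)[OF x]]) auto
    then show ?thesis using False n by (simp add: from_right_def)
  qed
  then have "(\<Sum>j\<in>?I. real_of_int (x (n, j))) \<le> (\<Sum>j\<in>?I. of_int (from_right N n x))"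
    by (intro sum_mono) simp
  also have "\<dots> = real (card ?I) * of_int (from_right N n x)" by simp
  also have "\<dots> \<le> real N * of_int (from_right N n x)"
  proof (rule mult_right_mono)
    have "?I = {n + 1 - N..n}" using n False by auto
    then show "real (card ?I) \<le> real N" by simp
    show "0 \<le> real_of_int (from_right N n x)" using from_right_bounds(1)[OF eventually_zero_arraysD(2)[OF x]] by simp
  qed
  finally show ?thesis .
next
  case True
  then have "{j \<in> {1..n}. n < j + N} = {}" by auto
  then show ?thesis using True by (simp only: sum.empty)
qed

lemma abs_diff_le_1: "0 \<le> a \<Longrightarrow> a \<le> 1 \<Longrightarrow> 0 \<le> b \<Longrightarrow> b \<le> 1 \<Longrightarrow> \<bar>a - b\<bar> \<le> (1 :: real)"
  by linarith

text \<open>At most N entries take part, each no larger than the N-th entry from the right. An entry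
  has at most as many targets as its value, the rate is n, and a jump changes \<open>hit\<close> by
  at most 1.\<close>

lemma boundary_bound:
  assumes t: "t \<ge> 0" and x: "x \<in> \<S>\<^sup>c" and n: "N \<le> n"
  shows "\<bar>boundary n t x\<bar> \<le> real n * real N * of_int (from_right N n x)"
proof -
  let ?y = "pad n x" and ?I = "{j \<in> {1..n}. n < j + N}"
  have y: "?y \<in> \<S>\<^sup>c" using x by (intro pad_eventually_zero eventually_zero_arraysD)
  have "\<bar>boundary n t x\<bar> \<le> (\<Sum>j\<in>?I. \<bar>\<Sum>m\<in>{lower n j ?y..<?y (n, j)}. real n * (hit t (?y((n, j) := m)) - hit t ?y)\<bar>)"
    unfolding boundary_def by (rule sum_abs)
  also have "\<dots> \<le> (\<Sum>j\<in>?I. real n * of_int (x (n, j)))"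
  proof (rule sum_mono)
    fix j assume j: "j \<in> ?I"
    have eq: "?y (n, j) = x (n, j)" using j by (intro pad_eq[OF x]) auto
    have "\<bar>\<Sum>m\<in>{lower n j ?y..<?y (n, j)}. real n * (hit t (?y((n, j) := m)) - hit t ?y)\<bar> \<le> real n * of_int (?y (n, j))"
    proof (rule sum_jump_bound)
      fix m assume "m \<in> {lower n j ?y..<?y (n, j)}"
      then have "?y((n, j) := m) \<in> \<S>\<^sup>c" using j by (intro jump_eventually_zero[OF y]) (auto simp: jump_allowed_iff)
      then show "\<bar>hit t (?y((n, j) := m)) - hit t ?y\<bar> \<le> 1" by (intro abs_diff_le_1 hit_bounds t y)
    next
      show "0 \<le> lower n j ?y" using j by (intro jump_bounds(1)[OF eventually_zero_arraysD[OF y]]) auto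
      show "0 \<le> ?y (n, j)" using eventually_zero_arraysD(2)[OF y] j by (simp add: array_index_def)
    qed
    then show "\<bar>\<Sum>m\<in>{lower n j ?y..<?y (n, j)}. real n * (hit t (?y((n, j) := m)) - hit t ?y)\<bar> \<le> real n * of_int (x (n, j))"
      unfolding eq .
  qed
  also have "\<dots> = real n * (\<Sum>j\<in>?I. of_int (x (n, j)))" by (simp add: sum_distrib_left)
  also have "\<dots> \<le> real n * (real N * of_int (from_right N n x))"
    by (intro mult_left_mono sum_strip_le[OF x n]) auto
  finally show ?thesis by (simp add: mult_ac)
qed

text \<open>Serves integrability for fixed n, where the growth in n is harmless.\<close>

lemma level_generator_bound:
  assumes t: "t \<ge> 0" and x: "x \<in> \<S>\<^sup>c" and k: "k \<le> n"
  shows "\<bar>level_generator k (hit_pad n t) x\<bar> \<le> real n * real n * of_int (level_sum n x)"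
proof -
  have ls: "0 \<le> level_sum n x" by (rule level_sum_nonneg[OF eventually_zero_arraysD(2)[OF x]])
  have "\<bar>level_generator k (hit_pad n t) x\<bar> \<le>
    (\<Sum>j=1..k. \<bar>\<Sum>m\<in>{lower k j x..<x (k, j)}. real k * (hit_pad n t (x((k, j) := m)) - hit_pad n t x)\<bar>)"
    unfolding level_generator_def by (rule sum_abs)
  also have "\<dots> \<le> (\<Sum>j=1..k. real n * of_int (level_sum n x))"
  proof (rule sum_mono)
    fix j assume j: "j \<in> {1..k}"
    have le: "x (k, j) \<le> level_sum n x" using j k by (intro coord_le_level_sum'[OF eventually_zero_arraysD[OF x]]) auto
    have "\<bar>\<Sum>m\<in>{lower k j x..<x (k, j)}. real k * (hit_pad n t (x((k, j) := m)) - hit_pad n t x)\<bar> \<le> real k * of_int (x (k, j))"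
    proof (rule sum_jump_bound)
      show "0 \<le> lower k j x" using j by (intro jump_bounds(1)[OF eventually_zero_arraysD[OF x]]) auto
      show "0 \<le> x (k, j)" using eventually_zero_arraysD(2)[OF x] j by (simp add: array_index_def)
    qed (intro abs_diff_le_1 hit_pad_bounds t)
    also have "\<dots> \<le> real n * of_int (level_sum n x)"
      using le k ls eventually_zero_arraysD(2)[OF x] j by (intro mult_mono) (auto simp: array_index_def)
    finally show "\<bar>\<Sum>m\<in>{lower k j x..<x (k, j)}. real k * (hit_pad n t (x((k, j) := m)) - hit_pad n t x)\<bar> \<le> real n * of_int (level_sum n x)" .
  qed
  also have "\<dots> = real k * (real n * of_int (level_sum n x))" by simp
  also have "\<dots> \<le> real n * (real n * of_int (level_sum n x))" using k ls by (intro mult_right_mono) auto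
  finally show ?thesis by (simp add: mult_ac)
qed

text \<open>A jump of \<open>x\<close> at (n, j) moves the whole column of its copies in the padded
  array. If (n, j) lies outside the strip, so does this column; the entries inside are counted as
  for \<open>boundary\<close>.\<close>

lemma top_level_generator_bound:
  assumes t: "t \<ge> 0" and x: "x \<in> \<S>\<^sup>c" and n: "N \<le> n"
  shows "\<bar>level_generator n (hit_pad n t) x\<bar> \<le> real n * real N * of_int (from_right N n x)"
proof -
  let ?I = "{j \<in> {1..n}. n < j + N}"
  let ?T = "\<lambda>j. \<Sum>m\<in>{lower n j x..<x (n, j)}. real n * (hit_pad n t (x((n, j) := m)) - hit_pad n t x)"
  have "level_generator n (hit_pad n t) x = (\<Sum>j\<in>?I. ?T j)"
    unfolding level_generator_def
  proof (rule sum.mono_neutral_right)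
    show "\<forall>j\<in>{1..n} - ?I. ?T j = 0"
    proof (intro ballI sum.neutral)
      fix j m assume j: "j \<in> {1..n} - ?I" and m: "m \<in> {lower n j x..<x (n, j)}"
      have xm: "x((n, j) := m) \<in> \<S>\<^sup>c" using j m by (intro jump_eventually_zero[OF x]) (auto simp: jump_allowed_iff)
      have "pad n (x((n, j) := m)) (k', j') = pad n x (k', j')" if "(k', j') \<in> strip N" for k' j'
      proof (cases "j' = j \<and> min k' n = n")
        case True
        then show ?thesis using j that by (auto simp: strip_def)
      next
        case False
        then show ?thesis using that by (auto simp: strip_def pad_apply)
      qed
      then have "restrict (pad n (x((n, j) := m))) (strip N) = restrict (pad n x) (strip N)"
        by (auto intro: restrict_ext)
      then have "hit t (pad n (x((n, j) := m))) = hit t (pad n x)"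
        using xm x by (intro hit_cong[OF t] pad_eventually_zero eventually_zero_arraysD)
      then show "real n * (hit_pad n t (x((n, j) := m)) - hit_pad n t x) = 0"
        by (simp add: hit_pad_eq xm x)
    qed
  qed auto
  then have "\<bar>level_generator n (hit_pad n t) x\<bar> \<le> (\<Sum>j\<in>?I. \<bar>?T j\<bar>)" by (simp add: sum_abs)
  also have "\<dots> \<le> (\<Sum>j\<in>?I. real n * of_int (x (n, j)))"
  proof (intro sum_mono sum_jump_bound)
    fix j assume j: "j \<in> ?I"
    show "0 \<le> lower n j x" using j by (intro jump_bounds(1)[OF eventually_zero_arraysD[OF x]]) auto
    show "0 \<le> x (n, j)" using eventually_zero_arraysD(2)[OF x] j by (simp add: array_index_def)
  qed (intro abs_diff_le_1 hit_pad_bounds t)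
  also have "\<dots> = real n * (\<Sum>j\<in>?I. of_int (x (n, j)))" by (simp add: sum_distrib_left)
  also have "\<dots> \<le> real n * (real N * of_int (from_right N n x))"
    by (intro mult_left_mono sum_strip_le[OF x n]) auto
  finally show ?thesis by (simp add: mult_ac)
qed

lemma integrable_from_right_bound:
  assumes "f \<in> borel_measurable M"
    and "\<And>x. x \<in> \<S>\<^sup>c \<Longrightarrow> \<bar>f x\<bar> \<le> real n * real N * of_int (from_right N n x)"
  shows "integrable M f"
proof (rule Bochner_Integration.integrable_bound)
  show "integrable M (\<lambda>x. real n * real N * of_int (from_right N n x))"
    by (intro integrable_mult_right integrable_from_right)
  show "AE x in M. norm (f x) \<le> norm (real n * real N * of_int (from_right N n x))"
    using AE_eventually_zero by eventually_elim (use assms(2) in force)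
qed fact

lemma integrable_boundary: "t \<ge> 0 \<Longrightarrow> N \<le> n \<Longrightarrow> integrable M (boundary n t)"
  by (rule integrable_from_right_bound[OF borel_measurable_determined[OF determined_by_boundary] boundary_bound])

lemma integrable_top_level_generator:
  assumes "t \<ge> 0" "N \<le> n" shows "integrable M (level_generator n (hit_pad n t))"
proof (rule integrable_from_right_bound[OF _ top_level_generator_bound[OF assms(1) _ assms(2)]])
  have "determined_by (Suc n) (hit_pad n t)" by (rule determined_by_mono[OF determined_by_hit_pad]) simp
  then show "level_generator n (hit_pad n t) \<in> borel_measurable M"
    by (intro borel_measurable_determined[OF determined_by_level_generator[OF order_refl]])
qed

lemma hit_pad_measurable [measurable]: "hit_pad n t \<in> borel_measurable M"
  by (rule borel_measurable_determined[OF determined_by_hit_pad])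

lemma integrable_hit_pad: "t \<ge> 0 \<Longrightarrow> integrable M (hit_pad n t)"
  by (rule integrable_const_bound[where B = 1]) (use hit_pad_bounds in auto)

text \<open>Duhamel interpolation: tilt for time s, then the dynamics for the remaining
  time.\<close>

definition interpolation :: "nat \<Rightarrow> real \<Rightarrow> real \<Rightarrow> real" where
  "interpolation n \<tau> s = (\<integral>x. weight n s x * hit_pad n (\<tau> - s) x \<partial>M)"

lemma level_generator_sum_integrable:
  assumes "t \<ge> 0" "n > 0"
  shows "determined_by n (\<lambda>x. \<Sum>k=1..<n. level_generator k (hit_pad n t) x)"
    "integrable M (\<lambda>x. \<Sum>k=1..<n. level_generator k (hit_pad n t) x)"
    "\<And>x. x \<in> \<S>\<^sup>c \<Longrightarrow> \<bar>\<Sum>k=1..<n. level_generator k (hit_pad n t) x\<bar> \<le> real n ^ 3 * of_int (level_sum n x)"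
proof -
  show det: "determined_by n (\<lambda>x. \<Sum>k=1..<n. level_generator k (hit_pad n t) x)"
  proof (rule determined_byI, rule sum.cong[OF refl])
    fix x y :: array and k assume xy: "\<And>i. i \<in> levels n \<Longrightarrow> x i = y i" and k: "k \<in> {1..<n}"
    obtain n' where n': "n = Suc n'" using assms(2) by (cases n) auto
    have "determined_by (Suc n') (level_generator k (hit_pad n t))"
      using k n' determined_by_hit_pad[of n t] by (intro determined_by_level_generator) auto
    then show "level_generator k (hit_pad n t) x = level_generator k (hit_pad n t) y"
      by (rule determined_byD) (rule xy[unfolded n'])
  qed
  show bound: "\<bar>\<Sum>k=1..<n. level_generator k (hit_pad n t) x\<bar> \<le> real n ^ 3 * of_int (level_sum n x)" if x: "x \<in> \<S>\<^sup>c" for x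
  proof -
    have ls: "0 \<le> level_sum n x" by (rule level_sum_nonneg[OF eventually_zero_arraysD(2)[OF x]])
    have "\<bar>\<Sum>k=1..<n. level_generator k (hit_pad n t) x\<bar> \<le> (\<Sum>k=1..<n. \<bar>level_generator k (hit_pad n t) x\<bar>)"
      by (rule sum_abs)
    also have "\<dots> \<le> (\<Sum>k=1..<n. real n * real n * of_int (level_sum n x))"
      by (intro sum_mono level_generator_bound assms x) auto
    also have "\<dots> = real (n - 1) * (real n * real n * of_int (level_sum n x))" by simp
    also have "\<dots> \<le> real n * (real n * real n * of_int (level_sum n x))"
      using ls by (intro mult_right_mono) auto
    finally show ?thesis by (simp add: power3_eq_cube mult_ac)
  qed
  show "integrable M (\<lambda>x. \<Sum>k=1..<n. level_generator k (hit_pad n t) x)"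
    by (rule integrable_AE_level_sum[OF borel_measurable_determined[OF det] bound])
qed

text \<open>Differentiating the density gives, by \<open>expectation_generator\<close>, the
  generators of levels 1 to n. Differentiating the dynamics gives, with a minus sign, those of
  levels 1 to n - 1 and the boundary term. Only the two contributions of level n survive.\<close>

lemma interpolation_DERIV:
  assumes \<tau>: "\<tau> \<ge> 0" and s: "s \<in> {0..\<tau>}" and n: "N \<le> n" "0 < n"
  shows "(interpolation n \<tau> has_real_derivative
    (\<integral>x. weight (Suc n) s x * level_generator n (hit_pad n (\<tau> - s)) x \<partial>M) -
    (\<integral>x. weight n s x * boundary n (\<tau> - s) x \<partial>M)) (at s within {0..\<tau>})"
proof -
  let ?G = "\<lambda>s x. \<Sum>k=1..<n. level_generator k (hit_pad n (\<tau> - s)) x"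
  let ?c = "\<lambda>s. real n * (pgf' s / pgf s)"
  let ?k = "\<lambda>s x. weight n s x * hit_pad n (\<tau> - s) x"
  let ?k' = "\<lambda>s x. weight n s x * (?c s - of_int (level_sum n x)) * hit_pad n (\<tau> - s) x
     - weight n s x * (?G s x + boundary n (\<tau> - s) x)"
  define b where "b = 1 / \<psi> 0 ^ n"
  \<comment> \<open>Majorant for all u in [0, \<tau>], from the bound b of the density,
    \<open>pgf' u \<le> pgf' 0\<close> and \<open>\<psi> 0 \<le> pgf u\<close>.\<close>
  define B where "B = (\<lambda>x. b * (real n * (pgf' 0 / \<psi> 0) + of_int (level_sum n x)) +
     b * (real n ^ 3 * of_int (level_sum n x) + real n * real N * of_int (from_right N n x)))"
  have b: "0 \<le> b" using psi_0_pos by (simp add: b_def)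
  have [measurable]: "boundary n t \<in> borel_measurable M" for t
    by (rule borel_measurable_determined[OF determined_by_boundary])
  have [measurable]: "(\<lambda>x. real_of_int (level_sum n x)) \<in> borel_measurable M"
    by (rule borel_measurable_determined[OF determined_by_app[OF determined_by_level_sum[OF order_refl]]])
  have S: "0 \<le> u" "0 \<le> \<tau> - u" if "u \<in> {0..\<tau>}" for u using that by auto
  have measG: "?G u \<in> borel_measurable M" if "u \<in> {0..\<tau>}" for u
    using level_generator_sum_integrable(1)[OF S(2)[OF that] n(2)] by (rule borel_measurable_determined)
  have pt: "((\<lambda>u. ?k u x) has_real_derivative ?k' u x) (at u within {0..\<tau>}) \<and> \<bar>?k' u x\<bar> \<le> B x"
    if x: "x \<in> \<S>\<^sup>c" and u: "u \<in> {0..\<tau>}" for x u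
  proof
    note u' = S[OF u]
    have y: "pad n x \<in> \<S>\<^sup>c" using x by (intro pad_eventually_zero eventually_zero_arraysD)
    have "((\<lambda>t. hit t (pad n x)) has_real_derivative ?G u x + boundary n (\<tau> - u) x) (at (\<tau> - u) within {0..})"
      using hit_DERIV[OF y u'(2)] strip_generator_pad[OF u'(2) x n(2)] by simp
    then have "((\<lambda>t. hit t (pad n x)) has_real_derivative ?G u x + boundary n (\<tau> - u) x) (at (\<tau> - u) within (\<lambda>u. \<tau> - u) ` {0..\<tau>})"
      by (rule DERIV_subset) auto
    moreover have "((\<lambda>u. \<tau> - u) has_real_derivative -1) (at u within {0..\<tau>})"
      by (auto intro!: derivative_eq_intros)
    ultimately have "((\<lambda>t. hit t (pad n x)) \<circ> (\<lambda>u. \<tau> - u) has_real_derivative (?G u x + boundary n (\<tau> - u) x) * -1) (at u within {0..\<tau>})"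
      by (rule DERIV_image_chain)
    then have hp: "((\<lambda>u. hit_pad n (\<tau> - u) x) has_real_derivative - (?G u x + boundary n (\<tau> - u) x)) (at u within {0..\<tau>})"
      by (simp add: o_def hit_pad_eq[OF x])
    have "((\<lambda>u. weight n u x) has_real_derivative weight n u x * (?c u - of_int (level_sum n x))) (at u within {0..\<tau>})"
      by (rule has_field_derivative_at_within[OF weight_DERIV[OF u'(1)]])
    from DERIV_mult[OF this hp] show "((\<lambda>u. ?k u x) has_real_derivative ?k' u x) (at u within {0..\<tau>})"
      by (simp add: algebra_simps)
    have ls: "0 \<le> level_sum n x" by (rule level_sum_nonneg[OF eventually_zero_arraysD(2)[OF x]])
    have w: "0 \<le> weight n u x" "weight n u x \<le> b"
      using weight_pos[OF u'(1), of n x] weight_le[OF u'(1) ls] by (auto simp: b_def)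
    have c: "0 \<le> ?c u" "?c u \<le> real n * (pgf' 0 / \<psi> 0)"
      using pgf'_nonneg[OF u'(1)] pgf_pos[OF u'(1)] pgf'_le[OF u'(1)] pgf_ge[OF u'(1)] psi_0_pos
      by (auto intro!: mult_left_mono frac_le)
    have h: "0 \<le> hit_pad n (\<tau> - u) x" "hit_pad n (\<tau> - u) x \<le> 1" by (rule hit_pad_bounds[OF u'(2)])+
    have "\<bar>(?c u - of_int (level_sum n x)) * hit_pad n (\<tau> - u) x\<bar> \<le> \<bar>?c u - of_int (level_sum n x)\<bar> * 1"
      unfolding abs_mult using h by (intro mult_left_mono) auto
    also have "\<dots> \<le> real n * (pgf' 0 / \<psi> 0) + of_int (level_sum n x)"
    proof -
      have "\<bar>a - b\<bar> * 1 \<le> A + b" if "0 \<le> a" "a \<le> A" "0 \<le> b" for a b A :: real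
        unfolding mult_1_right abs_le_iff using that by simp
      then show ?thesis using c ls by simp
    qed
    finally have "\<bar>weight n u x * ((?c u - of_int (level_sum n x)) * hit_pad n (\<tau> - u) x)\<bar> \<le> b * (real n * (pgf' 0 / \<psi> 0) + of_int (level_sum n x))"
      unfolding abs_mult[of "weight n u x"] using w b by (intro mult_mono) auto
    moreover have "\<bar>?G u x + boundary n (\<tau> - u) x\<bar> \<le> real n ^ 3 * of_int (level_sum n x) + real n * real N * of_int (from_right N n x)"
      using level_generator_sum_integrable(3)[OF u'(2) n(2) x] boundary_bound[OF u'(2) x n(1)] by linarith
    then have "\<bar>weight n u x * (?G u x + boundary n (\<tau> - u) x)\<bar> \<le> b * (real n ^ 3 * of_int (level_sum n x) + real n * real N * of_int (from_right N n x))"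
      unfolding abs_mult[of "weight n u x"] using w b by (intro mult_mono) auto
    ultimately show "\<bar>?k' u x\<bar> \<le> B x" unfolding B_def mult.assoc by linarith
  qed
  have der: "(interpolation n \<tau> has_real_derivative (\<integral>x. ?k' s x \<partial>M)) (at s within {0..\<tau>})"
    unfolding interpolation_def[abs_def]
  proof (rule has_real_derivative_integral[where B = B])
    show "integrable M (?k u)" if "u \<in> {0..\<tau>}" for u
      by (intro integrable_weight_mult integrable_hit_pad S[OF that])
    show "AE x in M. \<forall>u\<in>{0..\<tau>}. ((\<lambda>u. ?k u x) has_real_derivative ?k' u x) (at u within {0..\<tau>}) \<and> \<bar>?k' u x\<bar> \<le> B x"
      using AE_eventually_zero by eventually_elim (use pt in blast)
    show "integrable M B"
      unfolding B_def
      by (intro Bochner_Integration.integrable_add integrable_mult_right integrable_level_sum integrable_from_right) simp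
    show "?k' s \<in> borel_measurable M" using measG[OF s] by measurable
  qed (use s in auto)
  note s' = S[OF s]
  let ?h = "hit_pad n (\<tau> - s)"
  have intG: "integrable M (?G s)" and detG: "determined_by n (?G s)"
    using level_generator_sum_integrable[OF s'(2) n(2)] by blast+
  note intB = integrable_boundary[OF s'(2) n(1)] and intT = integrable_top_level_generator[OF s'(2) n(1)]
  have intl: "integrable M (\<lambda>x. (?c s - of_int (level_sum n x)) * ?h x)"
  proof (rule Bochner_Integration.integrable_bound)
    show "integrable M (\<lambda>x. ?c s - of_int (level_sum n x))"
      by (intro Bochner_Integration.integrable_diff integrable_level_sum) simp
    show "AE x in M. norm ((?c s - of_int (level_sum n x)) * ?h x) \<le> norm (?c s - of_int (level_sum n x))"
      unfolding norm_mult using hit_pad_bounds[OF s'(2)] by (intro AE_I2 mult_left_le) auto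
  qed measurable
  have "(\<integral>x. weight (Suc n) s x * (\<Sum>k=1..n. level_generator k ?h x) \<partial>M) =
    (\<integral>x. weight n s x * (?c s - of_int (level_sum n x)) * ?h x \<partial>M)"
    by (intro has_bochner_integral_integral_eq expectation_generator s' determined_by_hit_pad hit_pad_bounds)
  moreover have "(\<integral>x. weight (Suc n) s x * (\<Sum>k=1..n. level_generator k ?h x) \<partial>M) =
    (\<integral>x. weight (Suc n) s x * ?G s x \<partial>M) + (\<integral>x. weight (Suc n) s x * level_generator n ?h x \<partial>M)"
  proof -
    have "{1..n} = insert n {1..<n}" using n by auto
    then have "(\<integral>x. weight (Suc n) s x * (\<Sum>k=1..n. level_generator k ?h x) \<partial>M) =
      (\<integral>x. weight (Suc n) s x * ?G s x + weight (Suc n) s x * level_generator n ?h x \<partial>M)"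
      by (simp add: algebra_simps)
    also have "\<dots> = (\<integral>x. weight (Suc n) s x * ?G s x \<partial>M) + (\<integral>x. weight (Suc n) s x * level_generator n ?h x \<partial>M)"
      by (intro Bochner_Integration.integral_add integrable_weight_mult s' intG intT)
    finally show ?thesis .
  qed
  \<comment> \<open>Generators below level n look at the first n levels only, so the density may be
    lowered from level n + 1 to level n.\<close>
  moreover have "(\<integral>x. weight (Suc n) s x * ?G s x \<partial>M) = (\<integral>x. weight n s x * ?G s x \<partial>M)"
    by (rule expectation_weight_Suc_signed[OF s'(1) detG intG])
  moreover have "(\<integral>x. ?k' s x \<partial>M) = (\<integral>x. weight n s x * (?c s - of_int (level_sum n x)) * ?h x \<partial>M) -
    ((\<integral>x. weight n s x * ?G s x \<partial>M) + (\<integral>x. weight n s x * boundary n (\<tau> - s) x \<partial>M))"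
  proof -
    have 1: "integrable M (\<lambda>x. weight n s x * (?c s - of_int (level_sum n x)) * ?h x)"
      using integrable_weight_mult[OF s'(1) intl, of n] by (simp add: mult.assoc)
    have 2: "integrable M (\<lambda>x. weight n s x * (?G s x + boundary n (\<tau> - s) x))"
      by (intro integrable_weight_mult s' Bochner_Integration.integrable_add intG intB)
    have "(\<integral>x. weight n s x * (?G s x + boundary n (\<tau> - s) x) \<partial>M) =
      (\<integral>x. weight n s x * ?G s x \<partial>M) + (\<integral>x. weight n s x * boundary n (\<tau> - s) x \<partial>M)"
      unfolding distrib_left
      by (intro Bochner_Integration.integral_add integrable_weight_mult s' intG intB)
    then show ?thesis using Bochner_Integration.integral_diff[OF 1 2] by simp
  qed
  ultimately show ?thesis using der by simp
qed

text \<open>Mean value inequality in s; the factor 2 counts the two terms of the derivative.\<close>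

lemma interpolation_bound:
  assumes C: "\<And>n s. N \<le> n \<Longrightarrow> 0 \<le> s \<Longrightarrow> (\<integral>x. weight n s x * from_right N n x \<partial>M) \<le> C * decay_rate ^ n"
    and \<tau>: "\<tau> \<ge> 0" and n: "N \<le> n" "0 < n"
  shows "\<bar>interpolation n \<tau> \<tau> - interpolation n \<tau> 0\<bar> \<le> 2 * (real n * real N * (C * decay_rate ^ n)) * \<tau>"
proof -
  \<comment> \<open>One bound for both terms: they carry densities of different levels, but the
    expectation of \<open>from_right N n\<close> is the same for either density.\<close>
  have bd: "\<bar>\<integral>x. weight m s x * f x \<partial>M\<bar> \<le> real n * real N * (C * decay_rate ^ n)"
    if m: "m = n \<or> m = Suc n" and s: "0 \<le> s" and f: "integrable M f"
      "\<And>x. x \<in> \<S>\<^sup>c \<Longrightarrow> \<bar>f x\<bar> \<le> real n * real N * of_int (from_right N n x)" for m s f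
  proof -
    have "\<bar>\<integral>x. weight m s x * f x \<partial>M\<bar> \<le> (\<integral>x. \<bar>weight m s x * f x\<bar> \<partial>M)"
      by (rule integral_abs_bound)
    also have "\<dots> \<le> (\<integral>x. real n * real N * (weight m s x * of_int (from_right N n x)) \<partial>M)"
    proof (rule integral_mono_AE)
      show "integrable M (\<lambda>x. \<bar>weight m s x * f x\<bar>)"
        by (intro integrable_abs integrable_weight_mult s f)
      show "integrable M (\<lambda>x. real n * real N * (weight m s x * of_int (from_right N n x)))"
        by (intro integrable_mult_right integrable_weight_mult s integrable_from_right)
      show "AE x in M. \<bar>weight m s x * f x\<bar> \<le> real n * real N * (weight m s x * of_int (from_right N n x))"
        using AE_eventually_zero
      proof eventually_elim
        case (elim x)
        have "weight m s x * \<bar>f x\<bar> \<le> weight m s x * (real n * real N * of_int (from_right N n x))"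
          using weight_pos[OF s, of m x] by (intro mult_left_mono f(2) elim) simp
        then show ?case using weight_pos[OF s, of m x] by (simp add: abs_mult mult_ac)
      qed
    qed
    also have "\<dots> = real n * real N * (\<integral>x. weight m s x * of_int (from_right N n x) \<partial>M)" by simp
    also have "(\<integral>x. weight m s x * of_int (from_right N n x) \<partial>M) = (\<integral>x. weight n s x * of_int (from_right N n x) \<partial>M)"
    proof (rule expectation_weight_mono[OF s])
      show "determined_by n (\<lambda>x. real_of_int (from_right N n x))"
        by (rule determined_by_app[OF determined_by_from_right])
      show "AE x in M. 0 \<le> real_of_int (from_right N n x)"
        using AE_nonneg by eventually_elim (simp add: from_right_bounds)
    qed (use m integrable_from_right in auto)
    also have "real n * real N * \<dots> \<le> real n * real N * (C * decay_rate ^ n)"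
      by (intro mult_left_mono C n s) auto
    finally show ?thesis .
  qed
  let ?D = "\<lambda>s. (\<integral>x. weight (Suc n) s x * level_generator n (hit_pad n (\<tau> - s)) x \<partial>M) -
    (\<integral>x. weight n s x * boundary n (\<tau> - s) x \<partial>M)"
  have "norm (interpolation n \<tau> \<tau> - interpolation n \<tau> 0) \<le> (2 * (real n * real N * (C * decay_rate ^ n))) * norm (\<tau> - 0)"
  proof (rule field_differentiable_bound[of "{0..\<tau>}"])
    fix s assume s: "s \<in> {0..\<tau>}"
    show "(interpolation n \<tau> has_field_derivative ?D s) (at s within {0..\<tau>})"
      by (rule interpolation_DERIV[OF \<tau> s n])
    have "\<bar>\<integral>x. weight (Suc n) s x * level_generator n (hit_pad n (\<tau> - s)) x \<partial>M\<bar> \<le> real n * real N * (C * decay_rate ^ n)"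
      using s by (intro bd integrable_top_level_generator top_level_generator_bound n(1)) auto
    moreover have "\<bar>\<integral>x. weight n s x * boundary n (\<tau> - s) x \<partial>M\<bar> \<le> real n * real N * (C * decay_rate ^ n)"
      using s by (intro bd integrable_boundary boundary_bound n(1)) auto
    ultimately show "norm (?D s) \<le> 2 * (real n * real N * (C * decay_rate ^ n))"
      unfolding real_norm_def by linarith
  qed (use \<tau> in auto)
  then show ?thesis using \<tau> by simp
qed

text \<open>With no time left \<open>hit\<close> is the indicator of the cylinder, on which the
  density is constant; n \<ge> N ensures that padding leaves the first N levels unchanged.\<close>

lemma interpolation_end:
  assumes \<tau>: "\<tau> \<ge> 0" and n: "N \<le> n"
  shows "interpolation n \<tau> \<tau> = exp (- \<tau> * of_int (level_sum N l)) / pgf \<tau> ^ N * measure M (cylinder N l)"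
proof -
  have cyl_det: "determined_by N (\<lambda>x. target x)"
    by (rule determined_byI) simp
  have int: "integrable M target"
    by (rule integrable_const_bound[where B = 1]) (auto intro: borel_measurable_determined[OF cyl_det])
  have "interpolation n \<tau> \<tau> = (\<integral>x. weight n \<tau> x * target x \<partial>M)"
    unfolding interpolation_def
  proof (rule integral_cong_AE)
    show "AE x in M. weight n \<tau> x * hit_pad n (\<tau> - \<tau>) x = weight n \<tau> x * target x"
      using AE_eventually_zero
    proof eventually_elim
      case (elim x)
      have y: "pad n x \<in> \<S>\<^sup>c" by (intro pad_eventually_zero eventually_zero_arraysD elim)
      have "restrict (pad n x) (strip N) i = x i" if "i \<in> levels N" for i
        using that n pad_eq[OF elim] by (cases i) (auto simp: strip_def)
      then have "target (restrict (pad n x) (strip N)) = target x" by (auto simp del: split_paired_All)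
      then show ?case by (simp add: hit_pad_eq[OF elim] hit_eq[OF order_refl y] strip_semigroup_0)
    qed
    show "(\<lambda>x. weight n \<tau> x * target x) \<in> borel_measurable M" using int by measurable
  qed measurable
  also have "\<dots> = (\<integral>x. weight N \<tau> x * target x \<partial>M)"
    by (rule expectation_weight_mono[OF \<tau> cyl_det _ int n]) simp
  also have "\<dots> = (\<integral>x. exp (- \<tau> * of_int (level_sum N l)) / pgf \<tau> ^ N * indicator (cylinder N l) x \<partial>M)"
  proof (rule Bochner_Integration.integral_cong[OF refl])
    fix x assume "x \<in> space M"
    then have x: "x \<in> interlacing_arrays" by (simp add: space_M)
    have iff: "x \<in> cylinder N l \<longleftrightarrow> (\<forall>i\<in>levels N. x i = l i)"
      using x by (auto simp: cylinder_def levels_def array_index_def)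
    show "weight N \<tau> x * target x = exp (- \<tau> * of_int (level_sum N l)) / pgf \<tau> ^ N * indicator (cylinder N l) x"
    proof (cases "x \<in> cylinder N l")
      case True
      then have "level_sum N x = level_sum N l" by (auto simp: level_sum_def cylinder_def intro!: sum.cong)
      then show ?thesis using True iff by (simp add: weight_def)
    next
      case False
      then show ?thesis unfolding iff by (auto simp: False simp del: split_paired_All)
    qed
  qed
  also have "\<dots> = exp (- \<tau> * of_int (level_sum N l)) / pgf \<tau> ^ N * measure M (cylinder N l)"
    by simp
  finally show ?thesis .
qed

lemma hit_measurable:
  assumes "\<tau> \<ge> 0" shows "(\<lambda>x. indicator \<S>\<^sup>c x * hit \<tau> x) \<in> borel_measurable M"
proof -
  let ?R = "restrict_space array_space \<S>\<^sup>c"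
  have "L \<tau> \<in> ?R \<rightarrow>\<^sub>M prob_algebra ?R" using L assms by (auto simp: is_backward_semigroup_def)
  moreover have "cylinder N l \<inter> \<S>\<^sup>c \<in> sets ?R"
    by (intro sets_eventually_zeroI sets.Int cylinder_in_sets eventually_zero_arrays_sets) auto
  ultimately have "hit \<tau> \<in> borel_measurable ?R"
    unfolding hit_def[abs_def] by (intro measurable_compose[OF _ measurable_measure_prob_algebra])
  then have "(\<lambda>x. indicator \<S>\<^sup>c x *\<^sub>R hit \<tau> x) \<in> borel_measurable array_space"
    using eventually_zero_arrays_sets by (subst (asm) borel_measurable_restrict_space_iff) (auto simp: Int_absorb2 sets.Int_space_eq2)
  then show ?thesis using sets_M by (simp cong: measurable_cong_sets)
qed

text \<open>At s = 0 the padding becomes invisible: in the strip the padded array eventually agrees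
  with x, so dominated convergence yields the true expectation. The distance to the other end of the
  interpolation is at most a constant times n r^n.\<close>

lemma expectation_hit:
  assumes \<tau>: "\<tau> \<ge> 0"
  shows "(\<integral>x. indicator \<S>\<^sup>c x * hit \<tau> x \<partial>M) =
    exp (- \<tau> * of_int (level_sum N l)) / pgf \<tau> ^ N * measure M (cylinder N l)"
proof -
  let ?v = "exp (- \<tau> * of_int (level_sum N l)) / pgf \<tau> ^ N * measure M (cylinder N l)"
  obtain C where C: "C \<ge> 0" "\<And>n s. N \<le> n \<Longrightarrow> 0 \<le> s \<Longrightarrow> (\<integral>x. weight n s x * from_right N n x \<partial>M) \<le> C * decay_rate ^ n"
    using from_right_decay[of N] by blast
  have "(\<lambda>n. interpolation n \<tau> 0) \<longlonglongrightarrow> (\<integral>x. indicator \<S>\<^sup>c x * hit \<tau> x \<partial>M)"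
    unfolding interpolation_def
  proof (rule integral_dominated_convergence[where w = "\<lambda>_. 1"])
    show "AE x in M. (\<lambda>n. weight n 0 x * hit_pad n (\<tau> - 0) x) \<longlonglongrightarrow> indicator \<S>\<^sup>c x * hit \<tau> x"
      using AE_eventually_zero
    proof eventually_elim
      case (elim x)
      have "\<forall>\<^sub>F n in sequentially. weight n 0 x * hit_pad n (\<tau> - 0) x = indicator \<S>\<^sup>c x * hit \<tau> x"
        using restrict_pad_eventually[OF elim, of N]
      proof eventually_elim
        case (elim n)
        have "hit \<tau> (pad n x) = hit \<tau> x"
          using \<open>x \<in> \<S>\<^sup>c\<close> elim by (intro hit_cong[OF \<tau>] pad_eventually_zero eventually_zero_arraysD)
        then show ?case using \<open>x \<in> \<S>\<^sup>c\<close> by (simp add: weight_def pgf_0 hit_pad_eq)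
      qed
      then show ?case by (rule tendsto_eventually)
    qed
    show "AE x in M. norm (weight n 0 x * hit_pad n (\<tau> - 0) x) \<le> 1" for n
      using hit_pad_bounds[OF \<tau>] by (simp add: weight_def pgf_0)
    show "(\<lambda>x. weight n 0 x * hit_pad n (\<tau> - 0) x) \<in> borel_measurable M" for n by measurable
  qed (use hit_measurable[OF \<tau>] in auto)
  moreover have "(\<lambda>n. interpolation n \<tau> 0) \<longlonglongrightarrow> ?v"
  proof -
    have "(\<lambda>n. 2 * (real n * real N * (C * decay_rate ^ n)) * \<tau>) = (\<lambda>n. (2 * real N * C * \<tau>) * (real n * decay_rate ^ n))"
      by (simp add: fun_eq_iff mult_ac)
    moreover have "(\<lambda>n. (2 * real N * C * \<tau>) * (real n * decay_rate ^ n)) \<longlonglongrightarrow> (2 * real N * C * \<tau>) * 0"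
      using psi_0_pos psi_0_le_1 by (intro tendsto_mult_left powser_times_n_limit_0) auto
    ultimately have lim: "(\<lambda>n. 2 * (real n * real N * (C * decay_rate ^ n)) * \<tau>) \<longlonglongrightarrow> 0" by simp
    have "(\<lambda>n. interpolation n \<tau> 0 - ?v) \<longlonglongrightarrow> 0"
    proof (rule Lim_null_comparison[OF _ lim])
      show "\<forall>\<^sub>F n in sequentially. norm (interpolation n \<tau> 0 - ?v) \<le> 2 * (real n * real N * (C * decay_rate ^ n)) * \<tau>"
        using eventually_ge_at_top[of "Suc N"]
      proof eventually_elim
        case (elim n)
        have "\<bar>interpolation n \<tau> \<tau> - interpolation n \<tau> 0\<bar> \<le> 2 * (real n * real N * (C * decay_rate ^ n)) * \<tau>"
          using elim by (intro interpolation_bound C(2) \<tau>) auto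
        then show ?case using interpolation_end[OF \<tau>, of n] elim by (simp add: abs_minus_commute)
      qed
    qed
    then show ?thesis by (simp add: LIM_zero_iff)
  qed
  ultimately show ?thesis by (rule LIMSEQ_unique)
qed

end

section \<open>The action on the Gibbs measure\<close>

lemma (in one_sided_specialization) one_sided_gibbs:
  assumes "is_gibbs_measure \<rho> M" shows "one_sided_gibbs M (spec_psi \<rho>)"
proof -
  interpret prob_space M using assms by (simp add: is_gibbs_measure_def)
  show ?thesis
  proof
    show "sets M = sets array_space" using assms by (simp add: is_gibbs_measure_def)
    show "measure M (cylinder N l) = schur_det (spec_psi \<rho>) N (\<lambda>j. l (N, j))" if "interlacing_upto N l" for N l
      using assms that by (simp add: is_gibbs_measure_def spec_schur_eq)
    show "\<exists>r>1. summable (\<lambda>n. \<bar>spec_psi \<rho> (int n) * r ^ n\<bar>)" using psi_summable by blast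
  qed (auto intro: psi_nonneg_index psi_sums_1 simp: psi_0_nonzero)
qed

context one_sided_gibbs begin

lemma prob_eventually_zero: "measure M \<S>\<^sup>c = 1"
  using AE_eventually_zero eventually_zero_arrays_sets by (subst prob_eq_1) (auto simp: sets_M)

text \<open>The restriction inside \<open>kernel_action\<close> loses no mass, because
  \<open>M\<close> gives \<open>\<S>\<^sup>c\<close> probability 1.\<close>

lemma kernel_action_prob_space:
  assumes L: "is_backward_semigroup L" and \<tau>: "\<tau> \<ge> 0"
  shows "prob_space (kernel_action M (L \<tau>))"
    "measure (kernel_action M (L \<tau>)) (cylinder N l) = (\<integral>x. indicator \<S>\<^sup>c x * measure (L \<tau> x) (cylinder N l \<inter> \<S>\<^sup>c) \<partial>M)"
proof -
  let ?R = "restrict_space array_space \<S>\<^sup>c" and ?M = "restrict_space M \<S>\<^sup>c"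
  have S: "\<S>\<^sup>c \<in> sets M" using eventually_zero_arrays_sets by (simp add: sets_M)
  have setsR: "sets ?M = sets ?R" by (rule sets_restrict_space_cong[OF sets_M])
  have spaceR: "space ?M = \<S>\<^sup>c" using sets_eq_imp_space_eq[OF setsR] by (simp add: space_eventually_zero)
  have "L \<tau> \<in> ?R \<rightarrow>\<^sub>M prob_algebra ?R" using L \<tau> by (auto simp: is_backward_semigroup_def)
  then have K: "L \<tau> \<in> ?M \<rightarrow>\<^sub>M prob_algebra ?R" by (simp cong: measurable_cong_sets add: setsR)
  have K': "L \<tau> \<in> ?M \<rightarrow>\<^sub>M subprob_algebra ?R" by (rule measurable_prob_algebraD[OF K])
  have PM: "prob_space ?M"
    using S prob_eventually_zero by (intro prob_spaceI) (simp add: spaceR emeasure_restrict_space emeasure_eq_measure)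
  interpret PM: prob_space ?M by fact
  have ne: "space ?M \<noteq> {}" by (rule PM.not_empty)
  have PB: "prob_space (?M \<bind> L \<tau>)"
  proof (rule PM.prob_space_bind[OF _ K'])
    show "AE x in ?M. prob_space (L \<tau> x)"
      using measurable_space[OF K] by (intro AE_I2) (auto simp: space_prob_algebra)
  qed
  have setsB: "sets (?M \<bind> L \<tau>) = sets ?R" by (rule sets_bind[OF _ ne]) (use measurable_space[OF K] in \<open>auto simp: space_prob_algebra\<close>)
  have id: "(\<lambda>x. x) \<in> measurable (?M \<bind> L \<tau>) array_space"
  proof -
    have "(\<lambda>x. x) \<in> measurable ?R array_space" by (rule measurable_restrict_space1) simp
    then show ?thesis by (simp cong: measurable_cong_sets add: setsB)
  qed
  show "prob_space (kernel_action M (L \<tau>))"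
    unfolding kernel_action_def by (rule prob_space.prob_space_distr[OF PB id])
  have spaceB: "space (?M \<bind> L \<tau>) = \<S>\<^sup>c" using sets_eq_imp_space_eq[OF setsB] by (simp add: space_eventually_zero)
  let ?C = "cylinder N l \<inter> \<S>\<^sup>c"
  have C: "?C \<in> sets ?R"
    by (intro sets_eventually_zeroI sets.Int cylinder_in_sets eventually_zero_arrays_sets) auto
  have P: "prob_space (L \<tau> x)" if "x \<in> \<S>\<^sup>c" for x
    using measurable_space[OF K, of x] that by (simp add: spaceR space_prob_algebra)
  interpret PB: prob_space "?M \<bind> L \<tau>" by fact
  have "emeasure (?M \<bind> L \<tau>) ?C = (\<integral>\<^sup>+x. emeasure (L \<tau> x) ?C \<partial>?M)"
    by (rule emeasure_bind[OF ne K' C])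
  also have "\<dots> = (\<integral>\<^sup>+x. emeasure (L \<tau> x) ?C * indicator \<S>\<^sup>c x \<partial>M)"
    using S by (subst nn_integral_restrict_space) (auto intro: sets.Int_space_eq2)
  also have "\<dots> = (\<integral>\<^sup>+x. ennreal (indicator \<S>\<^sup>c x * measure (L \<tau> x) ?C) \<partial>M)"
  proof (rule nn_integral_cong)
    fix x
    show "emeasure (L \<tau> x) ?C * indicator \<S>\<^sup>c x = ennreal (indicator \<S>\<^sup>c x * measure (L \<tau> x) ?C)"
    proof (cases "x \<in> \<S>\<^sup>c")
      case True
      interpret L: prob_space "L \<tau> x" by (rule P[OF True])
      show ?thesis using True by (simp add: L.emeasure_eq_measure)
    qed simp
  qed
  also have "\<dots> = ennreal (\<integral>x. indicator \<S>\<^sup>c x * measure (L \<tau> x) ?C \<partial>M)"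
  proof (rule nn_integral_eq_integral)
    interpret backward_cylinder M \<psi> L N l by unfold_locales (rule L)
    have bounds: "0 \<le> indicator \<S>\<^sup>c x * measure (L \<tau> x) ?C \<and> indicator \<S>\<^sup>c x * measure (L \<tau> x) ?C \<le> 1" for x
      using hit_bounds[OF \<tau>, of x] unfolding hit_def by (cases "x \<in> \<S>\<^sup>c") auto
    show "integrable M (\<lambda>x. indicator \<S>\<^sup>c x * measure (L \<tau> x) ?C)"
      using hit_measurable[OF \<tau>] bounds unfolding hit_def
      by (intro integrable_const_bound[where B = 1]) auto
    show "AE x in M. 0 \<le> indicator \<S>\<^sup>c x * measure (L \<tau> x) ?C" using bounds by simp
  qed
  finally have "measure (?M \<bind> L \<tau>) ?C = (\<integral>x. indicator \<S>\<^sup>c x * measure (L \<tau> x) ?C \<partial>M)"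
    unfolding PB.emeasure_eq_measure by (subst (asm) ennreal_inj) (auto intro!: integral_nonneg_AE)
  then show "measure (kernel_action M (L \<tau>)) (cylinder N l) = (\<integral>x. indicator \<S>\<^sup>c x * measure (L \<tau> x) (cylinder N l \<inter> \<S>\<^sup>c) \<partial>M)"
    unfolding kernel_action_def by (subst measure_distr[OF id cylinder_in_sets]) (simp add: spaceB)
qed

end

theorem theorem8p5:
  fixes \<rho> :: specialization and L :: "real \<Rightarrow> array \<Rightarrow> array measure"
    and M :: "array measure" and \<tau> :: real
  assumes "is_specialization \<rho>"
    and "\<forall>i. alpha_minus \<rho> i = 0" and "\<forall>i. beta_minus \<rho> i = 0" and "gamma_minus \<rho> = 0"
    and "beta_plus \<rho> 0 < 1"
    and "is_backward_semigroup L"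
    and "is_gibbs_measure \<rho> M"
    and "\<tau> \<ge> 0"
  shows "is_specialization (backward_spec \<tau> \<rho>) \<and>
         is_gibbs_measure (backward_spec \<tau> \<rho>) (kernel_action M (L \<tau>))"
proof
  interpret one_sided_specialization \<rho> using assms by unfold_locales auto
  interpret one_sided_gibbs M "spec_psi \<rho>" by (rule one_sided_gibbs[OF assms(7)])
  show "is_specialization (backward_spec \<tau> \<rho>)" by (rule is_specialization_backward[OF assms(8)])
  have psi: "spec_psi (backward_spec \<tau> \<rho>) = (\<lambda>m. exp (- \<tau>) powi m * spec_psi \<rho> m / pgf \<tau>)"
    by (rule ext) (simp add: spec_psi_backward[OF assms(8)] pgf_def)
  have "measure (kernel_action M (L \<tau>)) (cylinder N l) = spec_schur (backward_spec \<tau> \<rho>) N (\<lambda>j. l (N, j))"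
    if l: "interlacing_upto N l" for N l
  proof -
    interpret backward_cylinder M "spec_psi \<rho>" L N l by unfold_locales (rule assms(6))
    have "measure (kernel_action M (L \<tau>)) (cylinder N l) =
      exp (- \<tau> * of_int (level_sum N l)) / pgf \<tau> ^ N * measure M (cylinder N l)"
      unfolding kernel_action_prob_space(2)[OF assms(6,8)] using expectation_hit[OF assms(8)] by (simp add: hit_def)
    also have "exp (- \<tau> * of_int (level_sum N l)) = exp (- \<tau>) powi (\<Sum>j=1..N. l (N, j))"
      by (simp add: exp_power_int level_sum_def mult.commute)
    also have "measure M (cylinder N l) = schur_det (spec_psi \<rho>) N (\<lambda>j. l (N, j))"
      by (rule measure_cylinder[OF l])
    \<comment> \<open>By \<open>schur_det_scale\<close>, the tilted coefficients produce the same
      factor on the determinant of \<open>M\<close>.\<close>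
    finally show ?thesis
      unfolding spec_schur_eq psi by (subst schur_det_scale) simp_all
  qed
  then show "is_gibbs_measure (backward_spec \<tau> \<rho>) (kernel_action M (L \<tau>))"
    unfolding is_gibbs_measure_def using kernel_action_prob_space(1)[OF assms(6,8)]
    by (auto simp: kernel_action_def)
qed

end
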